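(* Let $P$ be a submonoid of a group $G$. The following are equivalent: (1) the quotient map $q_u\colon\mathcal T_u(P)\to\mathbb C\times_{\mathbb C^P}P$ is an isomorphism; (2) no finite collection of proper constructible right ideals is a foundation set for $P$; (3) for every nonempty constructible right ideal $S$ in $P$, no finite collection of constructible right ideals is a proper foundation set for $S$.
   Context: $e$ is the identity of $G$. A word is a finite sequence $\alpha=(p_1,p_2,\ldots,p_{2k-1},p_{2k})$ of even length $2k\ge 0$ with entries in $P$; $\mathcal W$ is the set of all words (including the empty word). Put $\dot\alpha:=p_1^{-1}p_2\cdots p_{2k-1}^{-1}p_{2k}\in G$ (equal to $e$ for the empty word); $\alpha$ is neutral if $\dot\alpha=e$. Put $K(\alpha):=P\cap p_{2k}^{-1}p_{2k-1}P\cap p_{2k}^{-1}p_{2k-1}p_{2k-2}^{-1}p_{2k-3}P\cap\cdots\cap p_{2k}^{-1}p_{2k-1}\cdots p_2^{-1}p_1P$ (equal to $P$ for the empty word), and $\mathfrak J:=\{K(\alpha):\alpha\in\mathcal W\}$, the constructible right ideals (proper means different from $P$). For a map $w\colon P\to B$ into a unital $\mathrm C^*$-algebra, $\dot w_\alpha:=w_{p_1}^*w_{p_2}\cdots w_{p_{2k-1}}^*w_{p_{2k}}$ ($=1$ for the empty word). $\mathcal T_u(P)$ is the universal $\mathrm C^*$-algebra with generators $\{t_p:p\in P\}$ subject to: (T1) $t_e=1$; (T2) $\dot t_\alpha=0$ if $\alpha$ is neutral and $K(\alpha)=\emptyset$; (T3) $\dot t_\alpha=\dot t_\beta$ if $\alpha,\beta$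 are neutral and $K(\alpha)=K(\beta)$; (T4) $\prod_{\beta\in F}(\dot t_\alpha-\dot t_\beta)=0$ if $\alpha$ is neutral and $F$ is a finite set of neutral words with $K(\alpha)=\bigcup_{\beta\in F}K(\beta)$. For $S\in\mathfrak J$, a finite collection $\mathcal C\subset\mathfrak J$ is a foundation set for $S$ if $R\subset S$ for all $R\in\mathcal C$ and $pP\cap\bigcup_{R\in\mathcal C}R\neq\emptyset$ for all $p\in S$; it is a proper foundation set for $S$ if moreover $S\setminus\bigcup_{R\in\mathcal C}R\neq\emptyset$. $L_p\delta_q=\delta_{pq}$ is the left regular representation on $\ell^2(P)$; for neutral $\alpha$, $\dot L_\alpha$ is multiplication by $\mathbb 1_{K(\alpha)}$; $D_r:=\overline{\mathrm{span}}\{\mathbb 1_S:S\in\mathfrak J\}$. For finite $F\subseteq G$, $\Delta_F:=\{p\in P:\forall g\in F,\ pP\cap gP=\emptyset\text{ or }pP\cap gP=pP\}$; $D_r^{\mathrm o}:=\{b\in D_r:\lim_F\|b|_{\ell^2(\Delta_F)}\|=0\}$ (limit over finite $F\subseteq G$ directed by inclusion). An isometric representation $w\colon P\to B$ is strongly covariant if $\dot L_\alpha\mapsto\dot w_\alpha$ ($\alpha$ neutral) extends to a well-defined $*$-homomorphism $D_r\to B$ that factors through $D_r/D_r^{\mathrm o}$; the covariance algebra $\mathbb C\times_{\mathbb C^P}P$ is the universal $\mathrm C^*$-algebra for strongly covariant isometric representations, with canonical generators $j_p$, and $q_u\colon\mathcal T_u(P)\to\mathbb C\times_{\mathbb C^P}P$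 is the canonical surjective $*$-homomorphism with $q_u(t_p)=j_p$.
   Formalization: In relation (T4) the finite set F is taken to be nonempty; with F empty and K(α) empty the empty product would force 1 = 0 and collapse the universal Toeplitz algebra (e.g. for a free monoid on two generators), so q_u would not exist. That case is covered by (T2). *)

theory Defs
  imports "HOL-Algebra.Coset" "HOL-Algebra.Module" "HOL-Analysis.Infinite_Sum"
begin

section \<open>Unital C*-algebras on carrier sets\<close>

record 'b cstar = "(complex, 'b) module" +
  adj :: "'b \<Rightarrow> 'b"
  nrm :: "'b \<Rightarrow> real"

text \<open>The zero algebra is not excluded.\<close>

locale cstar_algebra = ring A for A :: "'b cstar" (structure) +
  assumes smult_closed: "x \<in> carrier A \<Longrightarrow> c \<odot> x \<in> carrier A"
    and smult_add_left: "x \<in> carrier A \<Longrightarrow> (c + d) \<odot> x = c \<odot> x \<oplus> d \<odot> x"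
    and smult_add_right: "x \<in> carrier A \<Longrightarrow> y \<in> carrier A \<Longrightarrow> c \<odot> (x \<oplus> y) = c \<odot> x \<oplus> c \<odot> y"
    and smult_smult: "x \<in> carrier A \<Longrightarrow> c \<odot> (d \<odot> x) = (c * d) \<odot> x"
    and smult_one: "x \<in> carrier A \<Longrightarrow> 1 \<odot> x = x"
    and smult_mult_left: "x \<in> carrier A \<Longrightarrow> y \<in> carrier A \<Longrightarrow> (c \<odot> x) \<otimes> y = c \<odot> (x \<otimes> y)"
    and smult_mult_right: "x \<in> carrier A \<Longrightarrow> y \<in> carrier A \<Longrightarrow> x \<otimes> (c \<odot> y) = c \<odot> (x \<otimes> y)"
    and adj_closed: "x \<in> carrier A \<Longrightarrow> adj A x \<in> carrier A"
    and adj_adj: "x \<in> carrier A \<Longrightarrow> adj A (adj A x) = x"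
    and adj_add: "x \<in> carrier A \<Longrightarrow> y \<in> carrier A \<Longrightarrow> adj A (x \<oplus> y) = adj A x \<oplus> adj A y"
    and adj_smult: "x \<in> carrier A \<Longrightarrow> adj A (c \<odot> x) = cnj c \<odot> adj A x"
    and adj_mult: "x \<in> carrier A \<Longrightarrow> y \<in> carrier A \<Longrightarrow> adj A (x \<otimes> y) = adj A y \<otimes> adj A x"
    and nrm_nonneg: "x \<in> carrier A \<Longrightarrow> 0 \<le> nrm A x"
    and nrm_eq_0: "x \<in> carrier A \<Longrightarrow> nrm A x = 0 \<longleftrightarrow> x = \<zero>"
    and nrm_add: "x \<in> carrier A \<Longrightarrow> y \<in> carrier A \<Longrightarrow> nrm A (x \<oplus> y) \<le> nrm A x + nrm A y"
    and nrm_smult: "x \<in> carrier A \<Longrightarrow> nrm A (c \<odot> x) = cmod c * nrm A x"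
    and nrm_mult: "x \<in> carrier A \<Longrightarrow> y \<in> carrier A \<Longrightarrow> nrm A (x \<otimes> y) \<le> nrm A x * nrm A y"
    and cstar_identity: "x \<in> carrier A \<Longrightarrow> nrm A (adj A x \<otimes> x) = (nrm A x)\<^sup>2"
    and complete: "range X \<subseteq> carrier A \<Longrightarrow>
      (\<forall>e>0. \<exists>N. \<forall>m\<ge>N. \<forall>n\<ge>N. nrm A (X m \<ominus> X n) < e) \<Longrightarrow>
      \<exists>l\<in>carrier A. (\<lambda>n. nrm A (X n \<ominus> l)) \<longlonglongrightarrow> (0::real)"

definition star_hom :: "'a cstar \<Rightarrow> 'b cstar \<Rightarrow> ('a \<Rightarrow> 'b) \<Rightarrow> bool" where
  "star_hom A B \<phi> \<longleftrightarrow> \<phi> \<in> carrier A \<rightarrow> carrier B \<and>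
     (\<forall>x\<in>carrier A. \<forall>y\<in>carrier A. \<phi> (x \<oplus>\<^bsub>A\<^esub> y) = \<phi> x \<oplus>\<^bsub>B\<^esub> \<phi> y) \<and>
     (\<forall>x\<in>carrier A. \<forall>y\<in>carrier A. \<phi> (x \<otimes>\<^bsub>A\<^esub> y) = \<phi> x \<otimes>\<^bsub>B\<^esub> \<phi> y) \<and>
     (\<forall>c. \<forall>x\<in>carrier A. \<phi> (c \<odot>\<^bsub>A\<^esub> x) = c \<odot>\<^bsub>B\<^esub> \<phi> x) \<and>
     (\<forall>x\<in>carrier A. \<phi> (adj A x) = adj B (\<phi> x))"

definition star_iso :: "'a cstar \<Rightarrow> 'b cstar \<Rightarrow> ('a \<Rightarrow> 'b) \<Rightarrow> bool" where
  "star_iso A B \<phi> \<longleftrightarrow> star_hom A B \<phi> \<and> bij_betw \<phi> (carrier A) (carrier B)"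

definition closed_subspace :: "'b cstar \<Rightarrow> 'b set \<Rightarrow> bool" where
  "closed_subspace A V \<longleftrightarrow> V \<subseteq> carrier A \<and> \<zero>\<^bsub>A\<^esub> \<in> V \<and>
     (\<forall>x\<in>V. \<forall>y\<in>V. x \<oplus>\<^bsub>A\<^esub> y \<in> V) \<and> (\<forall>c. \<forall>x\<in>V. c \<odot>\<^bsub>A\<^esub> x \<in> V) \<and>
     (\<forall>x\<in>carrier A. (\<forall>e>0. \<exists>v\<in>V. nrm A (x \<ominus>\<^bsub>A\<^esub> v) < e) \<longrightarrow> x \<in> V)"

definition closed_span :: "'b cstar \<Rightarrow> 'b set \<Rightarrow> 'b set" where
  "closed_span A X = \<Inter> {V. closed_subspace A V \<and> X \<subseteq> V}"

definition cstar_subalgebra :: "'b cstar \<Rightarrow> 'b set \<Rightarrow> bool" where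
  "cstar_subalgebra A V \<longleftrightarrow> closed_subspace A V \<and> \<one>\<^bsub>A\<^esub> \<in> V \<and>
     (\<forall>x\<in>V. \<forall>y\<in>V. x \<otimes>\<^bsub>A\<^esub> y \<in> V) \<and> (\<forall>x\<in>V. adj A x \<in> V)"

definition generated_subalgebra :: "'b cstar \<Rightarrow> 'b set \<Rightarrow> 'b set" where
  "generated_subalgebra A X = \<Inter> {V. cstar_subalgebra A V \<and> X \<subseteq> V}"

text \<open>The \<open>\<ell>\<^sup>\<infinity>\<close>-direct product.\<close>

definition cstar_product :: "'i set \<Rightarrow> ('i \<Rightarrow> 'b cstar) \<Rightarrow> ('i \<Rightarrow> 'b) cstar" where
  "cstar_product I B =
    \<lparr> carrier = {x \<in> \<Pi>\<^sub>E i\<in>I. carrier (B i). bdd_above ((\<lambda>i. nrm (B i) (x i)) ` I)},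
      monoid.mult = (\<lambda>x y. \<lambda>i\<in>I. x i \<otimes>\<^bsub>B i\<^esub> y i),
      one = (\<lambda>i\<in>I. \<one>\<^bsub>B i\<^esub>),
      zero = (\<lambda>i\<in>I. \<zero>\<^bsub>B i\<^esub>),
      add = (\<lambda>x y. \<lambda>i\<in>I. x i \<oplus>\<^bsub>B i\<^esub> y i),
      smult = (\<lambda>c x. \<lambda>i\<in>I. c \<odot>\<^bsub>B i\<^esub> x i),
      adj = (\<lambda>x. \<lambda>i\<in>I. adj (B i) (x i)),
      nrm = (\<lambda>x. SUP i\<in>I. nrm (B i) (x i)) \<rparr>"


section \<open>Universal C*-algebras\<close>

text \<open>
  HOL cannot quantify over all C*-algebras of all types at once, so representations are taken in
  C*-algebras carried by subsets of one type, chosen large enough to lose nothing: if a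
  C*-algebra \<open>B\<close> on any type is generated by a family \<open>w\<close> indexed by elements of type \<open>'g\<close>, then
  the *-polynomials in \<open>w\<close> are dense, so an element \<open>b\<close> is determined by the function sending a
  *-polynomial \<open>e\<close> to the distance from \<open>b\<close> to \<open>e(w)\<close>. Hence \<open>B\<close> has an isometric copy with
  carrier in \<open>'g universe\<close>; see \<open>universe_copy\<close>.
\<close>

datatype 'g star_poly =
    Gen 'g
  | Scalar complex
  | Plus "'g star_poly" "'g star_poly"
  | Times "'g star_poly" "'g star_poly"
  | Star "'g star_poly"

type_synonym 'g universe = "'g star_poly \<Rightarrow> real"

type_synonym 'g rep = "'g universe cstar \<times> ('g \<Rightarrow> 'g universe)"

definition reps :: "'g set \<Rightarrow> ('g universe cstar \<Rightarrow> ('g \<Rightarrow> 'g universe) \<Rightarrow> bool) \<Rightarrow> 'g rep set" where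
  "reps P R = {(B, w). cstar_algebra B \<and> w \<in> P \<rightarrow> carrier B \<and> R B w}"

text \<open>
  The universal C*-algebra for the class \<open>R\<close> of maps on \<open>P\<close> is the C*-algebra generated, inside the
  product over all members \<open>(B, w)\<close> of \<open>R\<close>, by the families \<open>(w p)\<^bsub>(B, w)\<^esub>\<close>, provided that for
  each \<open>p\<close> the norms of the \<open>w p\<close> are bounded. (In both cases below \<open>w p\<close> is an isometry; for
  the Toeplitz algebra this is (T3) applied to the word \<open>(p, p)\<close> and the empty word.) Coordinate
  projections are the *-homomorphisms demanded by the universal property; see
  \<open>universal_cstar_algebra\<close>.
\<close>

definition universal_gen ::
  "'g set \<Rightarrow> ('g universe cstar \<Rightarrow> ('g \<Rightarrow> 'g universe) \<Rightarrow> bool) \<Rightarrow> 'g \<Rightarrow> 'g rep \<Rightarrow> 'g universe" where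
  "universal_gen P R p = (\<lambda>i\<in>reps P R. snd i p)"

definition universal_cstar ::
  "'g set \<Rightarrow> ('g universe cstar \<Rightarrow> ('g \<Rightarrow> 'g universe) \<Rightarrow> bool) \<Rightarrow> ('g rep \<Rightarrow> 'g universe) cstar" where
  "universal_cstar P R =
     (let A = cstar_product (reps P R) fst
      in A\<lparr>carrier := generated_subalgebra A (universal_gen P R ` P)\<rparr>)"


subsection \<open>The choice of universe and the universal construction are adequate\<close>

primrec poly_value :: "'b cstar \<Rightarrow> 'g set \<Rightarrow> ('g \<Rightarrow> 'b) \<Rightarrow> 'g star_poly \<Rightarrow> 'b" where
  "poly_value B P w (Gen p) = (if p \<in> P then w p else \<zero>\<^bsub>B\<^esub>)"
| "poly_value B P w (Scalar c) = c \<odot>\<^bsub>B\<^esub> \<one>\<^bsub>B\<^esub>"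
| "poly_value B P w (Plus d e) = poly_value B P w d \<oplus>\<^bsub>B\<^esub> poly_value B P w e"
| "poly_value B P w (Times d e) = poly_value B P w d \<otimes>\<^bsub>B\<^esub> poly_value B P w e"
| "poly_value B P w (Star e) = adj B (poly_value B P w e)"

context cstar_algebra
begin

lemma smult_zero: "x \<in> carrier A \<Longrightarrow> 0 \<odot> x = \<zero>"
  using nrm_smult[of x 0] nrm_eq_0[of "0 \<odot> x"] smult_closed[of x 0] by simp

lemma nrm_minus: assumes "x \<in> carrier A" "y \<in> carrier A" shows "nrm A (x \<ominus> y) = nrm A (y \<ominus> x)"
proof -
  have u: "\<ominus> z = (-1) \<odot> z" if "z \<in> carrier A" for z
  proof -
    have "(-1) \<odot> z \<oplus> z = \<zero>"
      using smult_add_left[of z "-1" 1] smult_one[OF that] smult_zero[OF that] that by simp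
    then show ?thesis
      using minus_equality that smult_closed[OF that] by blast
  qed
  have "x \<ominus> y = \<ominus> (y \<ominus> x)"
    using assms by (simp add: minus_eq minus_add a_comm)
  also have "\<dots> = (-1) \<odot> (y \<ominus> x)"
    using assms u by simp
  finally show ?thesis
    using assms nrm_smult[of "y \<ominus> x" "-1"] by simp
qed

lemma nrm_tri: assumes "x \<in> carrier A" "y \<in> carrier A" "z \<in> carrier A"
  shows "nrm A (x \<ominus> z) \<le> nrm A (x \<ominus> y) + nrm A (y \<ominus> z)"
proof -
  have "x \<ominus> z = (x \<ominus> y) \<oplus> (y \<ominus> z)"
    using assms by algebra
  then show ?thesis
    using nrm_add[of "x \<ominus> y" "y \<ominus> z"] assms by simp
qed

lemma nrm_adj_le: assumes "x \<in> carrier A" shows "nrm A x \<le> nrm A (adj A x)"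
proof (cases "nrm A x = 0")
  case True
  then show ?thesis using assms nrm_nonneg adj_closed by simp
next
  case False
  then have "nrm A x > 0" using nrm_nonneg[OF assms] by simp
  moreover have "(nrm A x)\<^sup>2 \<le> nrm A (adj A x) * nrm A x"
    using cstar_identity[OF assms] nrm_mult[OF adj_closed[OF assms] assms] by simp
  ultimately show ?thesis by (simp add: power2_eq_square)
qed

lemma nrm_adj: "x \<in> carrier A \<Longrightarrow> nrm A (adj A x) = nrm A x"
  using nrm_adj_le[of x] nrm_adj_le[of "adj A x"] adj_adj adj_closed by force

lemma poly_value_closed: "w \<in> P \<rightarrow> carrier A \<Longrightarrow> poly_value A P w e \<in> carrier A"
  by (induction e) (auto simp: smult_closed adj_closed)

end

lemma (in cstar_algebra) poly_values_dense:
  assumes w: "w \<in> P \<rightarrow> carrier A" and x: "x \<in> generated_subalgebra A (w ` P)" and "e > 0"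
  shows "\<exists>p. nrm A (x \<ominus> poly_value A P w p) < e"
proof -
  let ?v = "poly_value A P w"
  define V where "V = {x \<in> carrier A. \<forall>e>0. \<exists>p. nrm A (x \<ominus> ?v p) < e}"
  have vc: "?v p \<in> carrier A" for p
    using poly_value_closed[OF w] .
  have z0: "nrm A (x \<ominus> x) = 0" if "x \<in> carrier A" for x
    using that nrm_eq_0[of \<zero>] by (simp add: minus_eq r_neg)
  have VI: "?v p \<in> V" for p
    using vc z0 unfolding V_def by (auto intro!: exI[of _ p])
  have add: "x \<oplus> y \<in> V" if "x \<in> V" "y \<in> V" for x y
  proof -
    have c: "x \<in> carrier A" "y \<in> carrier A" using that by (auto simp: V_def)
    have "\<exists>p. nrm A (x \<oplus> y \<ominus> ?v p) < e" if "e > 0" for e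
    proof -
      obtain p where p: "nrm A (x \<ominus> ?v p) < e / 2"
        using \<open>x \<in> V\<close> half_gt_zero[OF \<open>e > 0\<close>] unfolding V_def by blast
      obtain q where q: "nrm A (y \<ominus> ?v q) < e / 2"
        using \<open>y \<in> V\<close> half_gt_zero[OF \<open>e > 0\<close>] unfolding V_def by blast
      have "x \<oplus> y \<ominus> ?v (Plus p q) = (x \<ominus> ?v p) \<oplus> (y \<ominus> ?v q)"
        using c vc[of p] vc[of q] by (simp add: minus_eq minus_add a_ac)
      then have "nrm A (x \<oplus> y \<ominus> ?v (Plus p q)) < e"
        using nrm_add[of "x \<ominus> ?v p" "y \<ominus> ?v q"] p q c vc by simp
      then show ?thesis by blast
    qed
    then show ?thesis using c by (simp add: V_def)
  qed
  have mult: "x \<otimes> y \<in> V" if "x \<in> V" "y \<in> V" for x y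
  proof -
    have c: "x \<in> carrier A" "y \<in> carrier A" using that by (auto simp: V_def)
    have "\<exists>p. nrm A (x \<otimes> y \<ominus> ?v p) < e" if "e > 0" for e
    proof -
      have pos: "e / (2 * (nrm A y + 1)) > 0"
        using \<open>e > 0\<close> nrm_nonneg[OF c(2)] by simp
      obtain p where p: "nrm A (x \<ominus> ?v p) < e / (2 * (nrm A y + 1))"
        using \<open>x \<in> V\<close> pos unfolding V_def by blast
      have pos2: "e / (2 * (nrm A (?v p) + 1)) > 0"
        using \<open>e > 0\<close> nrm_nonneg[OF vc] by (simp add: add_nonneg_pos)
      obtain q where q: "nrm A (y \<ominus> ?v q) < e / (2 * (nrm A (?v p) + 1))"
        using \<open>y \<in> V\<close> pos2 unfolding V_def by blast
      have "x \<otimes> y \<ominus> ?v (Times p q) = (x \<ominus> ?v p) \<otimes> y \<oplus> ?v p \<otimes> (y \<ominus> ?v q)"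
        unfolding poly_value.simps using c vc[of p] vc[of q] by algebra
      then have "nrm A (x \<otimes> y \<ominus> ?v (Times p q))
          \<le> nrm A (x \<ominus> ?v p) * nrm A y + nrm A (?v p) * nrm A (y \<ominus> ?v q)"
        using nrm_add[of "(x \<ominus> ?v p) \<otimes> y" "?v p \<otimes> (y \<ominus> ?v q)"]
          nrm_mult[of "x \<ominus> ?v p" y] nrm_mult[of "?v p" "y \<ominus> ?v q"] c vc[of p] vc[of q] by simp
      moreover have "nrm A (x \<ominus> ?v p) * (nrm A y + 1) < e / 2"
        using p pos nrm_nonneg[OF c(2)] by (simp add: field_simps)
      moreover have "nrm A (y \<ominus> ?v q) * (nrm A (?v p) + 1) < e / 2"
        using q pos2 nrm_nonneg[OF vc[of p]] by (simp add: field_simps)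
      moreover have "nrm A (x \<ominus> ?v p) \<ge> 0" "nrm A (y \<ominus> ?v q) \<ge> 0"
        using c vc nrm_nonneg by simp_all
      ultimately have "nrm A (x \<otimes> y \<ominus> ?v (Times p q)) < e"
        by (simp add: algebra_simps)
      then show ?thesis by blast
    qed
    then show ?thesis using c by (simp add: V_def)
  qed
  have smult: "c \<odot> x \<in> V" if "x \<in> V" for c x
  proof -
    have "(c \<odot> \<one>) \<otimes> x \<in> V"
      using mult[OF VI[of "Scalar c"] that] by simp
    moreover have "x \<in> carrier A" using that by (simp add: V_def)
    ultimately show ?thesis using smult_mult_left[of \<one> x c] by simp
  qed
  have adj: "adj A x \<in> V" if "x \<in> V" for x
  proof -
    have c: "x \<in> carrier A" using that by (auto simp: V_def)
    have diff: "adj A x \<ominus> adj A y = adj A (x \<ominus> y)" if "y \<in> carrier A" for y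
    proof -
      have "adj A (x \<ominus> y) \<oplus> adj A y = adj A x"
        using adj_add[of "x \<ominus> y" y] c that by (simp add: minus_eq a_assoc l_neg)
      then have "adj A x \<ominus> adj A y = (adj A (x \<ominus> y) \<oplus> adj A y) \<ominus> adj A y"
        by simp
      also have "\<dots> = adj A (x \<ominus> y)"
        using adj_closed[OF minus_closed[OF c that]] adj_closed[OF that]
        by (simp add: minus_eq[of _ "adj A y"] a_assoc r_neg)
      finally show ?thesis .
    qed
    have "\<exists>p. nrm A (adj A x \<ominus> ?v p) < e" if "e > 0" for e
    proof -
      obtain p where "nrm A (x \<ominus> ?v p) < e"
        using \<open>x \<in> V\<close> \<open>e > 0\<close> unfolding V_def by blast
      then have "nrm A (adj A x \<ominus> ?v (Star p)) < e"
        using diff[OF vc[of p]] nrm_adj[of "x \<ominus> ?v p"] c vc by simp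
      then show ?thesis by blast
    qed
    then show ?thesis using c adj_closed by (simp add: V_def)
  qed
  have closed: "x \<in> V" if x: "x \<in> carrier A" and *: "\<forall>e>0. \<exists>v\<in>V. nrm A (x \<ominus> v) < e" for x
  proof -
    have "\<exists>p. nrm A (x \<ominus> ?v p) < e" if "e > 0" for e
    proof -
      obtain v where v: "v \<in> V" "nrm A (x \<ominus> v) < e / 2"
        using * half_gt_zero[OF \<open>e > 0\<close>] by blast
      then obtain p where p: "nrm A (v \<ominus> ?v p) < e / 2"
        using half_gt_zero[OF \<open>e > 0\<close>] unfolding V_def by blast
      have "nrm A (x \<ominus> ?v p) < e"
        using nrm_tri[OF x _ vc[of p], of v] v p by (simp add: V_def)
      then show ?thesis by blast
    qed
    then show ?thesis using x by (simp add: V_def)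
  qed
  have one: "\<one> \<in> V"
    using VI[of "Scalar 1"] smult_one[of \<one>] by simp
  have zero: "\<zero> \<in> V"
    using VI[of "Scalar 0"] smult_zero[of \<one>] by simp
  have gen: "w ` P \<subseteq> V"
  proof safe
    fix p assume "p \<in> P"
    then show "w p \<in> V" using VI[of "Gen p"] by simp
  qed
  have "cstar_subalgebra A V"
    unfolding cstar_subalgebra_def closed_subspace_def
    using add mult smult adj closed one zero by (auto simp: V_def)
  then have "x \<in> V"
    using x gen unfolding generated_subalgebra_def by blast
  then show ?thesis
    using \<open>e > 0\<close> by (simp add: V_def)
qed

definition transport :: "('a \<Rightarrow> 'b) \<Rightarrow> 'a cstar \<Rightarrow> 'b cstar" where
  "transport h A = (let k = inv_into (carrier A) h in
    \<lparr> carrier = h ` carrier A,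
      monoid.mult = (\<lambda>x y. h (k x \<otimes>\<^bsub>A\<^esub> k y)),
      one = h \<one>\<^bsub>A\<^esub>,
      zero = h \<zero>\<^bsub>A\<^esub>,
      add = (\<lambda>x y. h (k x \<oplus>\<^bsub>A\<^esub> k y)),
      smult = (\<lambda>c x. h (c \<odot>\<^bsub>A\<^esub> k x)),
      adj = (\<lambda>x. h (adj A (k x))),
      nrm = (\<lambda>x. nrm A (k x)) \<rparr>)"

lemma (in cstar_algebra) transport:
  assumes inj: "inj_on h (carrier A)"
  shows "cstar_algebra (transport h A)" "star_iso A (transport h A) h"
    "x \<in> carrier A \<Longrightarrow> nrm (transport h A) (h x) = nrm A x"
proof -
  let ?B = "transport h A"
  have k: "inv_into (carrier A) h (h x) = x" if "x \<in> carrier A" for x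
    using inj that by simp
  have T: "carrier ?B = h ` carrier A" "\<one>\<^bsub>?B\<^esub> = h \<one>" "\<zero>\<^bsub>?B\<^esub> = h \<zero>"
    by (simp_all add: transport_def Let_def)
  have T2: "h x \<otimes>\<^bsub>?B\<^esub> h y = h (x \<otimes> y)" "h x \<oplus>\<^bsub>?B\<^esub> h y = h (x \<oplus> y)"
    if "x \<in> carrier A" "y \<in> carrier A" for x y
    using that by (simp_all add: transport_def Let_def k)
  have T1: "c \<odot>\<^bsub>?B\<^esub> h x = h (c \<odot> x)" "adj ?B (h x) = h (adj A x)" "nrm ?B (h x) = nrm A x"
    if "x \<in> carrier A" for x c
    using that by (simp_all add: transport_def Let_def k)
  note cl = smult_closed adj_closed
  have ring: "ring ?B"
  proof (rule ringI)
    show "abelian_group ?B"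
    proof (rule abelian_groupI)
      fix x assume "x \<in> carrier ?B"
      then obtain a where "a \<in> carrier A" "x = h a" by (auto simp: T)
      then show "\<exists>y\<in>carrier ?B. y \<oplus>\<^bsub>?B\<^esub> x = \<zero>\<^bsub>?B\<^esub>"
        by (intro bexI[of _ "h (\<ominus> a)"]) (simp_all add: T T2 l_neg)
    qed (auto simp: T T2 a_ac)
    show "monoid ?B"
      by (rule monoidI) (auto simp: T T2 m_assoc)
  qed (auto simp: T T2 l_distr r_distr)
  interpret B: ring ?B by (fact ring)
  have neg: "\<ominus>\<^bsub>?B\<^esub> h x = h (\<ominus> x)" if "x \<in> carrier A" for x
    by (rule B.minus_equality) (use that in \<open>simp_all add: T T2 l_neg\<close>)
  have diff: "h x \<ominus>\<^bsub>?B\<^esub> h y = h (x \<ominus> y)" if "x \<in> carrier A" "y \<in> carrier A" for x y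
    using that by (simp add: B.minus_eq minus_eq neg T2)
  show "cstar_algebra ?B"
  proof (intro cstar_algebra.intro ring cstar_algebra_axioms.intro)
    fix X :: "nat \<Rightarrow> _" assume X: "range X \<subseteq> carrier ?B"
      and C: "\<forall>e>0. \<exists>N. \<forall>m\<ge>N. \<forall>n\<ge>N. nrm ?B (X m \<ominus>\<^bsub>?B\<^esub> X n) < e"
    have "\<forall>n. \<exists>a. a \<in> carrier A \<and> X n = h a"
      using X by (auto simp: T)
    then obtain Y where Y: "Y n \<in> carrier A" "X n = h (Y n)" for n
      by metis
    have "\<forall>e>0. \<exists>N. \<forall>m\<ge>N. \<forall>n\<ge>N. nrm A (Y m \<ominus> Y n) < e"
      using C by (simp add: Y diff T1)
    moreover have "range Y \<subseteq> carrier A" using Y by auto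
    ultimately obtain l where l: "l \<in> carrier A" "(\<lambda>n. nrm A (Y n \<ominus> l)) \<longlonglongrightarrow> 0"
      using complete by blast
    then show "\<exists>l\<in>carrier ?B. (\<lambda>n. nrm ?B (X n \<ominus>\<^bsub>?B\<^esub> l)) \<longlonglongrightarrow> 0"
      by (intro bexI[of _ "h l"]) (simp_all add: Y diff T1 T)
  next
    fix x assume "x \<in> carrier ?B"
    then obtain a where "a \<in> carrier A" "x = h a" by (auto simp: T)
    then show "nrm ?B x = 0 \<longleftrightarrow> x = \<zero>\<^bsub>?B\<^esub>"
      using nrm_eq_0 inj by (simp add: T T1 inj_on_eq_iff)
  qed (auto simp: T T1 T2 cl smult_add_left smult_add_right smult_smult smult_one smult_mult_left
      smult_mult_right adj_adj adj_add adj_smult adj_mult nrm_nonneg nrm_add nrm_smult nrm_mult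
      cstar_identity)
  show "star_iso A ?B h"
    using inj by (auto simp: star_iso_def star_hom_def bij_betw_def T T1 T2)
  show "x \<in> carrier A \<Longrightarrow> nrm ?B (h x) = nrm A x"
    by (rule T1)
qed

theorem universe_copy:
  fixes B :: "'b cstar" and w :: "'g \<Rightarrow> 'b"
  assumes "cstar_algebra B" and w: "w \<in> P \<rightarrow> carrier B"
    and gen: "generated_subalgebra B (w ` P) = carrier B"
  shows "\<exists>(B' :: 'g universe cstar) h. cstar_algebra B' \<and> star_iso B B' h \<and>
           (\<forall>x\<in>carrier B. nrm B' (h x) = nrm B x)"
proof -
  interpret cstar_algebra B by fact
  let ?v = "poly_value B P w"
  define h :: "'b \<Rightarrow> 'g universe" where "h x = (\<lambda>p. nrm B (x \<ominus>\<^bsub>B\<^esub> ?v p))" for x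
  have "inj_on h (carrier B)"
  proof (rule inj_onI)
    fix x y assume c: "x \<in> carrier B" "y \<in> carrier B" and eq: "h x = h y"
    have "nrm B (x \<ominus>\<^bsub>B\<^esub> y) \<le> 0 + e" if "e > 0" for e
    proof -
      have "x \<in> generated_subalgebra B (w ` P)" and "e / 2 > 0"
        using gen c that by simp_all
      then obtain p where p: "nrm B (x \<ominus>\<^bsub>B\<^esub> ?v p) < e / 2"
        using poly_values_dense[OF w] by blast
      moreover have "nrm B (y \<ominus>\<^bsub>B\<^esub> ?v p) < e / 2"
        using p fun_cong[OF eq, of p] by (simp add: h_def)
      ultimately show ?thesis
        using nrm_tri[OF c(1) poly_value_closed[OF w] c(2), of p]
          nrm_minus[OF c(2) poly_value_closed[OF w], of p] by simp
    qed
    then have "nrm B (x \<ominus>\<^bsub>B\<^esub> y) \<le> 0"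
      by (rule field_le_epsilon)
    then have "x \<ominus>\<^bsub>B\<^esub> y = \<zero>\<^bsub>B\<^esub>"
      using nrm_nonneg[of "x \<ominus>\<^bsub>B\<^esub> y"] nrm_eq_0[of "x \<ominus>\<^bsub>B\<^esub> y"] c by simp
    then show "x = y"
      using c by (simp add: minus_eq add.inv_solve_right')
  qed
  from transport[OF this] show ?thesis by blast
qed

lemma cstar_algebra_subalgebra:
  fixes A :: "'b cstar" (structure)
  assumes "cstar_algebra A" and V: "cstar_subalgebra A V"
  shows "cstar_algebra (A\<lparr>carrier := V\<rparr>)"
proof -
  interpret cstar_algebra A by fact
  let ?B = "A\<lparr>carrier := V\<rparr>"
  have sub: "x \<in> carrier A" if "x \<in> V" for x
    using V that by (auto simp: cstar_subalgebra_def closed_subspace_def)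
  have cl: "\<zero> \<in> V" "\<one> \<in> V" "x \<in> V \<Longrightarrow> y \<in> V \<Longrightarrow> x \<oplus> y \<in> V" "x \<in> V \<Longrightarrow> y \<in> V \<Longrightarrow> x \<otimes> y \<in> V"
    "x \<in> V \<Longrightarrow> c \<odot> x \<in> V" "x \<in> V \<Longrightarrow> adj A x \<in> V" for x y c
    using V by (auto simp: cstar_subalgebra_def closed_subspace_def)
  have lim: "x \<in> V" if "x \<in> carrier A" "\<And>e. e > 0 \<Longrightarrow> \<exists>v\<in>V. nrm A (x \<ominus> v) < e" for x
    using V that by (auto simp: cstar_subalgebra_def closed_subspace_def)
  have neg_smult: "(-1) \<odot> x \<oplus> x = \<zero>" if "x \<in> carrier A" for x
    using smult_add_left[of x "-1" 1] smult_one[OF that] smult_zero[OF that] that by simp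
  have ring: "ring ?B"
  proof (rule ringI)
    show "abelian_group ?B"
    proof (rule abelian_groupI)
      fix x assume "x \<in> carrier ?B"
      then show "\<exists>y\<in>carrier ?B. y \<oplus>\<^bsub>?B\<^esub> x = \<zero>\<^bsub>?B\<^esub>"
        by (intro bexI[of _ "(-1) \<odot> x"]) (simp_all add: cl sub neg_smult)
    qed (auto simp: cl sub a_assoc intro: a_comm)
    show "monoid ?B"
      by (rule monoidI) (auto simp: cl sub m_assoc)
  qed (auto simp: cl sub l_distr r_distr)
  interpret B: ring ?B by (fact ring)
  have "\<ominus>\<^bsub>?B\<^esub> x = \<ominus> x" if "x \<in> V" for x
  proof -
    have "\<ominus>\<^bsub>?B\<^esub> x = (-1) \<odot> x"
      by (rule B.minus_equality) (use that in \<open>simp_all add: cl sub neg_smult\<close>)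
    also have "\<dots> = \<ominus> x"
      by (rule minus_equality[symmetric]) (use that in \<open>simp_all add: cl sub neg_smult\<close>)
    finally show ?thesis .
  qed
  then have diff: "x \<ominus>\<^bsub>?B\<^esub> y = x \<ominus> y" if "x \<in> V" "y \<in> V" for x y
    using that by (simp add: B.minus_eq minus_eq)
  show ?thesis
  proof (intro cstar_algebra.intro ring cstar_algebra_axioms.intro)
    fix X :: "nat \<Rightarrow> _" assume X: "range X \<subseteq> carrier ?B"
      and C: "\<forall>e>0. \<exists>N. \<forall>m\<ge>N. \<forall>n\<ge>N. nrm ?B (X m \<ominus>\<^bsub>?B\<^esub> X n) < e"
    have XV: "X n \<in> V" for n using X by auto
    have "\<forall>e>0. \<exists>N. \<forall>m\<ge>N. \<forall>n\<ge>N. nrm A (X m \<ominus> X n) < e"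
      using C by (simp add: XV diff)
    moreover have "range X \<subseteq> carrier A" using XV sub by auto
    ultimately obtain l where l: "l \<in> carrier A" "(\<lambda>n. nrm A (X n \<ominus> l)) \<longlonglongrightarrow> 0"
      using complete by blast
    have "l \<in> V"
    proof (rule lim)
      fix e :: real assume "e > 0"
      then have "\<forall>\<^sub>F n in sequentially. nrm A (X n \<ominus> l) < e"
        by (rule order_tendstoD(2)[OF l(2)])
      then obtain n where "nrm A (X n \<ominus> l) < e"
        by (auto simp: eventually_sequentially)
      then show "\<exists>v\<in>V. nrm A (l \<ominus> v) < e"
        using nrm_minus[OF l(1) sub[OF XV[of n]]] XV by (intro bexI[of _ "X n"]) auto
    qed (fact l(1))
    then show "\<exists>l\<in>carrier ?B. (\<lambda>n. nrm ?B (X n \<ominus>\<^bsub>?B\<^esub> l)) \<longlonglongrightarrow> 0"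
      using l by (intro bexI[of _ l]) (simp_all add: XV diff)
  qed (auto simp: cl sub smult_add_left smult_add_right smult_smult smult_one smult_mult_left
      smult_mult_right adj_adj adj_add adj_smult adj_mult nrm_nonneg nrm_eq_0 nrm_add nrm_smult
      nrm_mult cstar_identity)
qed

lemma cstar_subalgebra_generated:
  fixes A :: "'b cstar" (structure)
  assumes "cstar_algebra A" and X: "X \<subseteq> carrier A"
  shows "cstar_subalgebra A (generated_subalgebra A X)"
proof -
  interpret cstar_algebra A by fact
  have "cstar_subalgebra A (carrier A)"
    by (auto simp: cstar_subalgebra_def closed_subspace_def smult_closed adj_closed)
  then have G: "generated_subalgebra A X \<subseteq> carrier A"
    using X by (auto simp: generated_subalgebra_def)
  have I: "x \<in> generated_subalgebra A X"
    if "\<And>V. cstar_subalgebra A V \<Longrightarrow> generated_subalgebra A X \<subseteq> V \<Longrightarrow> x \<in> V" for x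
    unfolding generated_subalgebra_def
  proof safe
    fix V assume V: "cstar_subalgebra A V" "X \<subseteq> V"
    then have "generated_subalgebra A X \<subseteq> V"
      by (auto simp: generated_subalgebra_def)
    with V show "x \<in> V" using that by blast
  qed
  have closed: "x \<in> V"
    if V: "cstar_subalgebra A V" "generated_subalgebra A X \<subseteq> V" and "x \<in> carrier A"
      and e: "\<forall>e>0. \<exists>v\<in>generated_subalgebra A X. nrm A (x \<ominus> v) < e" for x V
  proof -
    have "\<forall>e>0. \<exists>v\<in>V. nrm A (x \<ominus> v) < e"
      using e V(2) by (meson subsetD)
    then show ?thesis
      using V(1) \<open>x \<in> carrier A\<close> by (simp add: cstar_subalgebra_def closed_subspace_def)
  qed
  show ?thesis
    unfolding cstar_subalgebra_def closed_subspace_def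
  proof (intro conjI ballI allI impI G)
    show "\<zero> \<in> generated_subalgebra A X" "\<one> \<in> generated_subalgebra A X"
      by (rule I, simp add: cstar_subalgebra_def closed_subspace_def)+
  next
    fix x y assume xy: "x \<in> generated_subalgebra A X" "y \<in> generated_subalgebra A X"
    show "x \<oplus> y \<in> generated_subalgebra A X" "x \<otimes> y \<in> generated_subalgebra A X"
      by (rule I, use xy in \<open>simp add: cstar_subalgebra_def closed_subspace_def subset_iff\<close>)+
  next
    fix c x assume x: "x \<in> generated_subalgebra A X"
    show "c \<odot> x \<in> generated_subalgebra A X" "adj A x \<in> generated_subalgebra A X"
      by (rule I, use x in \<open>simp add: cstar_subalgebra_def closed_subspace_def subset_iff\<close>)+
  next
    fix x assume "x \<in> carrier A"
      and "\<forall>e>0. \<exists>v\<in>generated_subalgebra A X. nrm A (x \<ominus> v) < e"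
    then show "x \<in> generated_subalgebra A X"
      using closed by (intro I) blast
  qed
qed

lemma cstar_algebra_product:
  assumes "I \<noteq> {}" and B: "\<And>i. i \<in> I \<Longrightarrow> cstar_algebra (B i)"
  shows "cstar_algebra (cstar_product I B)"
proof -
  let ?A = "cstar_product I B"
  note ax = cstar_algebra.smult_closed[OF B] cstar_algebra.adj_closed[OF B]
    cstar_algebra.smult_add_left[OF B] cstar_algebra.smult_add_right[OF B]
    cstar_algebra.smult_smult[OF B] cstar_algebra.smult_one[OF B]
    cstar_algebra.smult_mult_left[OF B] cstar_algebra.smult_mult_right[OF B]
    cstar_algebra.adj_adj[OF B] cstar_algebra.adj_add[OF B] cstar_algebra.adj_smult[OF B]
    cstar_algebra.adj_mult[OF B]
  have R: "ring (B i)" if "i \<in> I" for i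
    using B[OF that] by (simp add: cstar_algebra_def)
  note rg = ring.ring_simprules[OF R]
  have S: "\<one>\<^bsub>?A\<^esub> = (\<lambda>i\<in>I. \<one>\<^bsub>B i\<^esub>)" "\<zero>\<^bsub>?A\<^esub> = (\<lambda>i\<in>I. \<zero>\<^bsub>B i\<^esub>)"
    "x \<otimes>\<^bsub>?A\<^esub> y = (\<lambda>i\<in>I. x i \<otimes>\<^bsub>B i\<^esub> y i)" "x \<oplus>\<^bsub>?A\<^esub> y = (\<lambda>i\<in>I. x i \<oplus>\<^bsub>B i\<^esub> y i)"
    "c \<odot>\<^bsub>?A\<^esub> x = (\<lambda>i\<in>I. c \<odot>\<^bsub>B i\<^esub> x i)" "adj ?A x = (\<lambda>i\<in>I. adj (B i) (x i))"
    "nrm ?A x = (SUP i\<in>I. nrm (B i) (x i))" for x y c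
    by (simp_all add: cstar_product_def)
  have mem: "x i \<in> carrier (B i)" if "x \<in> carrier ?A" "i \<in> I" for x i
    using that by (auto simp: cstar_product_def)
  have ext: "x \<in> extensional I" if "x \<in> carrier ?A" for x
    using that by (auto simp: cstar_product_def PiE_def)
  have le: "nrm (B i) (x i) \<le> nrm ?A x" if "x \<in> carrier ?A" "i \<in> I" for x i
    using that unfolding S by (intro cSUP_upper) (auto simp: cstar_product_def)
  have least: "nrm ?A x \<le> M" if "\<And>i. i \<in> I \<Longrightarrow> nrm (B i) (x i) \<le> M" for x M
    unfolding S using \<open>I \<noteq> {}\<close> that by (rule cSUP_least)
  have memI: "x \<in> carrier ?A"
    if "x \<in> extensional I" "\<And>i. i \<in> I \<Longrightarrow> x i \<in> carrier (B i)" "\<And>i. i \<in> I \<Longrightarrow> nrm (B i) (x i) \<le> M"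
    for x M
    using that by (auto simp: cstar_product_def PiE_def intro!: bdd_aboveI2[of _ _ M])
  have eqI: "x = y" if "x \<in> extensional I" "y \<in> extensional I" "\<And>i. i \<in> I \<Longrightarrow> x i = y i" for x y
    using that by (rule extensionalityI)
  have nn: "0 \<le> nrm ?A x" if x: "x \<in> carrier ?A" for x
  proof -
    obtain i where "i \<in> I" using \<open>I \<noteq> {}\<close> by auto
    then show ?thesis
      using le[OF x] cstar_algebra.nrm_nonneg[OF B mem[OF x]] by (meson order_trans)
  qed
  have nonneg: "0 \<le> nrm (B i) (x i)" if "x \<in> carrier ?A" "i \<in> I" for x i
    using cstar_algebra.nrm_nonneg[OF B] mem that by blast
  have c_add: "x \<oplus>\<^bsub>?A\<^esub> y \<in> carrier ?A" and n_add: "nrm ?A (x \<oplus>\<^bsub>?A\<^esub> y) \<le> nrm ?A x + nrm ?A y"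
    if x: "x \<in> carrier ?A" and y: "y \<in> carrier ?A" for x y
  proof -
    have "nrm (B i) ((x \<oplus>\<^bsub>?A\<^esub> y) i) \<le> nrm ?A x + nrm ?A y" if i: "i \<in> I" for i
      using cstar_algebra.nrm_add[OF B mem[OF x] mem[OF y], OF i i i] le[OF x i] le[OF y i] i
      by (simp add: S(4))
    then show "x \<oplus>\<^bsub>?A\<^esub> y \<in> carrier ?A" "nrm ?A (x \<oplus>\<^bsub>?A\<^esub> y) \<le> nrm ?A x + nrm ?A y"
      using mem[OF x] mem[OF y] least
      by (auto intro!: memI simp: S(4) rg)
  qed
  have c_mult: "x \<otimes>\<^bsub>?A\<^esub> y \<in> carrier ?A" and n_mult: "nrm ?A (x \<otimes>\<^bsub>?A\<^esub> y) \<le> nrm ?A x * nrm ?A y"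
    if x: "x \<in> carrier ?A" and y: "y \<in> carrier ?A" for x y
  proof -
    have "nrm (B i) ((x \<otimes>\<^bsub>?A\<^esub> y) i) \<le> nrm ?A x * nrm ?A y" if i: "i \<in> I" for i
      using cstar_algebra.nrm_mult[OF B mem[OF x] mem[OF y], OF i i i]
        mult_mono[OF le[OF x i] le[OF y i] nn[OF x] nonneg[OF y i]] i
      by (simp add: S(3))
    then show "x \<otimes>\<^bsub>?A\<^esub> y \<in> carrier ?A" "nrm ?A (x \<otimes>\<^bsub>?A\<^esub> y) \<le> nrm ?A x * nrm ?A y"
      using mem[OF x] mem[OF y] least
      by (auto intro!: memI simp: S(3) rg)
  qed
  have c_smult: "c \<odot>\<^bsub>?A\<^esub> x \<in> carrier ?A" and n_smult: "nrm ?A (c \<odot>\<^bsub>?A\<^esub> x) \<le> cmod c * nrm ?A x"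
    if x: "x \<in> carrier ?A" for x c
  proof -
    have "nrm (B i) ((c \<odot>\<^bsub>?A\<^esub> x) i) \<le> cmod c * nrm ?A x" if i: "i \<in> I" for i
      using cstar_algebra.nrm_smult[OF B mem[OF x], OF i i, of c] le[OF x i] i
      by (simp add: S(5) mult_left_mono)
    then show "c \<odot>\<^bsub>?A\<^esub> x \<in> carrier ?A" "nrm ?A (c \<odot>\<^bsub>?A\<^esub> x) \<le> cmod c * nrm ?A x"
      using mem[OF x] least by (auto intro!: memI simp: S(5) ax)
  qed
  have c_adj: "adj ?A x \<in> carrier ?A" if x: "x \<in> carrier ?A" for x
  proof -
    have "nrm (B i) ((adj ?A x) i) \<le> nrm ?A x" if i: "i \<in> I" for i
      using cstar_algebra.nrm_adj[OF B mem[OF x], OF i i] le[OF x i] i by (simp add: S(6))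
    then show ?thesis
      using mem[OF x] by (auto intro!: memI simp: S(6) ax)
  qed
  have c_one: "\<one>\<^bsub>?A\<^esub> \<in> carrier ?A"
  proof -
    have "nrm (B i) \<one>\<^bsub>B i\<^esub> \<le> 1" if i: "i \<in> I" for i
    proof -
      interpret cstar_algebra "B i" by (rule B[OF i])
      have "adj (B i) \<one>\<^bsub>B i\<^esub> = \<one>\<^bsub>B i\<^esub>"
        using adj_mult[of "adj (B i) \<one>\<^bsub>B i\<^esub>" "\<one>\<^bsub>B i\<^esub>"] adj_adj[of "\<one>\<^bsub>B i\<^esub>"] adj_closed[of "\<one>\<^bsub>B i\<^esub>"] by simp
      then have "nrm (B i) \<one>\<^bsub>B i\<^esub> = (nrm (B i) \<one>\<^bsub>B i\<^esub>)\<^sup>2"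
        using cstar_identity[of "\<one>\<^bsub>B i\<^esub>"] by simp
      then show ?thesis by (auto simp: power2_eq_square)
    qed
    then show ?thesis by (intro memI[of _ 1]) (simp_all add: S rg)
  qed
  have c_zero: "\<zero>\<^bsub>?A\<^esub> \<in> carrier ?A"
  proof (rule memI)
    fix i assume i: "i \<in> I"
    then show "\<zero>\<^bsub>?A\<^esub> i \<in> carrier (B i)" by (simp add: S(2) rg)
    have "nrm (B i) \<zero>\<^bsub>B i\<^esub> = 0"
      using cstar_algebra.nrm_eq_0[OF B[OF i]] i by (simp add: rg)
    then show "nrm (B i) (\<zero>\<^bsub>?A\<^esub> i) \<le> 0" using i by (simp add: S(2))
  qed (simp add: S(2))
  note cl = c_add c_mult c_smult c_adj c_one c_zero
  have sm0: "(-1) \<odot>\<^bsub>B i\<^esub> x \<oplus>\<^bsub>B i\<^esub> x = \<zero>\<^bsub>B i\<^esub>" if "i \<in> I" "x \<in> carrier (B i)" for i x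
  proof -
    interpret cstar_algebra "B i" by (rule B[OF that(1)])
    show ?thesis
      using smult_add_left[of x "-1" 1] smult_one smult_zero that by simp
  qed
  have pw: "a \<oplus>\<^bsub>B i\<^esub> b \<oplus>\<^bsub>B i\<^esub> c = a \<oplus>\<^bsub>B i\<^esub> (b \<oplus>\<^bsub>B i\<^esub> c)"
    "a \<oplus>\<^bsub>B i\<^esub> b = b \<oplus>\<^bsub>B i\<^esub> a"
    "\<zero>\<^bsub>B i\<^esub> \<oplus>\<^bsub>B i\<^esub> a = a"
    "a \<otimes>\<^bsub>B i\<^esub> b \<otimes>\<^bsub>B i\<^esub> c = a \<otimes>\<^bsub>B i\<^esub> (b \<otimes>\<^bsub>B i\<^esub> c)"
    "\<one>\<^bsub>B i\<^esub> \<otimes>\<^bsub>B i\<^esub> a = a"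
    "a \<otimes>\<^bsub>B i\<^esub> \<one>\<^bsub>B i\<^esub> = a"
    "(a \<oplus>\<^bsub>B i\<^esub> b) \<otimes>\<^bsub>B i\<^esub> c = a \<otimes>\<^bsub>B i\<^esub> c \<oplus>\<^bsub>B i\<^esub> b \<otimes>\<^bsub>B i\<^esub> c"
    "c \<otimes>\<^bsub>B i\<^esub> (a \<oplus>\<^bsub>B i\<^esub> b) = c \<otimes>\<^bsub>B i\<^esub> a \<oplus>\<^bsub>B i\<^esub> c \<otimes>\<^bsub>B i\<^esub> b"
    if "i \<in> I" "a \<in> carrier (B i)" "b \<in> carrier (B i)" "c \<in> carrier (B i)" for i a b c
  proof -
    interpret ring "B i" by (rule R[OF that(1)])
    show "a \<oplus>\<^bsub>B i\<^esub> b \<oplus>\<^bsub>B i\<^esub> c = a \<oplus>\<^bsub>B i\<^esub> (b \<oplus>\<^bsub>B i\<^esub> c)"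
      by (rule a_assoc) (use that in simp_all)
    show "a \<oplus>\<^bsub>B i\<^esub> b = b \<oplus>\<^bsub>B i\<^esub> a"
      by (rule a_comm) (use that in simp_all)
    show "\<zero>\<^bsub>B i\<^esub> \<oplus>\<^bsub>B i\<^esub> a = a"
      by (rule l_zero) (use that in simp_all)
    show "a \<otimes>\<^bsub>B i\<^esub> b \<otimes>\<^bsub>B i\<^esub> c = a \<otimes>\<^bsub>B i\<^esub> (b \<otimes>\<^bsub>B i\<^esub> c)"
      by (rule m_assoc) (use that in simp_all)
    show "\<one>\<^bsub>B i\<^esub> \<otimes>\<^bsub>B i\<^esub> a = a"
      by (rule l_one) (use that in simp_all)
    show "a \<otimes>\<^bsub>B i\<^esub> \<one>\<^bsub>B i\<^esub> = a"
      by (rule r_one) (use that in simp_all)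
    show "(a \<oplus>\<^bsub>B i\<^esub> b) \<otimes>\<^bsub>B i\<^esub> c = a \<otimes>\<^bsub>B i\<^esub> c \<oplus>\<^bsub>B i\<^esub> b \<otimes>\<^bsub>B i\<^esub> c"
      by (rule l_distr) (use that in simp_all)
    show "c \<otimes>\<^bsub>B i\<^esub> (a \<oplus>\<^bsub>B i\<^esub> b) = c \<otimes>\<^bsub>B i\<^esub> a \<oplus>\<^bsub>B i\<^esub> c \<otimes>\<^bsub>B i\<^esub> b"
      by (rule r_distr) (use that in simp_all)
  qed
  have ring_ax:
    "x \<oplus>\<^bsub>?A\<^esub> y \<oplus>\<^bsub>?A\<^esub> z = x \<oplus>\<^bsub>?A\<^esub> (y \<oplus>\<^bsub>?A\<^esub> z)" "x \<oplus>\<^bsub>?A\<^esub> y = y \<oplus>\<^bsub>?A\<^esub> x" "\<zero>\<^bsub>?A\<^esub> \<oplus>\<^bsub>?A\<^esub> x = x"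
    "x \<otimes>\<^bsub>?A\<^esub> y \<otimes>\<^bsub>?A\<^esub> z = x \<otimes>\<^bsub>?A\<^esub> (y \<otimes>\<^bsub>?A\<^esub> z)" "\<one>\<^bsub>?A\<^esub> \<otimes>\<^bsub>?A\<^esub> x = x" "x \<otimes>\<^bsub>?A\<^esub> \<one>\<^bsub>?A\<^esub> = x"
    "(x \<oplus>\<^bsub>?A\<^esub> y) \<otimes>\<^bsub>?A\<^esub> z = x \<otimes>\<^bsub>?A\<^esub> z \<oplus>\<^bsub>?A\<^esub> y \<otimes>\<^bsub>?A\<^esub> z" "z \<otimes>\<^bsub>?A\<^esub> (x \<oplus>\<^bsub>?A\<^esub> y) = z \<otimes>\<^bsub>?A\<^esub> x \<oplus>\<^bsub>?A\<^esub> z \<otimes>\<^bsub>?A\<^esub> y"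
    if c: "x \<in> carrier ?A" "y \<in> carrier ?A" "z \<in> carrier ?A" for x y z
  proof -
    note m = mem[OF c(1)] mem[OF c(2)] mem[OF c(3)]
    show "x \<oplus>\<^bsub>?A\<^esub> y \<oplus>\<^bsub>?A\<^esub> z = x \<oplus>\<^bsub>?A\<^esub> (y \<oplus>\<^bsub>?A\<^esub> z)"
      by (intro eqI ext cl c) (simp add: S pw(1)[OF _ m])
    show "x \<oplus>\<^bsub>?A\<^esub> y = y \<oplus>\<^bsub>?A\<^esub> x"
      by (intro eqI ext cl c) (simp add: S pw(2)[OF _ m])
    show "\<zero>\<^bsub>?A\<^esub> \<oplus>\<^bsub>?A\<^esub> x = x"
      by (intro eqI ext cl c) (simp add: S pw(3)[OF _ m])
    show "x \<otimes>\<^bsub>?A\<^esub> y \<otimes>\<^bsub>?A\<^esub> z = x \<otimes>\<^bsub>?A\<^esub> (y \<otimes>\<^bsub>?A\<^esub> z)"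
      by (intro eqI ext cl c) (simp add: S pw(4)[OF _ m])
    show "\<one>\<^bsub>?A\<^esub> \<otimes>\<^bsub>?A\<^esub> x = x"
      by (intro eqI ext cl c) (simp add: S pw(5)[OF _ m])
    show "x \<otimes>\<^bsub>?A\<^esub> \<one>\<^bsub>?A\<^esub> = x"
      by (intro eqI ext cl c) (simp add: S pw(6)[OF _ m])
    show "(x \<oplus>\<^bsub>?A\<^esub> y) \<otimes>\<^bsub>?A\<^esub> z = x \<otimes>\<^bsub>?A\<^esub> z \<oplus>\<^bsub>?A\<^esub> y \<otimes>\<^bsub>?A\<^esub> z"
      by (intro eqI ext cl c) (simp add: S pw(7)[OF _ m])
    show "z \<otimes>\<^bsub>?A\<^esub> (x \<oplus>\<^bsub>?A\<^esub> y) = z \<otimes>\<^bsub>?A\<^esub> x \<oplus>\<^bsub>?A\<^esub> z \<otimes>\<^bsub>?A\<^esub> y"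
      by (intro eqI ext cl c) (simp add: S pw(8)[OF _ m])
  qed
  have neg_ax: "((-1) \<odot>\<^bsub>?A\<^esub> x) \<oplus>\<^bsub>?A\<^esub> x = \<zero>\<^bsub>?A\<^esub>" if x: "x \<in> carrier ?A" for x
    by (intro eqI ext cl x) (simp add: S sm0 mem[OF x])
  have ring: "ring ?A"
  proof (rule ringI)
    show "abelian_group ?A"
    proof (rule abelian_groupI)
      fix x assume x: "x \<in> carrier ?A"
      show "\<exists>y\<in>carrier ?A. y \<oplus>\<^bsub>?A\<^esub> x = \<zero>\<^bsub>?A\<^esub>"
        using neg_ax[OF x] c_smult[OF x] by (rule bexI)
      show "\<zero>\<^bsub>?A\<^esub> \<oplus>\<^bsub>?A\<^esub> x = x" using x x x by (rule ring_ax(3))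
    qed (rule cl ring_ax; assumption)+
    show "monoid ?A"
      by (rule monoidI) (rule cl ring_ax; assumption)+
  qed (rule ring_ax; assumption)+
  interpret A: ring ?A by (fact ring)
  have neg: "\<ominus>\<^bsub>?A\<^esub> x = (\<lambda>i\<in>I. \<ominus>\<^bsub>B i\<^esub> x i)" if x: "x \<in> carrier ?A" for x
  proof (rule eqI)
    fix i assume i: "i \<in> I"
    have "(\<ominus>\<^bsub>?A\<^esub> x \<oplus>\<^bsub>?A\<^esub> x) i = \<zero>\<^bsub>B i\<^esub>"
      using A.l_neg[OF x] i by (simp add: S)
    then have "(\<ominus>\<^bsub>?A\<^esub> x) i \<oplus>\<^bsub>B i\<^esub> x i = \<zero>\<^bsub>B i\<^esub>"
      using i by (simp add: S(4))
    then show "(\<ominus>\<^bsub>?A\<^esub> x) i = (\<lambda>i\<in>I. \<ominus>\<^bsub>B i\<^esub> x i) i"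
      using abelian_group.minus_equality[OF ring.is_abelian_group[OF R[OF i]]] i x mem A.a_inv_closed
      by simp
  qed (use x ext A.a_inv_closed in auto)
  have diff: "(x \<ominus>\<^bsub>?A\<^esub> y) i = x i \<ominus>\<^bsub>B i\<^esub> y i"
    if "x \<in> carrier ?A" "y \<in> carrier ?A" "i \<in> I" for x y i
    using that by (simp add: A.minus_eq neg S(4)) (simp add: a_minus_def)
  have star_ax1:
    "(c + d) \<odot>\<^bsub>?A\<^esub> x = c \<odot>\<^bsub>?A\<^esub> x \<oplus>\<^bsub>?A\<^esub> d \<odot>\<^bsub>?A\<^esub> x"
    "c \<odot>\<^bsub>?A\<^esub> (d \<odot>\<^bsub>?A\<^esub> x) = (c * d) \<odot>\<^bsub>?A\<^esub> x"
    "1 \<odot>\<^bsub>?A\<^esub> x = x"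
    "adj ?A (adj ?A x) = x"
    "adj ?A (c \<odot>\<^bsub>?A\<^esub> x) = cnj c \<odot>\<^bsub>?A\<^esub> adj ?A x"
    if c: "x \<in> carrier ?A" for x c d
  proof -
    note m = mem[OF c]
    show "(c + d) \<odot>\<^bsub>?A\<^esub> x = c \<odot>\<^bsub>?A\<^esub> x \<oplus>\<^bsub>?A\<^esub> d \<odot>\<^bsub>?A\<^esub> x"
      by (intro eqI ext cl c) (simp add: S ax m)
    show "c \<odot>\<^bsub>?A\<^esub> (d \<odot>\<^bsub>?A\<^esub> x) = (c * d) \<odot>\<^bsub>?A\<^esub> x"
      by (intro eqI ext cl c) (simp add: S ax m)
    show "1 \<odot>\<^bsub>?A\<^esub> x = x"
      by (intro eqI ext cl c) (simp add: S ax m)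
    show "adj ?A (adj ?A x) = x"
      by (intro eqI ext cl c) (simp add: S ax m)
    show "adj ?A (c \<odot>\<^bsub>?A\<^esub> x) = cnj c \<odot>\<^bsub>?A\<^esub> adj ?A x"
      by (intro eqI ext cl c) (simp add: S ax m)
  qed
  have star_ax2:
    "c \<odot>\<^bsub>?A\<^esub> (x \<oplus>\<^bsub>?A\<^esub> y) = c \<odot>\<^bsub>?A\<^esub> x \<oplus>\<^bsub>?A\<^esub> c \<odot>\<^bsub>?A\<^esub> y"
    "(c \<odot>\<^bsub>?A\<^esub> x) \<otimes>\<^bsub>?A\<^esub> y = c \<odot>\<^bsub>?A\<^esub> (x \<otimes>\<^bsub>?A\<^esub> y)"
    "x \<otimes>\<^bsub>?A\<^esub> (c \<odot>\<^bsub>?A\<^esub> y) = c \<odot>\<^bsub>?A\<^esub> (x \<otimes>\<^bsub>?A\<^esub> y)"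
    "adj ?A (x \<oplus>\<^bsub>?A\<^esub> y) = adj ?A x \<oplus>\<^bsub>?A\<^esub> adj ?A y"
    "adj ?A (x \<otimes>\<^bsub>?A\<^esub> y) = adj ?A y \<otimes>\<^bsub>?A\<^esub> adj ?A x"
    if c: "x \<in> carrier ?A" "y \<in> carrier ?A" for x y c d
  proof -
    note m = mem[OF c(1)] mem[OF c(2)]
    show "c \<odot>\<^bsub>?A\<^esub> (x \<oplus>\<^bsub>?A\<^esub> y) = c \<odot>\<^bsub>?A\<^esub> x \<oplus>\<^bsub>?A\<^esub> c \<odot>\<^bsub>?A\<^esub> y"
      by (intro eqI ext cl c) (simp add: S ax m)
    show "(c \<odot>\<^bsub>?A\<^esub> x) \<otimes>\<^bsub>?A\<^esub> y = c \<odot>\<^bsub>?A\<^esub> (x \<otimes>\<^bsub>?A\<^esub> y)"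
      by (intro eqI ext cl c) (simp add: S ax m)
    show "x \<otimes>\<^bsub>?A\<^esub> (c \<odot>\<^bsub>?A\<^esub> y) = c \<odot>\<^bsub>?A\<^esub> (x \<otimes>\<^bsub>?A\<^esub> y)"
      by (intro eqI ext cl c) (simp add: S ax m)
    show "adj ?A (x \<oplus>\<^bsub>?A\<^esub> y) = adj ?A x \<oplus>\<^bsub>?A\<^esub> adj ?A y"
      by (intro eqI ext cl c) (simp add: S ax m)
    show "adj ?A (x \<otimes>\<^bsub>?A\<^esub> y) = adj ?A y \<otimes>\<^bsub>?A\<^esub> adj ?A x"
      by (intro eqI ext cl c) (simp add: S ax m)
  qed
  show ?thesis
  proof (intro cstar_algebra.intro ring cstar_algebra_axioms.intro)
    fix x assume x: "x \<in> carrier ?A"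
    show "nrm ?A x = 0 \<longleftrightarrow> x = \<zero>\<^bsub>?A\<^esub>"
    proof
      assume "nrm ?A x = 0"
      then have "nrm (B i) (x i) = 0" if "i \<in> I" for i
        using le[OF x that] nonneg[OF x that] by simp
      then show "x = \<zero>\<^bsub>?A\<^esub>"
        using cstar_algebra.nrm_eq_0[OF B] mem[OF x]
        by (intro eqI ext x c_zero) (simp add: S)
    next
      assume 0: "x = \<zero>\<^bsub>?A\<^esub>"
      have "nrm (B i) (x i) \<le> 0" if i: "i \<in> I" for i
      proof -
        interpret cstar_algebra "B i" by (rule B[OF i])
        show ?thesis using nrm_eq_0[of "\<zero>\<^bsub>B i\<^esub>"] i by (simp add: 0 S(2))
      qed
      then have "nrm ?A x \<le> 0" by (rule least)
      then show "nrm ?A x = 0" using nn[OF x] by (rule antisym)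
    qed
  next
    fix x c assume x: "x \<in> carrier ?A"
    show "nrm ?A (c \<odot>\<^bsub>?A\<^esub> x) = cmod c * nrm ?A x"
    proof (rule antisym[OF n_smult[OF x]])
      show "cmod c * nrm ?A x \<le> nrm ?A (c \<odot>\<^bsub>?A\<^esub> x)"
      proof (cases "c = 0")
        case True
        then show ?thesis using nn[OF c_smult[OF x]] by simp
      next
        case False
        have "inverse c \<odot>\<^bsub>?A\<^esub> (c \<odot>\<^bsub>?A\<^esub> x) = x"
          using False mem[OF x] by (intro eqI ext cl x) (simp add: S(5) ax)
        then show ?thesis
          using n_smult[OF c_smult[OF x, of c], of "inverse c"] False
          by (simp add: norm_divide field_simps)
      qed
    qed
  next
    fix x assume x: "x \<in> carrier ?A"
    have i: "nrm (B i) ((adj ?A x \<otimes>\<^bsub>?A\<^esub> x) i) = (nrm (B i) (x i))\<^sup>2" if "i \<in> I" for i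
      using cstar_algebra.cstar_identity[OF B mem[OF x], OF that that] that by (simp add: S(3,6))
    show "nrm ?A (adj ?A x \<otimes>\<^bsub>?A\<^esub> x) = (nrm ?A x)\<^sup>2"
    proof (rule antisym)
      show "nrm ?A (adj ?A x \<otimes>\<^bsub>?A\<^esub> x) \<le> (nrm ?A x)\<^sup>2"
        using i le[OF x] nonneg[OF x] by (intro least) (simp add: power_mono)
      have "nrm ?A x \<le> sqrt (nrm ?A (adj ?A x \<otimes>\<^bsub>?A\<^esub> x))"
        using i le[OF c_mult[OF c_adj[OF x] x]] by (intro least real_le_rsqrt) metis
      then show "(nrm ?A x)\<^sup>2 \<le> nrm ?A (adj ?A x \<otimes>\<^bsub>?A\<^esub> x)"
        using nn[OF x] nn[OF c_mult[OF c_adj[OF x] x]] by (metis power_mono real_sqrt_pow2)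
    qed
  next
    fix X :: "nat \<Rightarrow> _" assume X: "range X \<subseteq> carrier ?A"
      and C: "\<forall>e>0. \<exists>N. \<forall>m\<ge>N. \<forall>n\<ge>N. nrm ?A (X m \<ominus>\<^bsub>?A\<^esub> X n) < e"
    have XA: "X n \<in> carrier ?A" for n using X by auto
    have Ci: "nrm (B i) (X m i \<ominus>\<^bsub>B i\<^esub> X n i) \<le> nrm ?A (X m \<ominus>\<^bsub>?A\<^esub> X n)" if "i \<in> I" for i m n
      using le[of "X m \<ominus>\<^bsub>?A\<^esub> X n" i] XA that by (simp add: diff)
    have "\<forall>i\<in>I. \<exists>l\<in>carrier (B i). (\<lambda>n. nrm (B i) (X n i \<ominus>\<^bsub>B i\<^esub> l)) \<longlonglongrightarrow> 0"
    proof
      fix i assume i: "i \<in> I"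
      have "\<forall>e>0. \<exists>N. \<forall>m\<ge>N. \<forall>n\<ge>N. nrm (B i) (X m i \<ominus>\<^bsub>B i\<^esub> X n i) < e"
        using C Ci[OF i] by (meson le_less_trans)
      then show "\<exists>l\<in>carrier (B i). (\<lambda>n. nrm (B i) (X n i \<ominus>\<^bsub>B i\<^esub> l)) \<longlonglongrightarrow> 0"
        using cstar_algebra.complete[OF B[OF i], of "\<lambda>n. X n i"] mem[OF XA i] by blast
    qed
    then obtain l0 where l0: "\<And>i. i \<in> I \<Longrightarrow> l0 i \<in> carrier (B i)"
      "\<And>i. i \<in> I \<Longrightarrow> (\<lambda>n. nrm (B i) (X n i \<ominus>\<^bsub>B i\<^esub> l0 i)) \<longlonglongrightarrow> 0"
      by metis
    define l where "l = restrict l0 I"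
    have l: "l i \<in> carrier (B i)" "(\<lambda>n. nrm (B i) (X n i \<ominus>\<^bsub>B i\<^esub> l i)) \<longlonglongrightarrow> 0" if "i \<in> I" for i
      using l0[OF that] that by (simp_all add: l_def)
    have unif: "nrm (B i) (X m i \<ominus>\<^bsub>B i\<^esub> l i) \<le> e"
      if i: "i \<in> I" and N: "\<forall>n\<ge>N. nrm ?A (X m \<ominus>\<^bsub>?A\<^esub> X n) < e" for i m N e
    proof (rule field_le_epsilon)
      fix d :: real assume "d > 0"
      then have "eventually (\<lambda>n. nrm (B i) (X n i \<ominus>\<^bsub>B i\<^esub> l i) < d) sequentially"
        using order_tendstoD(2)[OF l(2)[OF i]] by blast
      then obtain M where M: "\<forall>n\<ge>M. nrm (B i) (X n i \<ominus>\<^bsub>B i\<^esub> l i) < d"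
        by (auto simp: eventually_sequentially)
      let ?n = "max M N"
      have "nrm (B i) (X m i \<ominus>\<^bsub>B i\<^esub> X ?n i) < e"
        using Ci[OF i, of m ?n] N by (meson le_less_trans max.cobounded2)
      moreover have "nrm (B i) (X ?n i \<ominus>\<^bsub>B i\<^esub> l i) < d"
        using M by simp
      moreover have "nrm (B i) (X m i \<ominus>\<^bsub>B i\<^esub> l i)
          \<le> nrm (B i) (X m i \<ominus>\<^bsub>B i\<^esub> X ?n i) + nrm (B i) (X ?n i \<ominus>\<^bsub>B i\<^esub> l i)"
        using cstar_algebra.nrm_tri[OF B[OF i] mem[OF XA i] mem[OF XA i] l(1)[OF i]] .
      ultimately show "nrm (B i) (X m i \<ominus>\<^bsub>B i\<^esub> l i) \<le> e + d"
        by linarith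
    qed
    have lA: "l \<in> carrier ?A"
    proof -
      obtain N where N: "\<forall>m\<ge>N. \<forall>n\<ge>N. nrm ?A (X m \<ominus>\<^bsub>?A\<^esub> X n) < 1"
        using C zero_less_one by blast
      have "nrm (B i) (l i) \<le> 1 + nrm ?A (X N)" if i: "i \<in> I" for i
      proof -
        interpret cstar_algebra "B i" by (rule B[OF i])
        note c = mem[OF XA i, of N] l(1)[OF i]
        have "l i = (l i \<ominus>\<^bsub>B i\<^esub> X N i) \<oplus>\<^bsub>B i\<^esub> X N i"
          using c by (simp add: minus_eq a_assoc l_neg)
        then have "nrm (B i) (l i) \<le> nrm (B i) (l i \<ominus>\<^bsub>B i\<^esub> X N i) + nrm (B i) (X N i)"
          using nrm_add[of "l i \<ominus>\<^bsub>B i\<^esub> X N i" "X N i"] c by simp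
        then show ?thesis
          using nrm_minus[OF c] unif[OF i, of N N 1] N le[OF XA i, of N] by simp
      qed
      then show ?thesis
        using l(1) by (intro memI) (auto simp: l_def)
    qed
    have "(\<lambda>n. nrm ?A (X n \<ominus>\<^bsub>?A\<^esub> l)) \<longlonglongrightarrow> 0"
    proof (rule LIMSEQ_I)
      fix e :: real assume "e > 0"
      then obtain N where N: "\<forall>m\<ge>N. \<forall>n\<ge>N. nrm ?A (X m \<ominus>\<^bsub>?A\<^esub> X n) < e / 2"
        using C half_gt_zero by blast
      have "norm (nrm ?A (X m \<ominus>\<^bsub>?A\<^esub> l) - 0) < e" if "m \<ge> N" for m
      proof -
        have "nrm ?A (X m \<ominus>\<^bsub>?A\<^esub> l) \<le> e / 2"
          using unif[of _ N m "e / 2"] N that by (intro least) (simp add: diff XA lA)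
        then show ?thesis
          using nn[of "X m \<ominus>\<^bsub>?A\<^esub> l"] XA lA \<open>e > 0\<close> by simp
      qed
      then show "\<exists>N. \<forall>n\<ge>N. norm (nrm ?A (X n \<ominus>\<^bsub>?A\<^esub> l) - 0) < e" by blast
    qed
    then show "\<exists>l\<in>carrier ?A. (\<lambda>n. nrm ?A (X n \<ominus>\<^bsub>?A\<^esub> l)) \<longlonglongrightarrow> 0"
      using lA by blast
  qed (rule cl nn n_add n_mult star_ax1 star_ax2; assumption)+
qed

theorem universal_cstar_algebra:
  assumes ne: "reps P R \<noteq> {}"
    and bound: "\<And>p. p \<in> P \<Longrightarrow> \<exists>M. \<forall>(B, w)\<in>reps P R. nrm B (w p) \<le> M"
  shows "cstar_algebra (universal_cstar P R)"
    and "p \<in> P \<Longrightarrow> universal_gen P R p \<in> carrier (universal_cstar P R)"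
    and "(B, w) \<in> reps P R \<Longrightarrow> star_hom (universal_cstar P R) B (\<lambda>x. x (B, w))"
    and "(B, w) \<in> reps P R \<Longrightarrow> universal_gen P R p (B, w) = w p"
proof -
  let ?A = "cstar_product (reps P R) fst"
  let ?V = "generated_subalgebra ?A (universal_gen P R ` P)"
  have A: "cstar_algebra ?A"
    using ne by (rule cstar_algebra_product) (auto simp: reps_def)
  have gen: "universal_gen P R ` P \<subseteq> carrier ?A"
  proof safe
    fix p assume p: "p \<in> P"
    from bound[OF p] obtain M where "\<forall>(B, w)\<in>reps P R. nrm B (w p) \<le> M" ..
    then show "universal_gen P R p \<in> carrier ?A"
      using p by (auto simp: cstar_product_def universal_gen_def reps_def PiE_def Pi_iff
          intro!: bdd_aboveI2[of _ _ M])
  qed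
  have V: "cstar_subalgebra ?A ?V"
    by (rule cstar_subalgebra_generated[OF A gen])
  have U: "universal_cstar P R = ?A\<lparr>carrier := ?V\<rparr>"
    by (simp add: universal_cstar_def Let_def)
  show "cstar_algebra (universal_cstar P R)"
    unfolding U by (rule cstar_algebra_subalgebra[OF A V])
  show "p \<in> P \<Longrightarrow> universal_gen P R p \<in> carrier (universal_cstar P R)"
    by (auto simp: U generated_subalgebra_def)
  have "?V \<subseteq> carrier ?A"
    using V by (simp add: cstar_subalgebra_def closed_subspace_def)
  then have "x (B, w) \<in> carrier B" if "x \<in> ?V" "(B, w) \<in> reps P R" for x B w
    using that PiE_mem[of x "reps P R" "\<lambda>i. carrier (fst i)" "(B, w)"]
    by (auto simp: cstar_product_def)
  then show "(B, w) \<in> reps P R \<Longrightarrow> star_hom (universal_cstar P R) B (\<lambda>x. x (B, w))"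
    by (simp add: star_hom_def U) (simp add: cstar_product_def)
  show "(B, w) \<in> reps P R \<Longrightarrow> universal_gen P R p (B, w) = w p"
    by (simp add: universal_gen_def)
qed


section \<open>Words and constructible right ideals\<close>

text \<open>The word \<open>(p\<^sub>1, p\<^sub>2, \<dots>, p\<^sub>2\<^sub>k\<^sub>-\<^sub>1, p\<^sub>2\<^sub>k)\<close> is encoded as the list \<open>[(p\<^sub>1, p\<^sub>2), \<dots>, (p\<^sub>2\<^sub>k\<^sub>-\<^sub>1, p\<^sub>2\<^sub>k)]\<close>.\<close>

definition words :: "'g set \<Rightarrow> ('g \<times> 'g) list set" where
  "words P = lists (P \<times> P)"

definition word_elt :: "('g, 'm) monoid_scheme \<Rightarrow> ('g \<times> 'g) list \<Rightarrow> 'g" where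
  "word_elt G \<alpha> = foldr (\<lambda>(p, q) x. inv\<^bsub>G\<^esub> p \<otimes>\<^bsub>G\<^esub> (q \<otimes>\<^bsub>G\<^esub> x)) \<alpha> \<one>\<^bsub>G\<^esub>"

definition word_op :: "'b cstar \<Rightarrow> ('g \<Rightarrow> 'b) \<Rightarrow> ('g \<times> 'g) list \<Rightarrow> 'b" where
  "word_op B w \<alpha> = foldr (\<lambda>(p, q) x. adj B (w p) \<otimes>\<^bsub>B\<^esub> (w q \<otimes>\<^bsub>B\<^esub> x)) \<alpha> \<one>\<^bsub>B\<^esub>"

definition neutral_words :: "('g, 'm) monoid_scheme \<Rightarrow> 'g set \<Rightarrow> ('g \<times> 'g) list set" where
  "neutral_words G P = {\<alpha> \<in> words P. word_elt G \<alpha> = \<one>\<^bsub>G\<^esub>}"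

text \<open>
  The group elements \<open>p\<^sub>2\<^sub>k\<^sup>-\<^sup>1 p\<^sub>2\<^sub>k\<^sub>-\<^sub>1 \<cdots> p\<^sub>2\<^sub>i\<^sub>+\<^sub>2\<^sup>-\<^sup>1 p\<^sub>2\<^sub>i\<^sub>+\<^sub>1\<close> occurring in the definition of \<open>K(\<alpha>)\<close> are
  the inverses of the values of the suffixes of \<open>\<alpha>\<close>; the empty suffix contributes \<open>P\<close> itself.
\<close>

definition K_ideal :: "('g, 'm) monoid_scheme \<Rightarrow> 'g set \<Rightarrow> ('g \<times> 'g) list \<Rightarrow> 'g set" where
  "K_ideal G P \<alpha> = (\<Inter>i\<in>{..length \<alpha>}. (inv\<^bsub>G\<^esub> (word_elt G (drop i \<alpha>))) <#\<^bsub>G\<^esub> P)"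

definition constructible :: "('g, 'm) monoid_scheme \<Rightarrow> 'g set \<Rightarrow> 'g set set" where
  "constructible G P = K_ideal G P ` words P"

definition foundation_set ::
  "('g, 'm) monoid_scheme \<Rightarrow> 'g set \<Rightarrow> 'g set \<Rightarrow> 'g set set \<Rightarrow> bool" where
  "foundation_set G P S C \<longleftrightarrow> finite C \<and> C \<subseteq> constructible G P \<and> (\<forall>R\<in>C. R \<subseteq> S) \<and>
     (\<forall>p\<in>S. (p <#\<^bsub>G\<^esub> P) \<inter> \<Union>C \<noteq> {})"

definition proper_foundation_set ::
  "('g, 'm) monoid_scheme \<Rightarrow> 'g set \<Rightarrow> 'g set \<Rightarrow> 'g set set \<Rightarrow> bool" where
  "proper_foundation_set G P S C \<longleftrightarrow> foundation_set G P S C \<and> S - \<Union>C \<noteq> {}"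


section \<open>The universal Toeplitz algebra\<close>

text \<open>
  In (T4) the factors \<open>w\<^sub>\<alpha> - w\<^sub>\<beta>\<close> commute by (T3), so the relation is imposed for every
  enumeration \<open>\<beta>s\<close> of \<open>F\<close>. The set \<open>F\<close> is taken to be nonempty: for empty \<open>F\<close> the intended
  relation is (T2), whereas the product over the empty list is the unit.
\<close>

definition toeplitz_rel ::
  "('g, 'm) monoid_scheme \<Rightarrow> 'g set \<Rightarrow> 'b cstar \<Rightarrow> ('g \<Rightarrow> 'b) \<Rightarrow> bool" where
  "toeplitz_rel G P B w \<longleftrightarrow>
     w \<one>\<^bsub>G\<^esub> = \<one>\<^bsub>B\<^esub> \<and>
     (\<forall>\<alpha>\<in>neutral_words G P. K_ideal G P \<alpha> = {} \<longrightarrow> word_op B w \<alpha> = \<zero>\<^bsub>B\<^esub>) \<and>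
     (\<forall>\<alpha>\<in>neutral_words G P. \<forall>\<beta>\<in>neutral_words G P.
        K_ideal G P \<alpha> = K_ideal G P \<beta> \<longrightarrow> word_op B w \<alpha> = word_op B w \<beta>) \<and>
     (\<forall>\<alpha>\<in>neutral_words G P. \<forall>\<beta>s. \<beta>s \<noteq> [] \<and> distinct \<beta>s \<and> set \<beta>s \<subseteq> neutral_words G P \<and>
        K_ideal G P \<alpha> = (\<Union>\<beta>\<in>set \<beta>s. K_ideal G P \<beta>) \<longrightarrow>
        foldr (\<lambda>\<beta> x. (word_op B w \<alpha> \<ominus>\<^bsub>B\<^esub> word_op B w \<beta>) \<otimes>\<^bsub>B\<^esub> x) \<beta>s \<one>\<^bsub>B\<^esub> = \<zero>\<^bsub>B\<^esub>)"

definition toeplitz_algebra ::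
  "('g, 'm) monoid_scheme \<Rightarrow> 'g set \<Rightarrow> ('g rep \<Rightarrow> 'g universe) cstar" where
  "toeplitz_algebra G P = universal_cstar P (toeplitz_rel G P)"


section \<open>The left regular representation\<close>

text \<open>\<open>\<ell>\<^sup>2(A)\<close> is realised as the functions on the whole type that vanish off \<open>A\<close>.\<close>

definition ell2 :: "'g set \<Rightarrow> ('g \<Rightarrow> complex) set" where
  "ell2 A = {\<xi>. (\<forall>p. p \<notin> A \<longrightarrow> \<xi> p = 0) \<and> (\<lambda>p. (cmod (\<xi> p))\<^sup>2) summable_on UNIV}"

definition ell2_norm :: "('g \<Rightarrow> complex) \<Rightarrow> real" where
  "ell2_norm \<xi> = sqrt (\<Sum>\<^sub>\<infinity>p. (cmod (\<xi> p))\<^sup>2)"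

definition ell2_inner :: "('g \<Rightarrow> complex) \<Rightarrow> ('g \<Rightarrow> complex) \<Rightarrow> complex" where
  "ell2_inner \<xi> \<eta> = (\<Sum>\<^sub>\<infinity>p. cnj (\<xi> p) * \<eta> p)"

definition bounded_ops :: "'g set \<Rightarrow> (('g \<Rightarrow> complex) \<Rightarrow> ('g \<Rightarrow> complex)) set" where
  "bounded_ops A = {T \<in> ell2 A \<rightarrow>\<^sub>E ell2 A.
     (\<forall>\<xi>\<in>ell2 A. \<forall>\<eta>\<in>ell2 A. T (\<lambda>p. \<xi> p + \<eta> p) = (\<lambda>p. T \<xi> p + T \<eta> p)) \<and>
     (\<forall>c. \<forall>\<xi>\<in>ell2 A. T (\<lambda>p. c * \<xi> p) = (\<lambda>p. c * T \<xi> p)) \<and>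
     (\<exists>M. \<forall>\<xi>\<in>ell2 A. ell2_norm (T \<xi>) \<le> M * ell2_norm \<xi>)}"

text \<open>For \<open>A \<subseteq> P\<close> and \<open>T\<close> an operator on \<open>\<ell>\<^sup>2(P)\<close>, this is the norm of the restriction of \<open>T\<close> to \<open>\<ell>\<^sup>2(A)\<close>.\<close>

definition op_norm_on :: "'g set \<Rightarrow> (('g \<Rightarrow> complex) \<Rightarrow> ('g \<Rightarrow> complex)) \<Rightarrow> real" where
  "op_norm_on A T = (SUP \<xi>\<in>{\<xi> \<in> ell2 A. ell2_norm \<xi> \<le> 1}. ell2_norm (T \<xi>))"

definition op_adjoint ::
  "'g set \<Rightarrow> (('g \<Rightarrow> complex) \<Rightarrow> ('g \<Rightarrow> complex)) \<Rightarrow> ('g \<Rightarrow> complex) \<Rightarrow> ('g \<Rightarrow> complex)" where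
  "op_adjoint A T = (THE S. S \<in> bounded_ops A \<and>
     (\<forall>\<xi>\<in>ell2 A. \<forall>\<eta>\<in>ell2 A. ell2_inner (T \<xi>) \<eta> = ell2_inner \<xi> (S \<eta>)))"

definition B_ell2 :: "'g set \<Rightarrow> (('g \<Rightarrow> complex) \<Rightarrow> ('g \<Rightarrow> complex)) cstar" where
  "B_ell2 A =
    \<lparr> carrier = bounded_ops A,
      monoid.mult = (\<lambda>S T. \<lambda>\<xi>\<in>ell2 A. S (T \<xi>)),
      one = (\<lambda>\<xi>\<in>ell2 A. \<xi>),
      zero = (\<lambda>\<xi>\<in>ell2 A. \<lambda>p. 0),
      add = (\<lambda>S T. \<lambda>\<xi>\<in>ell2 A. \<lambda>p. S \<xi> p + T \<xi> p),
      smult = (\<lambda>c T. \<lambda>\<xi>\<in>ell2 A. \<lambda>p. c * T \<xi> p),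
      adj = op_adjoint A,
      nrm = op_norm_on A \<rparr>"

text \<open>The operator determined by \<open>L\<^sub>p \<delta>\<^sub>q = \<delta>\<^sub>p\<^sub>q\<close>.\<close>

definition left_reg ::
  "('g, 'm) monoid_scheme \<Rightarrow> 'g set \<Rightarrow> 'g \<Rightarrow> ('g \<Rightarrow> complex) \<Rightarrow> ('g \<Rightarrow> complex)" where
  "left_reg G P p = (\<lambda>\<xi>\<in>ell2 P. \<lambda>r. if r \<in> p <#\<^bsub>G\<^esub> P then \<xi> (inv\<^bsub>G\<^esub> p \<otimes>\<^bsub>G\<^esub> r) else 0)"

definition indicator_op :: "'g set \<Rightarrow> 'g set \<Rightarrow> ('g \<Rightarrow> complex) \<Rightarrow> ('g \<Rightarrow> complex)" where
  "indicator_op P S = (\<lambda>\<xi>\<in>ell2 P. \<lambda>p. indicator S p * \<xi> p)"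

definition D_r ::
  "('g, 'm) monoid_scheme \<Rightarrow> 'g set \<Rightarrow> (('g \<Rightarrow> complex) \<Rightarrow> ('g \<Rightarrow> complex)) cstar" where
  "D_r G P = (B_ell2 P)\<lparr>carrier := closed_span (B_ell2 P) (indicator_op P ` constructible G P)\<rparr>"


section \<open>The covariance algebra\<close>

definition Delta :: "('g, 'm) monoid_scheme \<Rightarrow> 'g set \<Rightarrow> 'g set \<Rightarrow> 'g set" where
  "Delta G P F = {p \<in> P. \<forall>g\<in>F. (p <#\<^bsub>G\<^esub> P) \<inter> (g <#\<^bsub>G\<^esub> P) = {} \<or>
     (p <#\<^bsub>G\<^esub> P) \<inter> (g <#\<^bsub>G\<^esub> P) = p <#\<^bsub>G\<^esub> P}"

definition D_r_o ::
  "('g, 'm) monoid_scheme \<Rightarrow> 'g set \<Rightarrow> (('g \<Rightarrow> complex) \<Rightarrow> ('g \<Rightarrow> complex)) set" where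
  "D_r_o G P = {b \<in> carrier (D_r G P).
     ((\<lambda>F. op_norm_on (Delta G P F) b) \<longlongrightarrow> 0) (finite_subsets_at_top (carrier G))}"

definition isometric_rep ::
  "('g, 'm) monoid_scheme \<Rightarrow> 'g set \<Rightarrow> 'b cstar \<Rightarrow> ('g \<Rightarrow> 'b) \<Rightarrow> bool" where
  "isometric_rep G P B w \<longleftrightarrow> w \<one>\<^bsub>G\<^esub> = \<one>\<^bsub>B\<^esub> \<and>
     (\<forall>p\<in>P. adj B (w p) \<otimes>\<^bsub>B\<^esub> w p = \<one>\<^bsub>B\<^esub>) \<and>
     (\<forall>p\<in>P. \<forall>q\<in>P. w (p \<otimes>\<^bsub>G\<^esub> q) = w p \<otimes>\<^bsub>B\<^esub> w q)"

definition strongly_covariant ::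
  "('g, 'm) monoid_scheme \<Rightarrow> 'g set \<Rightarrow> 'b cstar \<Rightarrow> ('g \<Rightarrow> 'b) \<Rightarrow> bool" where
  "strongly_covariant G P B w \<longleftrightarrow> isometric_rep G P B w \<and>
     (\<exists>\<phi>. star_hom (D_r G P) B \<phi> \<and>
        (\<forall>\<alpha>\<in>neutral_words G P. \<phi> (word_op (B_ell2 P) (left_reg G P) \<alpha>) = word_op B w \<alpha>) \<and>
        (\<forall>b\<in>D_r_o G P. \<phi> b = \<zero>\<^bsub>B\<^esub>))"

definition covariance_algebra ::
  "('g, 'm) monoid_scheme \<Rightarrow> 'g set \<Rightarrow> ('g rep \<Rightarrow> 'g universe) cstar" where
  "covariance_algebra G P = universal_cstar P (strongly_covariant G P)"

text \<open>
  Strongly covariant representations satisfy (T1)--(T4), so restricting families indexed by the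
  representations of (T1)--(T4) to the strongly covariant ones is a *-homomorphism; it visibly
  sends the generator \<open>t\<^sub>p\<close> to \<open>j\<^sub>p\<close>.
\<close>

definition q_u ::
  "('g, 'm) monoid_scheme \<Rightarrow> 'g set \<Rightarrow> ('g rep \<Rightarrow> 'g universe) \<Rightarrow> ('g rep \<Rightarrow> 'g universe)" where
  "q_u G P = (\<lambda>x\<in>carrier (toeplitz_algebra G P). restrict x (reps P (strongly_covariant G P)))"

end

theory Submission
  imports Defs "HOL-Analysis.L2_Norm"
begin

text \<open>
  By (T1)--(T3) the operators \<open>E S = w\<^sub>\<alpha>\<close>, for \<open>\<alpha>\<close> neutral with \<open>K(\<alpha>) = S\<close>, are commuting projections
  indexed by the constructible ideals, and (T2), (T4) say that an atom \<open>E S \<Prod>(1 - E T)\<close> vanishes when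
  \<open>S \<subseteq> \<Union>T\<close>. Cutting successively by these projections shows that \<open>\<Sum> c\<^sub>i 1\<^bsub>S\<^sub>i\<^esub> \<mapsto> \<Sum> c\<^sub>i E S\<^sub>i\<close> does not
  increase norms, so every representation of (T1)--(T4) extends to \<open>D\<^sub>r\<close>. Under (3) the ideal
  \<open>D\<^sub>r\<^sup>o\<close> is zero: if the value of \<open>\<Sum> c\<^sub>i 1\<^bsub>S\<^sub>i\<^esub>\<close> at a point is large, then it stays so on some \<open>rP\<close>, and \<open>rP\<close>
  meets every \<open>\<Delta>\<^sub>F\<close>. Hence the two universal algebras have the same representations.
  Conversely, a foundation set \<open>C\<close> of proper ideals yields the element \<open>\<Prod>(1 - t\<^sub>\<beta>)\<close>, whose image in
  the left regular representation is the projection onto \<open>\<ell>\<^sup>2(P \<setminus> \<Union>C) \<noteq> 0\<close>, but which lies in \<open>D\<^sub>r\<^sup>o\<close>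
  and is therefore killed by \<open>q\<^sub>u\<close>.
\<close>

section \<open>Words in a submonoid of a group\<close>

text \<open>The indicator functions of constructible ideals may be linearly dependent, so
  prescribing values on them does not yet define a map on \<open>D_r\<close>. Linear combinations
  are therefore kept formal, as lists evaluated both as functions on P and as elements of an
  algebra, and a norm estimate between the two values takes the place of linear independence. The
  estimate needs no spectral theory: splitting along a commuting projection bounds the norm by the
  larger of two pieces, which rests on the C*-identity alone. (T2) and (T4) enter at the end of the
  splitting, where an atom without points would otherwise contribute a norm that no function value
  controls. The universal algebras consist of families indexed by representations, so they are
  compared through their index sets, and one coordinate suffices to see that an element is nonzero.
  That coordinate comes from the left regular representation; since it acts on \<open>ell2\<close>,
  the algebra it generates must be copied into the type of the index set. The same copy shows that
  the index set is not empty. The equivalence of (2) and (3) is independent of this: translating by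
  an uncovered point of S reduces S to P.\<close>

definition word_rev :: "('c \<times> 'c) list \<Rightarrow> ('c \<times> 'c) list" where
  "word_rev \<alpha> = rev (map prod.swap \<alpha>)"

lemma word_rev_simps [simp]:
  "word_rev [] = []" "word_rev ((a, b) # \<alpha>) = word_rev \<alpha> @ [(b, a)]"
  by (simp_all add: word_rev_def)

locale group_submonoid = group G for G (structure) +
  fixes P assumes submonoid: "submonoid P G"
begin

sublocale P: submonoid P G by (rule submonoid)

lemma mem_coset_iff:
  assumes "g \<in> carrier G"
  shows "x \<in> g <#\<^bsub>G\<^esub> P \<longleftrightarrow> x \<in> carrier G \<and> inv g \<otimes> x \<in> P"
proof
  assume "x \<in> g <#\<^bsub>G\<^esub> P"
  then obtain p where "p \<in> P" "x = g \<otimes> p" by (auto simp: l_coset_def)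
  then show "x \<in> carrier G \<and> inv g \<otimes> x \<in> P"
    using assms by (simp add: inv_solve_left' flip: m_assoc)
next
  assume "x \<in> carrier G \<and> inv g \<otimes> x \<in> P"
  moreover from this have "x = g \<otimes> (inv g \<otimes> x)"
    using assms by (simp flip: m_assoc)
  ultimately show "x \<in> g <#\<^bsub>G\<^esub> P" unfolding l_coset_def by blast
qed

lemma coset_subset:
  assumes "p \<in> P" "g \<in> carrier G" "p \<in> g <#\<^bsub>G\<^esub> P"
  shows "p <#\<^bsub>G\<^esub> P \<subseteq> g <#\<^bsub>G\<^esub> P"
proof
  fix x assume "x \<in> p <#\<^bsub>G\<^esub> P"
  then obtain q where q: "q \<in> P" "x = p \<otimes> q" by (auto simp: l_coset_def)
  then show "x \<in> g <#\<^bsub>G\<^esub> P"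
    using assms P.m_closed[of "inv g \<otimes> p" q] by (simp add: mem_coset_iff m_assoc)
qed

lemma words_simps [simp]:
  "[] \<in> words P" "(a, b) # \<alpha> \<in> words P \<longleftrightarrow> a \<in> P \<and> b \<in> P \<and> \<alpha> \<in> words P"
  "\<alpha> @ \<beta> \<in> words P \<longleftrightarrow> \<alpha> \<in> words P \<and> \<beta> \<in> words P"
  by (auto simp: words_def)

lemma word_elt_simps [simp]:
  "word_elt G [] = \<one>" "word_elt G ((a, b) # \<alpha>) = inv a \<otimes> (b \<otimes> word_elt G \<alpha>)"
  by (simp_all add: word_elt_def)

lemma word_elt_closed [simp, intro]: "\<alpha> \<in> words P \<Longrightarrow> word_elt G \<alpha> \<in> carrier G"
  by (induction \<alpha>) auto

lemma word_elt_append: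
  "\<alpha> \<in> words P \<Longrightarrow> \<beta> \<in> words P \<Longrightarrow> word_elt G (\<alpha> @ \<beta>) = word_elt G \<alpha> \<otimes> word_elt G \<beta>"
  by (induction \<alpha>) (auto simp: m_assoc)

lemma drop_words: "\<alpha> \<in> words P \<Longrightarrow> drop i \<alpha> \<in> words P"
  unfolding words_def using set_drop_subset[of i \<alpha>] by (auto simp: lists_eq_set)

text \<open>Read from the right, a word acts on p by successive partial left translations;
  K(\<alpha>) is the set of p whose images after each pair stay in P, that is, the domain of the
  partial translation by \<open>word_elt G \<alpha>\<close> along the word.\<close>

lemma mem_K_ideal_iff:
  assumes "\<alpha> \<in> words P"
  shows "p \<in> K_ideal G P \<alpha> \<longleftrightarrow> p \<in> P \<and> (\<forall>i\<le>length \<alpha>. word_elt G (drop i \<alpha>) \<otimes> p \<in> P)"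
proof -
  have "p \<in> K_ideal G P \<alpha> \<longleftrightarrow>
      (\<forall>i\<le>length \<alpha>. p \<in> carrier G \<and> word_elt G (drop i \<alpha>) \<otimes> p \<in> P)"
    using assms drop_words by (auto simp: K_ideal_def mem_coset_iff)
  also have "\<dots> \<longleftrightarrow> p \<in> P \<and> (\<forall>i\<le>length \<alpha>. word_elt G (drop i \<alpha>) \<otimes> p \<in> P)"
    by (auto dest: spec[of _ "length \<alpha>"])
  finally show ?thesis .
qed

lemma mem_K_ideal_Nil [simp]: "p \<in> K_ideal G P [] \<longleftrightarrow> p \<in> P"
  by (auto simp: mem_K_ideal_iff)

lemma mem_K_ideal_Cons:
  assumes "x # \<alpha> \<in> words P"
  shows "p \<in> K_ideal G P (x # \<alpha>) \<longleftrightarrow> p \<in> K_ideal G P \<alpha> \<and> word_elt G (x # \<alpha>) \<otimes> p \<in> P"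
proof -
  have \<alpha>: "\<alpha> \<in> words P" using assms by (cases x) simp
  have "(\<forall>i\<le>length (x # \<alpha>). word_elt G (drop i (x # \<alpha>)) \<otimes> p \<in> P) \<longleftrightarrow>
     word_elt G (x # \<alpha>) \<otimes> p \<in> P \<and> (\<forall>i\<le>length \<alpha>. word_elt G (drop i \<alpha>) \<otimes> p \<in> P)"
    by (simp del: word_elt_simps) (metis (no_types, lifting) Suc_le_mono drop0 drop_Suc_Cons not0_implies_Suc zero_le)
  then show ?thesis
    using mem_K_ideal_iff[OF assms] mem_K_ideal_iff[OF \<alpha>] by blast
qed

lemma K_ideal_subset: "\<alpha> \<in> words P \<Longrightarrow> K_ideal G P \<alpha> \<subseteq> P"
  by (auto simp: mem_K_ideal_iff)

lemma K_ideal_carrier: "\<alpha> \<in> words P \<Longrightarrow> p \<in> K_ideal G P \<alpha> \<Longrightarrow> p \<in> carrier G"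
  using K_ideal_subset[of \<alpha>] by auto

lemma word_elt_K_ideal: "\<alpha> \<in> words P \<Longrightarrow> p \<in> K_ideal G P \<alpha> \<Longrightarrow> word_elt G \<alpha> \<otimes> p \<in> P"
  by (auto simp: mem_K_ideal_iff dest: spec[of _ 0])

text \<open>Domain of a composite: \<beta> acts first, and the point it produces must lie in the
  domain of \<alpha>.\<close>

lemma K_ideal_append:
  assumes "\<alpha> \<in> words P" "\<beta> \<in> words P"
  shows "p \<in> K_ideal G P (\<alpha> @ \<beta>) \<longleftrightarrow> p \<in> K_ideal G P \<beta> \<and> word_elt G \<beta> \<otimes> p \<in> K_ideal G P \<alpha>"
  using assms(1)
proof (induction \<alpha>)
  case Nil
  then show ?case using word_elt_K_ideal[OF assms(2)] by auto
next
  case (Cons x \<alpha>)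
  have \<alpha>: "\<alpha> \<in> words P" using Cons.prems by (cases x) simp
  have "x # \<alpha> @ \<beta> \<in> words P" using Cons.prems assms(2) by (cases x) simp
  moreover have "p \<in> carrier G \<Longrightarrow>
      word_elt G (x # \<alpha> @ \<beta>) \<otimes> p = word_elt G (x # \<alpha>) \<otimes> (word_elt G \<beta> \<otimes> p)"
    using word_elt_append[of "x # \<alpha>" \<beta>] Cons.prems assms(2) by (simp add: m_assoc)
  ultimately show ?case
    using Cons.IH[OF \<alpha>] Cons.prems K_ideal_carrier[OF assms(2), of p]
    by (auto simp: mem_K_ideal_Cons simp del: word_elt_simps)
qed

lemma word_rev_words [simp]: "\<alpha> \<in> words P \<Longrightarrow> word_rev \<alpha> \<in> words P"
  by (induction \<alpha>) auto

lemma word_elt_rev: "\<alpha> \<in> words P \<Longrightarrow> word_elt G (word_rev \<alpha>) = inv (word_elt G \<alpha>)"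
  by (induction \<alpha>) (auto simp: word_elt_append inv_mult_group m_assoc)

text \<open>\<open>word_rev \<alpha>\<close> runs the partial translation backwards, so its domain
  is the image of K(\<alpha>). It is the counterpart of the adjoint on the level of words.\<close>

lemma mem_K_ideal_rev:
  assumes "\<alpha> \<in> words P"
  shows "p \<in> K_ideal G P (word_rev \<alpha>) \<longleftrightarrow> p \<in> P \<and> inv (word_elt G \<alpha>) \<otimes> p \<in> K_ideal G P \<alpha>"
  using assms
proof (induction \<alpha> arbitrary: p)
  case Nil
  show ?case by auto
next
  case (Cons x \<alpha>)
  obtain a b where x: "x = (a, b)" by (cases x)
  with Cons.prems have w: "a \<in> P" "b \<in> P" "\<alpha> \<in> words P" by auto
  have K1: "p \<in> K_ideal G P [(b, a)] \<longleftrightarrow> p \<in> P \<and> inv b \<otimes> (a \<otimes> p) \<in> P"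
    using w by (subst mem_K_ideal_Cons) (auto simp: m_assoc)
  have "p \<in> K_ideal G P (word_rev (x # \<alpha>)) \<longleftrightarrow>
      p \<in> K_ideal G P [(b, a)] \<and> inv b \<otimes> (a \<otimes> p) \<in> K_ideal G P (word_rev \<alpha>)"
    using w by (auto simp: x K_ideal_append K1 m_assoc)
  also have "\<dots> \<longleftrightarrow> p \<in> P \<and> inv b \<otimes> (a \<otimes> p) \<in> P \<and>
      inv (word_elt G \<alpha>) \<otimes> (inv b \<otimes> (a \<otimes> p)) \<in> K_ideal G P \<alpha>"
    using Cons.IH[OF w(3)] by (auto simp: K1)
  also have "\<dots> \<longleftrightarrow> p \<in> P \<and> inv (word_elt G (x # \<alpha>)) \<otimes> p \<in> K_ideal G P (x # \<alpha>)"
  proof (cases "p \<in> P")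
    case True
    have e: "inv (word_elt G (x # \<alpha>)) \<otimes> p = inv (word_elt G \<alpha>) \<otimes> (inv b \<otimes> (a \<otimes> p))"
      using w True by (simp add: x inv_mult_group m_assoc)
    have "word_elt G (x # \<alpha>) \<otimes> (inv (word_elt G (x # \<alpha>)) \<otimes> p) = p"
      using Cons.prems True word_elt_closed[OF Cons.prems] by (simp del: word_elt_simps flip: m_assoc)
    moreover have "word_elt G \<alpha> \<otimes> (inv (word_elt G \<alpha>) \<otimes> (inv b \<otimes> (a \<otimes> p))) = inv b \<otimes> (a \<otimes> p)"
      using w True by (simp flip: m_assoc)
    ultimately show ?thesis
      unfolding mem_K_ideal_Cons[OF Cons.prems] e using True word_elt_K_ideal[OF w(3)] by force
  qed simp
  finally show ?case .
qed

section \<open>Neutral words and constructible right ideals\<close>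

lemma neutral_wordsD:
  "\<alpha> \<in> neutral_words G P \<Longrightarrow> \<alpha> \<in> words P" "\<alpha> \<in> neutral_words G P \<Longrightarrow> word_elt G \<alpha> = \<one>"
  by (auto simp: neutral_words_def)

lemma neutral_append:
  assumes "\<alpha> \<in> neutral_words G P" "\<beta> \<in> neutral_words G P"
  shows "\<alpha> @ \<beta> \<in> neutral_words G P"
    "K_ideal G P (\<alpha> @ \<beta>) = K_ideal G P \<alpha> \<inter> K_ideal G P \<beta>"
  using assms K_ideal_carrier[of \<beta>] by (auto simp: neutral_words_def word_elt_append K_ideal_append)

lemma neutral_rev:
  assumes "\<alpha> \<in> neutral_words G P"
  shows "word_rev \<alpha> \<in> neutral_words G P" "K_ideal G P (word_rev \<alpha>) = K_ideal G P \<alpha>"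
  using assms K_ideal_subset[of \<alpha>] by (auto simp: neutral_words_def word_elt_rev mem_K_ideal_rev)

lemma Nil_neutral [simp]: "[] \<in> neutral_words G P"
  by (simp add: neutral_words_def)

lemma K_ideal_Nil: "K_ideal G P [] = P"
  by auto

text \<open>Following \<alpha> by its reversal returns each point of K(\<alpha>) to itself and
  restricts the domain no further. Hence the ideals of arbitrary words, used for foundation sets,
  are already those of neutral words, the only ones in (T2)-(T4).\<close>

lemma constructible_neutral:
  assumes "S \<in> constructible G P"
  shows "\<exists>\<alpha>\<in>neutral_words G P. K_ideal G P \<alpha> = S"
proof -
  obtain \<alpha> where \<alpha>: "\<alpha> \<in> words P" "S = K_ideal G P \<alpha>"
    using assms by (auto simp: constructible_def)
  have "word_rev \<alpha> @ \<alpha> \<in> neutral_words G P"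
    using \<alpha> by (auto simp: neutral_words_def word_elt_append word_elt_rev)
  moreover have "inv (word_elt G \<alpha>) \<otimes> (word_elt G \<alpha> \<otimes> p) = p" if "p \<in> S" for p
    using K_ideal_carrier[OF \<alpha>(1)] that \<alpha> by (simp flip: m_assoc)
  then have "K_ideal G P (word_rev \<alpha> @ \<alpha>) = S"
    using \<alpha> word_elt_K_ideal[OF \<alpha>(1)] by (auto simp: K_ideal_append mem_K_ideal_rev)
  ultimately show ?thesis by blast
qed

lemma constructibleI: "\<alpha> \<in> words P \<Longrightarrow> K_ideal G P \<alpha> \<in> constructible G P"
  by (auto simp: constructible_def)

lemma constructible_Int:
  assumes "S \<in> constructible G P" "T \<in> constructible G P"
  shows "S \<inter> T \<in> constructible G P"
  using constructible_neutral[OF assms(1)] constructible_neutral[OF assms(2)]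
  by (metis neutral_append constructibleI neutral_wordsD(1))

lemma constructible_P: "P \<in> constructible G P"
  using constructibleI[of "[]"] K_ideal_Nil by simp

lemma constructible_subset: "S \<in> constructible G P \<Longrightarrow> S \<subseteq> P"
  using K_ideal_subset by (auto simp: constructible_def)

text \<open>The pair \<open>(\<one>, p)\<close> at the right end of a word applies left translation
  by p before everything else.\<close>

lemma constructible_preimage:
  assumes "S \<in> constructible G P" "p \<in> P"
  shows "{q \<in> P. p \<otimes> q \<in> S} \<in> constructible G P"
proof -
  obtain \<alpha> where \<alpha>: "\<alpha> \<in> words P" "S = K_ideal G P \<alpha>"
    using assms by (auto simp: constructible_def)
  have "q \<in> K_ideal G P (\<alpha> @ [(\<one>, p)]) \<longleftrightarrow> q \<in> P \<and> p \<otimes> q \<in> S" for q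
    using \<alpha> assms(2) by (auto simp: K_ideal_append mem_K_ideal_Cons)
  then have "{q \<in> P. p \<otimes> q \<in> S} = K_ideal G P (\<alpha> @ [(\<one>, p)])" by blast
  then show ?thesis using \<alpha> assms(2) by (simp add: constructibleI)
qed

lemma K_ideal_right_ideal:
  assumes "\<alpha> \<in> words P" "p \<in> K_ideal G P \<alpha>" "q \<in> P"
  shows "p \<otimes> q \<in> K_ideal G P \<alpha>"
proof -
  have "word_elt G (drop i \<alpha>) \<otimes> (p \<otimes> q) \<in> P" if "i \<le> length \<alpha>" for i
    using assms that mem_K_ideal_iff[OF assms(1), of p] P.m_closed[of "word_elt G (drop i \<alpha>) \<otimes> p" q]
      drop_words[OF assms(1)] by (simp add: m_assoc)
  then show ?thesis
    using assms mem_K_ideal_iff[OF assms(1)] by auto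
qed

lemma constructible_right_ideal:
  "S \<in> constructible G P \<Longrightarrow> p \<in> S \<Longrightarrow> p <#\<^bsub>G\<^esub> P \<subseteq> S"
  using K_ideal_right_ideal by (auto simp: constructible_def l_coset_def)

lemma one_mem_constructible:
  assumes "S \<in> constructible G P" "\<one> \<in> S"
  shows "S = P"
proof
  show "P \<subseteq> S"
    using constructible_right_ideal[OF assms] by (auto simp: l_coset_def)
qed (rule constructible_subset[OF assms(1)])

text \<open>A proper constructible ideal misses the identity, so proper ideals never cover P.
  Conversely, choose p in S outside all members of C and pull back along q \<mapsto> pq: the
  preimage of S is P because pP \<subseteq> S, and no preimage of a member contains the identity
  because p lies in no member.\<close>

lemma foundation_iff_proper_foundation:
  "(\<exists>C. (\<forall>R\<in>C. R \<noteq> P) \<and> foundation_set G P P C) \<longleftrightarrow>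
   (\<exists>S\<in>constructible G P. S \<noteq> {} \<and> (\<exists>C. proper_foundation_set G P S C))"
proof
  assume "\<exists>C. (\<forall>R\<in>C. R \<noteq> P) \<and> foundation_set G P P C"
  then obtain C where C: "\<forall>R\<in>C. R \<noteq> P" "foundation_set G P P C" by blast
  then have "\<one> \<notin> \<Union>C"
    using one_mem_constructible unfolding foundation_set_def by blast
  then have "P - \<Union>C \<noteq> {}" using P.one_closed by blast
  then have "proper_foundation_set G P P C"
    using C by (simp add: proper_foundation_set_def)
  then show "\<exists>S\<in>constructible G P. S \<noteq> {} \<and> (\<exists>C. proper_foundation_set G P S C)"
    using constructible_P \<open>P - \<Union>C \<noteq> {}\<close> by blast
next
  assume "\<exists>S\<in>constructible G P. S \<noteq> {} \<and> (\<exists>C. proper_foundation_set G P S C)"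
  then obtain S C p where S: "S \<in> constructible G P" and C: "foundation_set G P S C"
    and p: "p \<in> S" "p \<notin> \<Union>C" by (auto simp: proper_foundation_set_def)
  have pP: "p \<in> P" using p S constructible_subset by blast
  define T where "T R = {q \<in> P. p \<otimes> q \<in> R}" for R
  have "T R \<noteq> P" if "R \<in> C" for R
    using p(2) that pP by (auto simp: T_def set_eq_iff intro!: exI[of _ \<one>])
  moreover have "(q <#\<^bsub>G\<^esub> P) \<inter> \<Union>(T ` C) \<noteq> {}" if q: "q \<in> P" for q
  proof -
    have "p \<otimes> q \<in> S"
      using constructible_right_ideal[OF S p(1)] q by (auto simp: l_coset_def)
    then obtain R x where "R \<in> C" "x \<in> R" "x \<in> (p \<otimes> q) <#\<^bsub>G\<^esub> P"
      using C by (fastforce simp: foundation_set_def)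
    then obtain r where "r \<in> P" "R \<in> C" "p \<otimes> q \<otimes> r \<in> R"
      by (auto simp: l_coset_def)
    then have "q \<otimes> r \<in> T R" "q \<otimes> r \<in> q <#\<^bsub>G\<^esub> P"
      using q pP by (auto simp: T_def m_assoc l_coset_def)
    then show ?thesis using \<open>R \<in> C\<close> by blast
  qed
  ultimately have "(\<forall>R\<in>T ` C. R \<noteq> P) \<and> foundation_set G P P (T ` C)"
    using C constructible_preimage[OF _ pP] by (auto simp: foundation_set_def T_def)
  then show "\<exists>C. (\<forall>R\<in>C. R \<noteq> P) \<and> foundation_set G P P C" by blast
qed

text \<open>If qP meets gP, replace q by a common point q': then q'P lies inside gP. Decisions
  already made for other elements of F survive, since containment and disjointness pass to the
  smaller set q'P.\<close>

lemma Delta_refine: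
  assumes "finite F" "F \<subseteq> carrier G" "r \<in> P"
  shows "\<exists>q\<in>Delta G P F. q \<in> r <#\<^bsub>G\<^esub> P"
  using assms(1,2)
proof (induction F)
  case empty
  show ?case using assms(3) by (auto simp: Delta_def mem_coset_iff intro!: bexI[of _ r])
next
  case (insert g F)
  then obtain q where q: "q \<in> Delta G P F" "q \<in> r <#\<^bsub>G\<^esub> P" by auto
  have qP: "q \<in> P" using q by (simp add: Delta_def)
  have g: "g \<in> carrier G" "F \<subseteq> carrier G" using insert by auto
  show ?case
  proof (cases "(q <#\<^bsub>G\<^esub> P) \<inter> (g <#\<^bsub>G\<^esub> P) = {}")
    case True
    then show ?thesis using q by (auto simp: Delta_def)
  next
    case False
    then obtain q' where q': "q' \<in> q <#\<^bsub>G\<^esub> P" "q' \<in> g <#\<^bsub>G\<^esub> P" by auto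
    then have P: "q' \<in> P" using qP by (auto simp: l_coset_def)
    have s: "q' <#\<^bsub>G\<^esub> P \<subseteq> q <#\<^bsub>G\<^esub> P" "q' <#\<^bsub>G\<^esub> P \<subseteq> g <#\<^bsub>G\<^esub> P"
      using coset_subset P q' qP g by auto
    have "q' \<in> r <#\<^bsub>G\<^esub> P"
      using q' q(2) coset_subset[OF qP _ q(2)] assms(3) by auto
    moreover have "q' \<in> Delta G P (insert g F)"
      unfolding Delta_def
    proof (intro CollectI conjI ballI P)
      fix h assume "h \<in> insert g F"
      then consider "h = g" | "(q <#\<^bsub>G\<^esub> P) \<inter> (h <#\<^bsub>G\<^esub> P) = {}"
        | "(q <#\<^bsub>G\<^esub> P) \<inter> (h <#\<^bsub>G\<^esub> P) = q <#\<^bsub>G\<^esub> P"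
        using q(1) by (auto simp: Delta_def)
      then show "(q' <#\<^bsub>G\<^esub> P) \<inter> (h <#\<^bsub>G\<^esub> P) = {} \<or>
          (q' <#\<^bsub>G\<^esub> P) \<inter> (h <#\<^bsub>G\<^esub> P) = q' <#\<^bsub>G\<^esub> P"
        using s by cases blast+
    qed
    ultimately show ?thesis by blast
  qed
qed

text \<open>If \<open>F\<close> contains the group elements whose cosets define \<open>S\<close>, then \<open>S\<close> cannot split \<open>pP\<close> for \<open>p \<in> \<Delta>\<^sub>F\<close>.\<close>

lemma Delta_decides:
  assumes "S \<in> constructible G P"
  shows "\<exists>F. finite F \<and> F \<subseteq> carrier G \<and>
    (\<forall>F' p. F \<subseteq> F' \<longrightarrow> p \<in> Delta G P F' \<longrightarrow> (p <#\<^bsub>G\<^esub> P) \<inter> S \<noteq> {} \<longrightarrow> p \<in> S)"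
proof -
  obtain \<alpha> where \<alpha>: "\<alpha> \<in> words P" "S = K_ideal G P \<alpha>"
    using assms by (auto simp: constructible_def)
  let ?F = "(\<lambda>i. inv (word_elt G (drop i \<alpha>))) ` {..length \<alpha>}"
  have "p \<in> S" if F': "?F \<subseteq> F'" and p: "p \<in> Delta G P F'" and ne: "(p <#\<^bsub>G\<^esub> P) \<inter> S \<noteq> {}" for F' p
  proof -
    have "p \<in> inv (word_elt G (drop i \<alpha>)) <#\<^bsub>G\<^esub> P" if "i \<le> length \<alpha>" for i
    proof -
      have "(p <#\<^bsub>G\<^esub> P) \<inter> (inv (word_elt G (drop i \<alpha>)) <#\<^bsub>G\<^esub> P) \<noteq> {}"
        using ne that by (auto simp: \<alpha> K_ideal_def)
      then have "p <#\<^bsub>G\<^esub> P \<subseteq> inv (word_elt G (drop i \<alpha>)) <#\<^bsub>G\<^esub> P"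
        using p F' that by (auto simp: Delta_def)
      moreover have "p \<in> p <#\<^bsub>G\<^esub> P" using p by (auto simp: Delta_def mem_coset_iff)
      ultimately show ?thesis by blast
    qed
    then show "p \<in> S" by (auto simp: \<alpha> K_ideal_def)
  qed
  moreover have "finite ?F" "?F \<subseteq> carrier G"
    using \<alpha> drop_words by auto
  ultimately show ?thesis by blast
qed

end


section \<open>The C*-algebra of bounded operators\<close>

abbreviation L2_on :: "('g \<Rightarrow> complex) \<Rightarrow> 'g set \<Rightarrow> real" where
  "L2_on \<xi> F \<equiv> L2_set (\<lambda>p. cmod (\<xi> p)) F"

lemma ell2D: "\<xi> \<in> ell2 A \<Longrightarrow> p \<notin> A \<Longrightarrow> \<xi> p = 0"
  by (simp add: ell2_def)

lemma ell2_mono: "\<xi> \<in> ell2 A \<Longrightarrow> A \<subseteq> B \<Longrightarrow> \<xi> \<in> ell2 B"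
  by (auto simp: ell2_def)

lemma
  assumes 0: "\<And>p. p \<notin> A \<Longrightarrow> \<xi> p = 0" and le: "\<And>F. finite F \<Longrightarrow> L2_on \<xi> F \<le> M"
  shows ell2I: "\<xi> \<in> ell2 A" and ell2_norm_leI: "ell2_norm \<xi> \<le> M"
proof -
  have M: "0 \<le> M" using le[of "{}"] by simp
  have le': "(\<Sum>p\<in>F. (cmod (\<xi> p))\<^sup>2) \<le> M\<^sup>2" if "finite F" for F
    using le[OF that] M unfolding L2_set_def by (simp add: real_le_lsqrt sqrt_le_D)
  have s: "(\<lambda>p. (cmod (\<xi> p))\<^sup>2) summable_on UNIV"
    by (rule nonneg_bdd_above_summable_on) (auto intro!: bdd_aboveI2[of _ _ "M\<^sup>2"] le')
  then show "\<xi> \<in> ell2 A" using 0 by (simp add: ell2_def)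
  show "ell2_norm \<xi> \<le> M"
    unfolding ell2_norm_def using M infsum_le_finite_sums[OF s le'] by (simp add: real_le_lsqrt infsum_nonneg)
qed

lemma L2_on_le_ell2_norm:
  assumes "\<xi> \<in> ell2 A" "finite F"
  shows "L2_on \<xi> F \<le> ell2_norm \<xi>"
  unfolding L2_set_def ell2_norm_def
  using assms by (intro real_sqrt_le_mono finite_sum_le_infsum) (auto simp: ell2_def)

lemma ell2_norm_nonneg [simp]: "0 \<le> ell2_norm \<xi>"
  by (simp add: ell2_norm_def infsum_nonneg)

lemma cmod_le_ell2_norm: "\<xi> \<in> ell2 A \<Longrightarrow> cmod (\<xi> p) \<le> ell2_norm \<xi>"
  using L2_on_le_ell2_norm[of \<xi> A "{p}"] by simp

lemma ell2_norm_eq_0: "\<xi> \<in> ell2 A \<Longrightarrow> ell2_norm \<xi> = 0 \<Longrightarrow> \<xi> p = 0"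
  using cmod_le_ell2_norm[of \<xi> A p] by simp

lemma L2_on_add: "L2_on (\<lambda>p. \<xi> p + \<eta> p) F \<le> L2_on \<xi> F + L2_on \<eta> F"
proof -
  have "L2_on (\<lambda>p. \<xi> p + \<eta> p) F \<le> L2_set (\<lambda>p. cmod (\<xi> p) + cmod (\<eta> p)) F"
    by (rule L2_set_mono) (auto simp: norm_triangle_ineq)
  also have "\<dots> \<le> L2_on \<xi> F + L2_on \<eta> F" by (rule L2_set_triangle_ineq)
  finally show ?thesis .
qed

lemma
  assumes "\<xi> \<in> ell2 A" "\<eta> \<in> ell2 A"
  shows ell2_add: "(\<lambda>p. \<xi> p + \<eta> p) \<in> ell2 A"
    and ell2_norm_add: "ell2_norm (\<lambda>p. \<xi> p + \<eta> p) \<le> ell2_norm \<xi> + ell2_norm \<eta>"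
proof -
  have "L2_on (\<lambda>p. \<xi> p + \<eta> p) F \<le> ell2_norm \<xi> + ell2_norm \<eta>" if "finite F" for F
    using L2_on_add[of \<xi> \<eta> F] L2_on_le_ell2_norm[OF assms(1) that] L2_on_le_ell2_norm[OF assms(2) that]
    by simp
  then show "(\<lambda>p. \<xi> p + \<eta> p) \<in> ell2 A" "ell2_norm (\<lambda>p. \<xi> p + \<eta> p) \<le> ell2_norm \<xi> + ell2_norm \<eta>"
    using assms by (auto intro!: ell2I ell2_norm_leI simp: ell2D)
qed

lemma
  assumes "\<xi> \<in> ell2 A" "\<And>p. cmod (g p) \<le> M" "0 \<le> M"
  shows ell2_mult: "(\<lambda>p. g p * \<xi> p) \<in> ell2 A"
    and ell2_norm_mult: "ell2_norm (\<lambda>p. g p * \<xi> p) \<le> M * ell2_norm \<xi>"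
proof -
  have "L2_on (\<lambda>p. g p * \<xi> p) F \<le> M * ell2_norm \<xi>" if "finite F" for F
  proof -
    have "L2_on (\<lambda>p. g p * \<xi> p) F \<le> L2_set (\<lambda>p. M * cmod (\<xi> p)) F"
      by (rule L2_set_mono) (auto simp: norm_mult assms mult_right_mono)
    also have "\<dots> = M * L2_on \<xi> F" using assms by (simp add: L2_set_right_distrib)
    also have "\<dots> \<le> M * ell2_norm \<xi>"
      using L2_on_le_ell2_norm[OF assms(1) that] assms by (simp add: mult_left_mono)
    finally show ?thesis .
  qed
  then show "(\<lambda>p. g p * \<xi> p) \<in> ell2 A" "ell2_norm (\<lambda>p. g p * \<xi> p) \<le> M * ell2_norm \<xi>"
    using assms by (auto intro!: ell2I ell2_norm_leI simp: ell2D)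
qed

lemma ell2_zero [simp]: "(\<lambda>p. 0) \<in> ell2 A" "ell2_norm (\<lambda>p. 0) = 0"
  by (simp_all add: ell2_def ell2_norm_def)

lemma ell2_scale: "\<xi> \<in> ell2 A \<Longrightarrow> (\<lambda>p. c * \<xi> p) \<in> ell2 A"
  by (rule ell2_mult[where M = "cmod c"]) auto

lemma ell2_norm_scale:
  assumes "\<xi> \<in> ell2 A"
  shows "ell2_norm (\<lambda>p. c * \<xi> p) = cmod c * ell2_norm \<xi>"
proof -
  have "(\<Sum>\<^sub>\<infinity>p. (cmod (c * \<xi> p))\<^sup>2) = (cmod c)\<^sup>2 * (\<Sum>\<^sub>\<infinity>p. (cmod (\<xi> p))\<^sup>2)"
    by (simp add: norm_mult power_mult_distrib infsum_cmult_right')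
  then show ?thesis by (simp add: ell2_norm_def real_sqrt_mult)
qed

lemma ell2_diff:
  assumes "\<xi> \<in> ell2 A" "\<eta> \<in> ell2 A"
  shows "(\<lambda>p. \<xi> p - \<eta> p) \<in> ell2 A"
  using ell2_add[OF assms(1) ell2_scale[OF assms(2), of "-1"]] by simp

lemma inner_summable:
  assumes "\<xi> \<in> ell2 A" "\<eta> \<in> ell2 B"
  shows "(\<lambda>p. cnj (\<xi> p) * \<eta> p) summable_on UNIV"
    and "cmod (ell2_inner \<xi> \<eta>) \<le> ell2_norm \<xi> * ell2_norm \<eta>"
proof -
  let ?f = "\<lambda>p. cmod (cnj (\<xi> p) * \<eta> p)"
  have le: "sum ?f F \<le> ell2_norm \<xi> * ell2_norm \<eta>" if "finite F" for F
  proof -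
    have "sum ?f F = (\<Sum>p\<in>F. \<bar>cmod (\<xi> p)\<bar> * \<bar>cmod (\<eta> p)\<bar>)"
      by (simp add: norm_mult)
    also have "\<dots> \<le> L2_on \<xi> F * L2_on \<eta> F" by (rule L2_set_mult_ineq)
    also have "\<dots> \<le> ell2_norm \<xi> * ell2_norm \<eta>"
      using assms that by (intro mult_mono L2_on_le_ell2_norm) auto
    finally show ?thesis .
  qed
  have abs: "?f summable_on UNIV"
    by (rule nonneg_bdd_above_summable_on)
      (auto intro!: bdd_aboveI2[of _ _ "ell2_norm \<xi> * ell2_norm \<eta>"] le)
  then show "(\<lambda>p. cnj (\<xi> p) * \<eta> p) summable_on UNIV" by (rule abs_summable_summable)
  have "cmod (ell2_inner \<xi> \<eta>) \<le> infsum ?f UNIV"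
    unfolding ell2_inner_def using abs by (rule norm_infsum_bound)
  also have "\<dots> \<le> ell2_norm \<xi> * ell2_norm \<eta>"
    using abs le by (rule infsum_le_finite_sums)
  finally show "cmod (ell2_inner \<xi> \<eta>) \<le> ell2_norm \<xi> * ell2_norm \<eta>" .
qed

lemma inner_add_right:
  assumes "\<xi> \<in> ell2 A" "\<eta> \<in> ell2 A" "\<zeta> \<in> ell2 A"
  shows "ell2_inner \<xi> (\<lambda>p. \<eta> p + \<zeta> p) = ell2_inner \<xi> \<eta> + ell2_inner \<xi> \<zeta>"
  using infsum_add[OF inner_summable(1)[OF assms(1,2)] inner_summable(1)[OF assms(1,3)]]
  by (simp add: ell2_inner_def algebra_simps)

lemma inner_scale_right: "ell2_inner \<xi> (\<lambda>p. c * \<eta> p) = c * ell2_inner \<xi> \<eta>"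
  unfolding ell2_inner_def by (subst infsum_cmult_right'[symmetric]) (simp add: algebra_simps)

lemma inner_commute: "ell2_inner \<eta> \<xi> = cnj (ell2_inner \<xi> \<eta>)"
  unfolding ell2_inner_def by (subst infsum_cnj[symmetric]) (simp add: mult.commute)

lemma inner_add_left:
  assumes "\<xi> \<in> ell2 A" "\<eta> \<in> ell2 A" "\<zeta> \<in> ell2 A"
  shows "ell2_inner (\<lambda>p. \<eta> p + \<zeta> p) \<xi> = ell2_inner \<eta> \<xi> + ell2_inner \<zeta> \<xi>"
  using inner_add_right[OF assms] by (simp add: inner_commute[of _ \<xi>])

lemma inner_scale_left: "ell2_inner (\<lambda>p. c * \<eta> p) \<xi> = cnj c * ell2_inner \<eta> \<xi>"
  by (simp add: inner_commute[of _ \<xi>] inner_scale_right)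

lemma inner_self:
  assumes "\<xi> \<in> ell2 A"
  shows "ell2_inner \<xi> \<xi> = of_real ((ell2_norm \<xi>)\<^sup>2)"
proof -
  have "ell2_inner \<xi> \<xi> = (\<Sum>\<^sub>\<infinity>p. of_real ((cmod (\<xi> p))\<^sup>2))"
    unfolding ell2_inner_def by (rule infsum_cong) (simp only: complex_norm_square mult.commute)
  also have "\<dots> = of_real (\<Sum>\<^sub>\<infinity>p. (cmod (\<xi> p))\<^sup>2)"
    using assms by (intro infsumI has_sum_of_real_iff[THEN iffD2] has_sum_infsum) (simp add: ell2_def)
  finally show ?thesis by (simp add: ell2_norm_def infsum_nonneg)
qed

definition delta :: "'g \<Rightarrow> 'g \<Rightarrow> complex" where
  "delta p = (\<lambda>q. if q = p then 1 else 0)"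

lemma inner_delta: "ell2_inner (delta p) \<eta> = \<eta> p"
proof -
  have "ell2_inner (delta p) \<eta> = (\<Sum>\<^sub>\<infinity>q\<in>{p}. cnj (delta p q) * \<eta> q)"
    unfolding ell2_inner_def by (rule infsum_cong_neutral) (auto simp: delta_def)
  then show ?thesis by (simp add: delta_def)
qed

lemma finite_support_ell2:
  assumes "finite F" "F \<subseteq> A" "\<And>p. p \<notin> F \<Longrightarrow> \<xi> p = 0"
  shows "\<xi> \<in> ell2 A" "ell2_norm \<xi> = L2_on \<xi> F"
proof -
  have "(\<lambda>p. (cmod (\<xi> p))\<^sup>2) summable_on UNIV \<longleftrightarrow> (\<lambda>p. (cmod (\<xi> p))\<^sup>2) summable_on F"
    by (rule summable_on_cong_neutral) (use assms in auto)
  then show "\<xi> \<in> ell2 A" using assms by (auto simp: ell2_def)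
  have "(\<Sum>\<^sub>\<infinity>p. (cmod (\<xi> p))\<^sup>2) = (\<Sum>\<^sub>\<infinity>p\<in>F. (cmod (\<xi> p))\<^sup>2)"
    by (rule infsum_cong_neutral) (use assms in auto)
  then show "ell2_norm \<xi> = L2_on \<xi> F" using assms by (simp add: ell2_norm_def L2_set_def)
qed

lemma delta_ell2: "p \<in> A \<Longrightarrow> delta p \<in> ell2 A" "ell2_norm (delta p) = 1"
  using finite_support_ell2[of "{p}" A "delta p"] finite_support_ell2[of "{p}" "{p}" "delta p"]
  by (auto simp: delta_def)

section \<open>Bounded operators and operator norms\<close>

lemma bounded_ops_ell2 [intro]: "T \<in> bounded_ops A \<Longrightarrow> \<xi> \<in> ell2 A \<Longrightarrow> T \<xi> \<in> ell2 A"
  by (auto simp: bounded_ops_def)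

lemma bounded_ops_add:
  "T \<in> bounded_ops A \<Longrightarrow> \<xi> \<in> ell2 A \<Longrightarrow> \<eta> \<in> ell2 A \<Longrightarrow> T (\<lambda>p. \<xi> p + \<eta> p) = (\<lambda>p. T \<xi> p + T \<eta> p)"
  by (auto simp: bounded_ops_def)

lemma bounded_ops_scale:
  "T \<in> bounded_ops A \<Longrightarrow> \<xi> \<in> ell2 A \<Longrightarrow> T (\<lambda>p. c * \<xi> p) = (\<lambda>p. c * T \<xi> p)"
  by (auto simp: bounded_ops_def)

lemma bounded_ops_zero: "T \<in> bounded_ops A \<Longrightarrow> T (\<lambda>p. 0) = (\<lambda>p. 0)"
  using bounded_ops_scale[of T A "\<lambda>p. 0" 0] by simp

lemma bounded_ops_eqI:
  assumes "S \<in> bounded_ops A" "T \<in> bounded_ops A" "\<And>\<xi>. \<xi> \<in> ell2 A \<Longrightarrow> S \<xi> = T \<xi>"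
  shows "S = T"
  using assms by (intro extensionalityI[of S "ell2 A" T]) (auto simp: bounded_ops_def PiE_def)

lemma bounded_opsI:
  assumes "\<And>\<xi>. \<xi> \<in> ell2 A \<Longrightarrow> T \<xi> \<in> ell2 A"
    and "\<And>\<xi> \<eta>. \<xi> \<in> ell2 A \<Longrightarrow> \<eta> \<in> ell2 A \<Longrightarrow> T (\<lambda>p. \<xi> p + \<eta> p) = (\<lambda>p. T \<xi> p + T \<eta> p)"
    and "\<And>c \<xi>. \<xi> \<in> ell2 A \<Longrightarrow> T (\<lambda>p. c * \<xi> p) = (\<lambda>p. c * T \<xi> p)"
    and "\<And>\<xi>. \<xi> \<in> ell2 A \<Longrightarrow> ell2_norm (T \<xi>) \<le> M * ell2_norm \<xi>"
  shows "restrict T (ell2 A) \<in> bounded_ops A"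
  using assms by (auto simp: bounded_ops_def ell2_add ell2_scale intro!: exI[of _ M])

lemma op_norm_bdd:
  assumes T: "T \<in> bounded_ops A" and "B \<subseteq> A"
  shows "bdd_above ((\<lambda>\<xi>. ell2_norm (T \<xi>)) ` {\<xi> \<in> ell2 B. ell2_norm \<xi> \<le> 1})"
proof -
  obtain M where M: "\<forall>\<xi>\<in>ell2 A. ell2_norm (T \<xi>) \<le> M * ell2_norm \<xi>"
    using T by (auto simp: bounded_ops_def)
  have "ell2_norm (T \<xi>) \<le> \<bar>M\<bar>" if "\<xi> \<in> ell2 B" "ell2_norm \<xi> \<le> 1" for \<xi>
  proof -
    have "ell2_norm (T \<xi>) \<le> M * ell2_norm \<xi>" using M that ell2_mono \<open>B \<subseteq> A\<close> by blast
    also have "\<dots> \<le> \<bar>M\<bar> * 1" using that by (intro mult_mono) auto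
    finally show ?thesis by simp
  qed
  then show ?thesis by (auto intro!: bdd_aboveI2)
qed

lemma ell2_norm_le_op_norm:
  assumes "T \<in> bounded_ops A" "B \<subseteq> A" "\<xi> \<in> ell2 B"
  shows "ell2_norm (T \<xi>) \<le> op_norm_on B T * ell2_norm \<xi>"
proof (cases "ell2_norm \<xi> = 0")
  case True
  then have "\<xi> = (\<lambda>p. 0)" using ell2_norm_eq_0[OF assms(3)] by auto
  then show ?thesis using bounded_ops_zero[OF assms(1)] by simp
next
  case False
  define n where "n = ell2_norm \<xi>"
  have n: "n > 0" using False by (simp add: n_def less_le)
  define \<eta> where "\<eta> = (\<lambda>p. of_real (inverse n) * \<xi> p)"
  have \<eta>: "\<eta> \<in> ell2 B" "ell2_norm \<eta> = 1"
    using assms(3) n unfolding \<eta>_def by (simp_all add: ell2_scale ell2_norm_scale n_def[symmetric] norm_inverse)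
  have "ell2_norm (T \<eta>) = inverse n * ell2_norm (T \<xi>)"
    unfolding \<eta>_def using assms n ell2_mono[OF assms(3,2)] bounded_ops_ell2[OF assms(1)]
    by (simp add: bounded_ops_scale ell2_norm_scale[of _ A] norm_inverse)
  moreover have "ell2_norm (T \<eta>) \<le> op_norm_on B T"
    unfolding op_norm_on_def using \<eta> by (intro cSUP_upper op_norm_bdd[OF assms(1,2)]) auto
  ultimately have "inverse n * ell2_norm (T \<xi>) \<le> op_norm_on B T" by simp
  then show ?thesis using n by (simp add: n_def[symmetric] divide_simps mult.commute)
qed

lemma op_norm_leI:
  assumes "0 \<le> M" "\<And>\<xi>. \<xi> \<in> ell2 B \<Longrightarrow> ell2_norm (T \<xi>) \<le> M * ell2_norm \<xi>"
  shows "op_norm_on B T \<le> M"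
  unfolding op_norm_on_def
proof (rule cSUP_least)
  show "{\<xi> \<in> ell2 B. ell2_norm \<xi> \<le> 1} \<noteq> {}" by (auto intro!: exI[of _ "\<lambda>p. 0"])
  fix \<xi> assume "\<xi> \<in> {\<xi> \<in> ell2 B. ell2_norm \<xi> \<le> 1}"
  then show "ell2_norm (T \<xi>) \<le> M"
    using assms(2)[of \<xi>] mult_left_mono[of "ell2_norm \<xi>" 1 M] \<open>0 \<le> M\<close> by auto
qed

lemma op_norm_nonneg:
  assumes "T \<in> bounded_ops A" "B \<subseteq> A"
  shows "0 \<le> op_norm_on B T"
proof -
  have "ell2_norm (T (\<lambda>p. 0)) \<le> op_norm_on B T"
    unfolding op_norm_on_def by (intro cSUP_upper op_norm_bdd[OF assms]) auto
  then show ?thesis using bounded_ops_zero[OF assms(1)] by simp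
qed

section \<open>Adjoints\<close>

lemma delta_expansion:
  assumes "T \<in> bounded_ops A" "finite F" "F \<subseteq> A" "\<eta> \<in> ell2 A"
  shows "ell2_inner (T (\<lambda>p. if p \<in> F then c p else 0)) \<eta> = (\<Sum>p\<in>F. cnj (c p) * ell2_inner (T (delta p)) \<eta>)"
  using assms(2,3)
proof (induction F)
  case empty
  show ?case using bounded_ops_zero[OF assms(1)] by (simp add: ell2_inner_def)
next
  case (insert q F)
  let ?\<xi> = "\<lambda>p. if p \<in> F then c p else 0"
  have \<xi>: "?\<xi> \<in> ell2 A" "delta q \<in> ell2 A"
    using insert by (auto intro!: finite_support_ell2[of F] delta_ell2)
  have "(\<lambda>p. if p \<in> insert q F then c p else 0) = (\<lambda>p. c q * delta q p + ?\<xi> p)"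
    using insert by (auto simp: delta_def)
  then have "T (\<lambda>p. if p \<in> insert q F then c p else 0) = (\<lambda>p. c q * T (delta q) p + T ?\<xi> p)"
    using bounded_ops_add[OF assms(1) ell2_scale[OF \<xi>(2), of "c q"] \<xi>(1)]
      bounded_ops_scale[OF assms(1) \<xi>(2)] by simp
  then show ?case
    using insert inner_add_left[OF assms(4) ell2_scale[OF bounded_ops_ell2[OF assms(1) \<xi>(2)], of "c q"]
        bounded_ops_ell2[OF assms(1) \<xi>(1)]]
    by (simp add: inner_scale_left)
qed

text \<open>The coordinates of an adjoint are forced by testing against \<open>delta p\<close>,
  which defines S. That \<open>S \<eta>\<close> is square-summable comes from applying T to its
  finite truncations; the adjoint identity is exact for finitely supported vectors and extends by
  approximation.\<close>

lemma adjoint_exists: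
  assumes T: "T \<in> bounded_ops A"
  shows "\<exists>S\<in>bounded_ops A. \<forall>\<xi>\<in>ell2 A. \<forall>\<eta>\<in>ell2 A. ell2_inner (T \<xi>) \<eta> = ell2_inner \<xi> (S \<eta>)"
proof -
  let ?M = "op_norm_on A T"
  have M: "0 \<le> ?M" "\<And>\<xi>. \<xi> \<in> ell2 A \<Longrightarrow> ell2_norm (T \<xi>) \<le> ?M * ell2_norm \<xi>"
    using op_norm_nonneg[OF T] ell2_norm_le_op_norm[OF T] by auto
  define S where "S \<eta> = (\<lambda>p. if p \<in> A then ell2_inner (T (delta p)) \<eta> else 0)" for \<eta>
  have le: "L2_on (S \<eta>) F \<le> ?M * ell2_norm \<eta>" if \<eta>: "\<eta> \<in> ell2 A" and "finite F" for \<eta> F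
  proof -
    let ?F = "F \<inter> A" and ?\<xi> = "\<lambda>p. if p \<in> F \<inter> A then S \<eta> p else 0"
    have F: "finite ?F" using that by simp
    have \<xi>: "?\<xi> \<in> ell2 A" "ell2_norm ?\<xi> = L2_on ?\<xi> ?F"
      by (rule finite_support_ell2(1)[OF F], auto) (rule finite_support_ell2(2)[OF F, of A], auto)
    have n: "L2_on ?\<xi> ?F = L2_on (S \<eta>) F"
    proof -
      have "(\<Sum>p\<in>?F. (cmod (?\<xi> p))\<^sup>2) = (\<Sum>p\<in>F. (cmod (S \<eta> p))\<^sup>2)"
        using \<open>finite F\<close> by (intro sum.mono_neutral_cong_left) (auto simp: S_def)
      then show ?thesis by (simp add: L2_set_def)
    qed
    \<comment> \<open>With the truncation of \<open>S \<eta>\<close> itself as test vector the inner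
      product is its squared norm; cancelling one factor gives the bound.\<close>
    have "ell2_inner (T ?\<xi>) \<eta> = (\<Sum>p\<in>?F. cnj (S \<eta> p) * S \<eta> p)"
      using delta_expansion[OF T F _ \<eta>, of "S \<eta>"] by (simp add: S_def)
    also have "\<dots> = of_real (\<Sum>p\<in>?F. (cmod (S \<eta> p))\<^sup>2)"
      unfolding of_real_sum by (rule sum.cong) (auto simp only: complex_norm_square mult.commute)
    also have "(\<Sum>p\<in>?F. (cmod (S \<eta> p))\<^sup>2) = (L2_on ?\<xi> ?F)\<^sup>2"
      by (simp add: L2_set_def sum_nonneg)
    finally have "cmod (ell2_inner (T ?\<xi>) \<eta>) = (L2_on ?\<xi> ?F)\<^sup>2"
      by (simp only: norm_of_real abs_power2)
    then have "(ell2_norm ?\<xi>)\<^sup>2 = cmod (ell2_inner (T ?\<xi>) \<eta>)"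
      by (simp only: \<xi>(2))
    also have "\<dots> \<le> ell2_norm (T ?\<xi>) * ell2_norm \<eta>"
      using inner_summable(2) T \<xi> \<eta> by blast
    also have "\<dots> \<le> (?M * ell2_norm ?\<xi>) * ell2_norm \<eta>"
      using M(2)[OF \<xi>(1)] by (simp add: mult_right_mono)
    finally have "ell2_norm ?\<xi> * ell2_norm ?\<xi> \<le> ell2_norm ?\<xi> * (?M * ell2_norm \<eta>)"
      by (simp add: power2_eq_square algebra_simps)
    then have "ell2_norm ?\<xi> \<le> ?M * ell2_norm \<eta>"
      using M by (cases "ell2_norm ?\<xi> = 0") (auto simp: mult_le_cancel_left less_le)
    then show ?thesis by (simp only: \<xi>(2) n)
  qed
  have S0: "S \<eta> p = 0" if "p \<notin> A" for \<eta> p using that by (simp add: S_def)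
  have S: "S \<eta> \<in> ell2 A" "ell2_norm (S \<eta>) \<le> ?M * ell2_norm \<eta>" if "\<eta> \<in> ell2 A" for \<eta>
    using ell2I[of A "S \<eta>", OF S0 le[OF that]] ell2_norm_leI[of A "S \<eta>", OF S0 le[OF that]] by auto
  have Td: "T (delta p) \<in> ell2 A" if "p \<in> A" for p
    using T delta_ell2(1)[OF that] by blast
  have "restrict S (ell2 A) \<in> bounded_ops A"
  proof (rule bounded_opsI)
    fix \<xi> \<eta> assume "\<xi> \<in> ell2 A" "\<eta> \<in> ell2 A"
    then show "S (\<lambda>p. \<xi> p + \<eta> p) = (\<lambda>p. S \<xi> p + S \<eta> p)"
      using Td by (auto simp: S_def fun_eq_iff inner_add_right[of _ A])
  qed (use S in \<open>auto simp: S_def inner_scale_right\<close>)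
  moreover have "ell2_inner (T \<xi>) \<eta> = ell2_inner \<xi> (S \<eta>)" if \<xi>: "\<xi> \<in> ell2 A" and \<eta>: "\<eta> \<in> ell2 A" for \<xi> \<eta>
  proof (rule ccontr)
    \<comment> \<open>The tail of \<xi> enters twice, through T and through S, each time with factor
      \<open>?M * ell2_norm \<eta>\<close>. A tail of norm at most d/(2K) thus contributes less than
      d; the summand 1 makes this strict and K positive.\<close>
    let ?K = "?M * ell2_norm \<eta> + 1"
    define d where "d = cmod (ell2_inner (T \<xi>) \<eta> - ell2_inner \<xi> (S \<eta>))"
    assume "ell2_inner (T \<xi>) \<eta> \<noteq> ell2_inner \<xi> (S \<eta>)"
    then have "d > 0" by (simp add: d_def)
    have K: "?K > 0" using M by (simp add: add_nonneg_pos)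
    have pos: "(d / (2 * ?K))\<^sup>2 / 2 > 0" using \<open>d > 0\<close> K by simp
    have s: "(\<lambda>p. (cmod (\<xi> p))\<^sup>2) summable_on UNIV" using \<xi> by (simp add: ell2_def)
    obtain F0 where F0: "finite F0" "dist (sum (\<lambda>p. (cmod (\<xi> p))\<^sup>2) F0) (\<Sum>\<^sub>\<infinity>p. (cmod (\<xi> p))\<^sup>2) \<le> (d / (2 * ?K))\<^sup>2 / 2"
      using infsum_finite_approximation[OF s pos] by auto
    let ?F = "F0 \<inter> A"
    let ?\<xi> = "\<lambda>p. if p \<in> ?F then \<xi> p else 0"
    let ?\<rho> = "\<lambda>p. if p \<in> ?F then 0 else \<xi> p"
    have F: "finite ?F" using F0 by simp
    have r: "?\<rho> \<in> ell2 A" "?\<xi> \<in> ell2 A"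
      using ell2_mult[OF \<xi>, of "\<lambda>p. if p \<in> ?F then 0 else 1" 1] ell2_mult[OF \<xi>, of "\<lambda>p. if p \<in> ?F then 1 else 0" 1]
      by (auto simp: if_distrib[of "\<lambda>x. x * _"] cong: if_cong)
    have eq: "\<xi> = (\<lambda>p. ?\<xi> p + ?\<rho> p)" by auto
    have "ell2_norm ?\<rho> \<le> d / (2 * ?K)"
    proof -
      have "(\<Sum>\<^sub>\<infinity>p. (cmod (\<xi> p))\<^sup>2) = (\<Sum>\<^sub>\<infinity>p. (cmod (?\<xi> p))\<^sup>2 + (cmod (?\<rho> p))\<^sup>2)"
        by (rule infsum_cong) auto
      also have "\<dots> = (\<Sum>\<^sub>\<infinity>p. (cmod (?\<xi> p))\<^sup>2) + (\<Sum>\<^sub>\<infinity>p. (cmod (?\<rho> p))\<^sup>2)"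
        using r by (intro infsum_add) (simp_all add: ell2_def)
      also have "(\<Sum>\<^sub>\<infinity>p. (cmod (?\<xi> p))\<^sup>2) = (\<Sum>\<^sub>\<infinity>p\<in>F0. (cmod (\<xi> p))\<^sup>2)"
        using ell2D[OF \<xi>] by (intro infsum_cong_neutral) auto
      finally have "(\<Sum>\<^sub>\<infinity>p. (cmod (?\<rho> p))\<^sup>2) \<le> (d / (2 * ?K))\<^sup>2 / 2"
        using F0 by (simp add: dist_real_def)
      then have "(\<Sum>\<^sub>\<infinity>p. (cmod (?\<rho> p))\<^sup>2) \<le> (d / (2 * ?K))\<^sup>2"
        using zero_le_power2[of "d / (2 * ?K)"] by linarith
      then have "ell2_norm ?\<rho> \<le> sqrt ((d / (2 * ?K))\<^sup>2)"
        unfolding ell2_norm_def[of ?\<rho>] by (rule real_sqrt_le_mono)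
      also have "\<dots> = d / (2 * ?K)" using \<open>d > 0\<close> K by simp
      finally show ?thesis .
    qed
    then have "2 * (ell2_norm ?\<rho> * (?M * ell2_norm \<eta>)) \<le> 2 * (d / (2 * ?K) * (?M * ell2_norm \<eta>))"
      using M by (intro mult_left_mono mult_right_mono) auto
    also have "\<dots> < d" using \<open>d > 0\<close> K by (simp add: field_simps)
    finally have small: "2 * (ell2_norm ?\<rho> * (?M * ell2_norm \<eta>)) < d" .
    have "ell2_inner (T ?\<xi>) \<eta> = ell2_inner ?\<xi> (S \<eta>)"
    proof -
      have "ell2_inner ?\<xi> (S \<eta>) = (\<Sum>\<^sub>\<infinity>p\<in>?F. cnj (\<xi> p) * S \<eta> p)"
        unfolding ell2_inner_def by (rule infsum_cong_neutral) auto
      then show ?thesis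
        using delta_expansion[OF T F _ \<eta>, of \<xi>] F by (simp add: S_def)
    qed
    moreover have "ell2_inner (T \<xi>) \<eta> = ell2_inner (T ?\<xi>) \<eta> + ell2_inner (T ?\<rho>) \<eta>"
      using inner_add_left[OF \<eta> bounded_ops_ell2[OF T r(2)] bounded_ops_ell2[OF T r(1)]]
      unfolding bounded_ops_add[OF T r(2,1), symmetric] eq[symmetric] .
    moreover have "ell2_inner \<xi> (S \<eta>) = ell2_inner ?\<xi> (S \<eta>) + ell2_inner ?\<rho> (S \<eta>)"
      using inner_add_left[OF S(1)[OF \<eta>] r(2,1)] unfolding eq[symmetric] .
    ultimately have "ell2_inner (T \<xi>) \<eta> - ell2_inner \<xi> (S \<eta>) = ell2_inner (T ?\<rho>) \<eta> - ell2_inner ?\<rho> (S \<eta>)"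
      by (simp only: add_diff_add diff_self add_0)
    moreover have "cmod (ell2_inner (T ?\<rho>) \<eta>) \<le> ?M * ell2_norm ?\<rho> * ell2_norm \<eta>"
      using inner_summable(2)[OF bounded_ops_ell2[OF T r(1)] \<eta>] M(2)[OF r(1)]
      by (meson ell2_norm_nonneg mult_right_mono order_trans)
    moreover have "cmod (ell2_inner ?\<rho> (S \<eta>)) \<le> ell2_norm ?\<rho> * (?M * ell2_norm \<eta>)"
      using inner_summable(2)[OF r(1) S(1)[OF \<eta>]] S(2)[OF \<eta>]
      by (meson ell2_norm_nonneg mult_left_mono order_trans)
    ultimately have "d \<le> 2 * (ell2_norm ?\<rho> * (?M * ell2_norm \<eta>))"
      unfolding d_def using norm_triangle_ineq4[of "ell2_inner (T ?\<rho>) \<eta>" "ell2_inner ?\<rho> (S \<eta>)"]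
      by (simp add: mult_ac)
    then show False using small by simp
  qed
  ultimately show ?thesis
    by (intro bexI[of _ "restrict S (ell2 A)"]) auto
qed


text \<open>The definite description is resolved by pairing with \<open>delta p\<close>, which reads
  off coordinates.\<close>

lemma op_adjoint_unique:
  assumes "T \<in> bounded_ops A" "S \<in> bounded_ops A"
    and S: "\<And>\<xi> \<eta>. \<xi> \<in> ell2 A \<Longrightarrow> \<eta> \<in> ell2 A \<Longrightarrow> ell2_inner (T \<xi>) \<eta> = ell2_inner \<xi> (S \<eta>)"
  shows "op_adjoint A T = S"
  unfolding op_adjoint_def
proof (rule the_equality)
  show "S \<in> bounded_ops A \<and> (\<forall>\<xi>\<in>ell2 A. \<forall>\<eta>\<in>ell2 A. ell2_inner (T \<xi>) \<eta> = ell2_inner \<xi> (S \<eta>))"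
    using assms by blast
  fix S' assume S': "S' \<in> bounded_ops A \<and> (\<forall>\<xi>\<in>ell2 A. \<forall>\<eta>\<in>ell2 A. ell2_inner (T \<xi>) \<eta> = ell2_inner \<xi> (S' \<eta>))"
  show "S' = S"
  proof (rule bounded_ops_eqI)
    fix \<eta> assume \<eta>: "\<eta> \<in> ell2 A"
    show "S' \<eta> = S \<eta>"
    proof
      fix p
      show "S' \<eta> p = S \<eta> p"
      proof (cases "p \<in> A")
        case True
        have "ell2_inner (delta p) (S' \<eta>) = ell2_inner (delta p) (S \<eta>)"
          using S[OF delta_ell2(1)[OF True] \<eta>] S' delta_ell2(1)[OF True] \<eta> by simp
        then show ?thesis by (simp add: inner_delta)
      next
        case False
        then show ?thesis using S' assms \<eta> ell2D by (metis bounded_ops_ell2)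
      qed
    qed
  qed (use S' assms in auto)
qed

lemma
  assumes T: "T \<in> bounded_ops A"
  shows op_adjoint_bounded: "op_adjoint A T \<in> bounded_ops A"
    and op_adjoint_inner:
      "\<xi> \<in> ell2 A \<Longrightarrow> \<eta> \<in> ell2 A \<Longrightarrow> ell2_inner (T \<xi>) \<eta> = ell2_inner \<xi> (op_adjoint A T \<eta>)"
  using adjoint_exists[OF T] op_adjoint_unique[OF T] by force+

lemma op_adjoint_inner_left:
  assumes T: "T \<in> bounded_ops A" "\<xi> \<in> ell2 A" "\<eta> \<in> ell2 A"
  shows "ell2_inner (op_adjoint A T \<xi>) \<eta> = ell2_inner \<xi> (T \<eta>)"
  using op_adjoint_inner[OF T(1,3,2)] inner_commute by metis

lemma B_ell2_simps:
  "carrier (B_ell2 A) = bounded_ops A"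
  "S \<otimes>\<^bsub>B_ell2 A\<^esub> T = (\<lambda>\<xi>\<in>ell2 A. S (T \<xi>))"
  "\<one>\<^bsub>B_ell2 A\<^esub> = (\<lambda>\<xi>\<in>ell2 A. \<xi>)"
  "\<zero>\<^bsub>B_ell2 A\<^esub> = (\<lambda>\<xi>\<in>ell2 A. \<lambda>p. 0)"
  "S \<oplus>\<^bsub>B_ell2 A\<^esub> T = (\<lambda>\<xi>\<in>ell2 A. \<lambda>p. S \<xi> p + T \<xi> p)"
  "c \<odot>\<^bsub>B_ell2 A\<^esub> T = (\<lambda>\<xi>\<in>ell2 A. \<lambda>p. c * T \<xi> p)"
  "adj (B_ell2 A) T = op_adjoint A T"
  "nrm (B_ell2 A) T = op_norm_on A T"
  by (simp_all add: B_ell2_def)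

text \<open>Pairing \<open>T (op_adjoint A T \<xi>)\<close> with \<xi> gives the squared norm of
  \<open>op_adjoint A T \<xi>\<close>, of which one factor cancels.\<close>

lemma op_norm_adjoint_le:
  assumes T: "T \<in> bounded_ops A"
  shows "op_norm_on A (op_adjoint A T) \<le> op_norm_on A T"
proof (rule op_norm_leI)
  fix \<xi> assume \<xi>: "\<xi> \<in> ell2 A"
  let ?n = "ell2_norm (op_adjoint A T \<xi>)"
  have S: "op_adjoint A T \<xi> \<in> ell2 A" using op_adjoint_bounded[OF T] \<xi> by blast
  have "of_real (?n\<^sup>2) = ell2_inner \<xi> (T (op_adjoint A T \<xi>))"
    using inner_self[OF S] op_adjoint_inner_left[OF T \<xi> S] by simp
  then have "?n\<^sup>2 = cmod (ell2_inner \<xi> (T (op_adjoint A T \<xi>)))"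
    by (metis abs_of_nonneg norm_of_real zero_le_power2)
  also have "\<dots> \<le> ell2_norm \<xi> * ell2_norm (T (op_adjoint A T \<xi>))"
    using inner_summable(2)[OF \<xi>] T S by blast
  also have "\<dots> \<le> ell2_norm \<xi> * (op_norm_on A T * ?n)"
    using ell2_norm_le_op_norm[OF T _ S] by (simp add: mult_left_mono)
  finally have "?n * ?n \<le> ?n * (op_norm_on A T * ell2_norm \<xi>)"
    by (simp add: power2_eq_square algebra_simps)
  then show "?n \<le> op_norm_on A T * ell2_norm \<xi>"
    using op_norm_nonneg[OF T] ell2_norm_nonneg[of "op_adjoint A T \<xi>"]
    by (cases "?n = 0") (auto simp: mult_le_cancel_left)
qed (rule op_norm_nonneg[OF T order.refl])

lemma cstar_algebra_B_ell2: "cstar_algebra (B_ell2 A)"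
proof -
  let ?B = "B_ell2 A"
  note S = B_ell2_simps
  have c_mult: "S \<otimes>\<^bsub>?B\<^esub> T \<in> bounded_ops A" and n_mult: "op_norm_on A (S \<otimes>\<^bsub>?B\<^esub> T) \<le> op_norm_on A S * op_norm_on A T"
    if T: "S \<in> bounded_ops A" "T \<in> bounded_ops A" for S T
  proof -
    have le: "ell2_norm (S (T \<xi>)) \<le> op_norm_on A S * op_norm_on A T * ell2_norm \<xi>" if "\<xi> \<in> ell2 A" for \<xi>
    proof -
      have "ell2_norm (S (T \<xi>)) \<le> op_norm_on A S * ell2_norm (T \<xi>)"
        using T that by (intro ell2_norm_le_op_norm[of S A]) auto
      also have "\<dots> \<le> op_norm_on A S * (op_norm_on A T * ell2_norm \<xi>)"
        using T that by (intro mult_left_mono ell2_norm_le_op_norm[of T A] op_norm_nonneg[of S A]) auto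
      finally show ?thesis by simp
    qed
    show "S \<otimes>\<^bsub>?B\<^esub> T \<in> bounded_ops A"
      unfolding B_ell2_simps using T le
      by (intro bounded_opsI) (auto simp: bounded_ops_add[of _ A] bounded_ops_scale[of _ A] bounded_ops_ell2)
    show "op_norm_on A (S \<otimes>\<^bsub>?B\<^esub> T) \<le> op_norm_on A S * op_norm_on A T"
      unfolding B_ell2_simps using T le by (intro op_norm_leI) (auto simp: op_norm_nonneg)
  qed
  have c_add: "S \<oplus>\<^bsub>?B\<^esub> T \<in> bounded_ops A" and n_add: "op_norm_on A (S \<oplus>\<^bsub>?B\<^esub> T) \<le> op_norm_on A S + op_norm_on A T"
    if T: "S \<in> bounded_ops A" "T \<in> bounded_ops A" for S T
  proof -
    have le: "ell2_norm (\<lambda>p. S \<xi> p + T \<xi> p) \<le> (op_norm_on A S + op_norm_on A T) * ell2_norm \<xi>" if "\<xi> \<in> ell2 A" for \<xi>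
    proof -
      have "ell2_norm (\<lambda>p. S \<xi> p + T \<xi> p) \<le> ell2_norm (S \<xi>) + ell2_norm (T \<xi>)"
        using T that by (intro ell2_norm_add) auto
      also have "\<dots> \<le> op_norm_on A S * ell2_norm \<xi> + op_norm_on A T * ell2_norm \<xi>"
        using T that by (intro add_mono ell2_norm_le_op_norm[of _ A]) auto
      finally show ?thesis by (simp add: algebra_simps)
    qed
    show "S \<oplus>\<^bsub>?B\<^esub> T \<in> bounded_ops A"
      unfolding B_ell2_simps using T le
      by (intro bounded_opsI[where M = "op_norm_on A S + op_norm_on A T"])
        (auto simp: bounded_ops_add[of _ A] bounded_ops_scale[of _ A] bounded_ops_ell2 ell2_add algebra_simps)
    show "op_norm_on A (S \<oplus>\<^bsub>?B\<^esub> T) \<le> op_norm_on A S + op_norm_on A T"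
      unfolding B_ell2_simps using T le by (intro op_norm_leI) (auto simp: op_norm_nonneg)
  qed
  have c_smult: "c \<odot>\<^bsub>?B\<^esub> T \<in> bounded_ops A" and n_smult: "op_norm_on A (c \<odot>\<^bsub>?B\<^esub> T) = cmod c * op_norm_on A T"
    if T: "T \<in> bounded_ops A" for c T
  proof -
    have nn: "ell2_norm (\<lambda>p. c * T \<xi> p) = cmod c * ell2_norm (T \<xi>)" if "\<xi> \<in> ell2 A" for \<xi>
      using T that by (intro ell2_norm_scale) auto
    then have le: "ell2_norm (\<lambda>p. c * T \<xi> p) \<le> cmod c * op_norm_on A T * ell2_norm \<xi>" if "\<xi> \<in> ell2 A" for \<xi>
      using ell2_norm_le_op_norm[OF T order.refl that] that by (simp add: mult_left_mono mult.assoc)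
    show 1: "c \<odot>\<^bsub>?B\<^esub> T \<in> bounded_ops A"
      unfolding B_ell2_simps using T le
      by (intro bounded_opsI[where M = "cmod c * op_norm_on A T"])
        (auto simp: bounded_ops_add[of _ A] bounded_ops_scale[of _ A] bounded_ops_ell2 ell2_scale algebra_simps)
    show "op_norm_on A (c \<odot>\<^bsub>?B\<^esub> T) = cmod c * op_norm_on A T"
    proof (rule antisym)
      show "op_norm_on A (c \<odot>\<^bsub>?B\<^esub> T) \<le> cmod c * op_norm_on A T"
        unfolding B_ell2_simps using T le by (intro op_norm_leI) (auto simp: op_norm_nonneg)
      show "cmod c * op_norm_on A T \<le> op_norm_on A (c \<odot>\<^bsub>?B\<^esub> T)"
      proof (cases "c = 0")
        case True
        then show ?thesis using op_norm_nonneg[OF 1] by simp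
      next
        case False
        have "op_norm_on A T \<le> op_norm_on A (c \<odot>\<^bsub>?B\<^esub> T) / cmod c"
        proof (rule op_norm_leI)
          fix \<xi> assume \<xi>: "\<xi> \<in> ell2 A"
          show "ell2_norm (T \<xi>) \<le> op_norm_on A (c \<odot>\<^bsub>?B\<^esub> T) / cmod c * ell2_norm \<xi>"
            using ell2_norm_le_op_norm[OF 1 order.refl \<xi>] \<xi> nn[OF \<xi>] False by (simp add: S field_simps)
        qed (use op_norm_nonneg[OF 1] in simp)
        then show ?thesis using False by (simp add: field_simps)
      qed
    qed
  qed
  have c_one: "\<one>\<^bsub>?B\<^esub> \<in> bounded_ops A"
    unfolding S by (rule bounded_opsI[of A "\<lambda>x. x" 1]) auto
  have c_zero: "\<zero>\<^bsub>?B\<^esub> \<in> bounded_ops A"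
    unfolding S by (rule bounded_opsI[of A _ 0]) auto
  note cl = c_mult c_add c_smult c_one c_zero
  have lin: "T (\<lambda>p. \<xi> p + \<eta> p) = (\<lambda>p. T \<xi> p + T \<eta> p)" "T (\<lambda>p. c * \<xi> p) = (\<lambda>p. c * T \<xi> p)"
    if "T \<in> bounded_ops A" "\<xi> \<in> ell2 A" "\<eta> \<in> ell2 A" for T \<xi> \<eta> c
    using that bounded_ops_add bounded_ops_scale by blast+
  have neg: "(-1) \<odot>\<^bsub>?B\<^esub> T \<oplus>\<^bsub>?B\<^esub> T = \<zero>\<^bsub>?B\<^esub>" if "T \<in> bounded_ops A" for T
    using that by (intro bounded_ops_eqI[of _ A] cl) (auto simp: S)
  have ring: "ring ?B"
  proof (rule ringI)
    show "abelian_group ?B"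
    proof (rule abelian_groupI)
      fix T assume T: "T \<in> carrier ?B"
      then show "\<exists>U\<in>carrier ?B. U \<oplus>\<^bsub>?B\<^esub> T = \<zero>\<^bsub>?B\<^esub>"
        by (intro bexI[of _ "(-1) \<odot>\<^bsub>?B\<^esub> T"]) (auto simp: S(1) neg intro: cl)
      show "\<zero>\<^bsub>?B\<^esub> \<oplus>\<^bsub>?B\<^esub> T = T"
        using T by (intro bounded_ops_eqI[of _ A] cl) (auto simp: S)
    qed (auto simp: S(1) intro!: cl, auto simp: S algebra_simps intro!: restrict_ext)
    show "monoid ?B"
    proof (rule monoidI)
      fix T assume T: "T \<in> carrier ?B"
      then show "\<one>\<^bsub>?B\<^esub> \<otimes>\<^bsub>?B\<^esub> T = T" "T \<otimes>\<^bsub>?B\<^esub> \<one>\<^bsub>?B\<^esub> = T"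
        using T by (intro bounded_ops_eqI[of _ A] cl; auto simp: S)+
    qed (auto simp: S(1) intro!: cl, auto simp: S intro!: restrict_ext)
    fix T U V assume "T \<in> carrier ?B" "U \<in> carrier ?B" "V \<in> carrier ?B"
    then have *: "T \<in> bounded_ops A" "U \<in> bounded_ops A" "V \<in> bounded_ops A" by (simp_all add: S)
    show "(T \<oplus>\<^bsub>?B\<^esub> U) \<otimes>\<^bsub>?B\<^esub> V = T \<otimes>\<^bsub>?B\<^esub> V \<oplus>\<^bsub>?B\<^esub> U \<otimes>\<^bsub>?B\<^esub> V"
      using * by (intro bounded_ops_eqI[of _ A] cl) (auto simp: S)
    show "V \<otimes>\<^bsub>?B\<^esub> (T \<oplus>\<^bsub>?B\<^esub> U) = V \<otimes>\<^bsub>?B\<^esub> T \<oplus>\<^bsub>?B\<^esub> V \<otimes>\<^bsub>?B\<^esub> U"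
      using * by (intro bounded_ops_eqI[of _ A] cl) (auto simp: S lin bounded_ops_ell2)
  qed
  interpret R: ring ?B by (fact ring)
  have "\<ominus>\<^bsub>?B\<^esub> T = (-1) \<odot>\<^bsub>?B\<^esub> T" if "T \<in> bounded_ops A" for T
    by (rule R.minus_equality) (use that in \<open>simp_all add: S(1) neg cl\<close>)
  then have diff: "(T \<ominus>\<^bsub>?B\<^esub> U) \<xi> = (\<lambda>p. T \<xi> p - U \<xi> p)" if "T \<in> bounded_ops A" "U \<in> bounded_ops A" "\<xi> \<in> ell2 A" for T U \<xi>
    using that by (simp add: R.minus_eq S)
  have c_diff: "T \<ominus>\<^bsub>?B\<^esub> U \<in> bounded_ops A" if "T \<in> bounded_ops A" "U \<in> bounded_ops A" for T U
    using R.minus_closed[of T U] that by (simp add: S(1))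
  show ?thesis
  proof (intro cstar_algebra.intro ring cstar_algebra_axioms.intro)
    fix T assume "T \<in> carrier ?B"
    then have T: "T \<in> bounded_ops A" by (simp add: S)
    note T' = op_adjoint_bounded[OF T]
    show "adj ?B T \<in> carrier ?B" using T' by (simp add: S)
    show "adj ?B (adj ?B T) = T"
      unfolding S by (rule op_adjoint_unique) (use T T' op_adjoint_inner_left in auto)
    show "0 \<le> nrm ?B T" using op_norm_nonneg[OF T] by (simp add: S)
    show "nrm ?B T = 0 \<longleftrightarrow> T = \<zero>\<^bsub>?B\<^esub>"
    proof
      assume 0: "nrm ?B T = 0"
      show "T = \<zero>\<^bsub>?B\<^esub>"
      proof (rule bounded_ops_eqI[OF T c_zero])
        fix \<xi> assume \<xi>: "\<xi> \<in> ell2 A"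
        then have "ell2_norm (T \<xi>) = 0"
          using ell2_norm_le_op_norm[OF T order.refl \<xi>] 0 by (simp add: S antisym)
        then show "T \<xi> = \<zero>\<^bsub>?B\<^esub> \<xi>" using ell2_norm_eq_0[OF bounded_ops_ell2[OF T \<xi>]] \<xi> by (auto simp: S)
      qed
    next
      assume "T = \<zero>\<^bsub>?B\<^esub>"
      then have "op_norm_on A T \<le> 0" by (intro op_norm_leI) (auto simp: S)
      then show "nrm ?B T = 0" using op_norm_nonneg[OF T order.refl] by (simp add: S)
    qed
    show "nrm ?B (adj ?B T \<otimes>\<^bsub>?B\<^esub> T) = (nrm ?B T)\<^sup>2"
    proof (rule antisym)
      have "nrm ?B (adj ?B T \<otimes>\<^bsub>?B\<^esub> T) \<le> op_norm_on A (op_adjoint A T) * op_norm_on A T"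
        using n_mult[OF T' T] by (simp add: S)
      also have "\<dots> \<le> (op_norm_on A T)\<^sup>2"
        using op_norm_adjoint_le[OF T] op_norm_nonneg[OF T] by (simp add: power2_eq_square mult_right_mono)
      finally show "nrm ?B (adj ?B T \<otimes>\<^bsub>?B\<^esub> T) \<le> (nrm ?B T)\<^sup>2" by (simp add: S)
      let ?N = "op_norm_on A (op_adjoint A T \<otimes>\<^bsub>?B\<^esub> T)"
      have N: "0 \<le> ?N" using op_norm_nonneg[OF c_mult[OF T' T]] by simp
      have "op_norm_on A T \<le> sqrt ?N"
      proof (rule op_norm_leI)
        fix \<xi> assume \<xi>: "\<xi> \<in> ell2 A"
        have T\<xi>: "T \<xi> \<in> ell2 A" using T \<xi> by blast
        have "of_real ((ell2_norm (T \<xi>))\<^sup>2) = ell2_inner \<xi> ((op_adjoint A T \<otimes>\<^bsub>?B\<^esub> T) \<xi>)"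
          using inner_self[OF T\<xi>] op_adjoint_inner[OF T \<xi> T\<xi>] \<xi> by (simp add: S)
        then have "(ell2_norm (T \<xi>))\<^sup>2 = cmod (ell2_inner \<xi> ((op_adjoint A T \<otimes>\<^bsub>?B\<^esub> T) \<xi>))"
          by (metis abs_of_nonneg norm_of_real zero_le_power2)
        also have "\<dots> \<le> ell2_norm \<xi> * ell2_norm ((op_adjoint A T \<otimes>\<^bsub>?B\<^esub> T) \<xi>)"
          using inner_summable(2)[OF \<xi>] c_mult[OF T' T] \<xi> by blast
        also have "\<dots> \<le> ell2_norm \<xi> * (?N * ell2_norm \<xi>)"
          using ell2_norm_le_op_norm[OF c_mult[OF T' T] order.refl \<xi>] by (simp add: mult_left_mono)
        also have "\<dots> = (sqrt ?N * ell2_norm \<xi>)\<^sup>2"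
          using N by (simp add: power_mult_distrib power2_eq_square)
        finally show "ell2_norm (T \<xi>) \<le> sqrt ?N * ell2_norm \<xi>"
          by (rule power2_le_imp_le) (use N in simp)
      qed (use N in simp)
      then show "(nrm ?B T)\<^sup>2 \<le> nrm ?B (adj ?B T \<otimes>\<^bsub>?B\<^esub> T)"
        using N op_norm_nonneg[OF T] power_mono[of "op_norm_on A T" "sqrt ?N" 2] by (simp add: S(7,8))
    qed
    fix c :: complex
    show "c \<odot>\<^bsub>?B\<^esub> T \<in> carrier ?B" using c_smult[OF T] by (simp add: S(1))
    show "nrm ?B (c \<odot>\<^bsub>?B\<^esub> T) = cmod c * nrm ?B T" using n_smult[OF T] by (simp add: S(8))
    show "adj ?B (c \<odot>\<^bsub>?B\<^esub> T) = cnj c \<odot>\<^bsub>?B\<^esub> adj ?B T"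
      unfolding S(7)
    proof (rule op_adjoint_unique)
      fix \<xi> \<eta> assume *: "\<xi> \<in> ell2 A" "\<eta> \<in> ell2 A"
      then show "ell2_inner ((c \<odot>\<^bsub>?B\<^esub> T) \<xi>) \<eta> = ell2_inner \<xi> ((cnj c \<odot>\<^bsub>?B\<^esub> op_adjoint A T) \<eta>)"
        by (simp add: S inner_scale_left inner_scale_right op_adjoint_inner[OF T])
    qed (use T T' cl in auto)
    show "1 \<odot>\<^bsub>?B\<^esub> T = T" using T by (intro bounded_ops_eqI[of _ A] cl) (auto simp: S)
    fix d
    show "(c + d) \<odot>\<^bsub>?B\<^esub> T = c \<odot>\<^bsub>?B\<^esub> T \<oplus>\<^bsub>?B\<^esub> d \<odot>\<^bsub>?B\<^esub> T"
      using T by (intro bounded_ops_eqI[of _ A] cl) (auto simp: S algebra_simps)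
    show "c \<odot>\<^bsub>?B\<^esub> (d \<odot>\<^bsub>?B\<^esub> T) = (c * d) \<odot>\<^bsub>?B\<^esub> T"
      using T by (intro bounded_ops_eqI[of _ A] cl) (auto simp: S algebra_simps)
    fix U assume "U \<in> carrier ?B"
    then have U: "U \<in> bounded_ops A" by (simp add: S)
    note U' = op_adjoint_bounded[OF U]
    show "c \<odot>\<^bsub>?B\<^esub> (T \<oplus>\<^bsub>?B\<^esub> U) = c \<odot>\<^bsub>?B\<^esub> T \<oplus>\<^bsub>?B\<^esub> c \<odot>\<^bsub>?B\<^esub> U"
      using T U by (intro bounded_ops_eqI[of _ A] cl) (auto simp: S algebra_simps)
    show "c \<odot>\<^bsub>?B\<^esub> T \<otimes>\<^bsub>?B\<^esub> U = c \<odot>\<^bsub>?B\<^esub> (T \<otimes>\<^bsub>?B\<^esub> U)"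
      using T U by (intro bounded_ops_eqI[of _ A] cl) (auto simp: S)
    show "T \<otimes>\<^bsub>?B\<^esub> (c \<odot>\<^bsub>?B\<^esub> U) = c \<odot>\<^bsub>?B\<^esub> (T \<otimes>\<^bsub>?B\<^esub> U)"
      using T U by (intro bounded_ops_eqI[of _ A] cl) (auto simp: S lin bounded_ops_ell2)
    show "adj ?B (T \<oplus>\<^bsub>?B\<^esub> U) = adj ?B T \<oplus>\<^bsub>?B\<^esub> adj ?B U"
      unfolding S(7)
    proof (rule op_adjoint_unique)
      fix \<xi> \<eta> assume *: "\<xi> \<in> ell2 A" "\<eta> \<in> ell2 A"
      then show "ell2_inner ((T \<oplus>\<^bsub>?B\<^esub> U) \<xi>) \<eta> = ell2_inner \<xi> ((op_adjoint A T \<oplus>\<^bsub>?B\<^esub> op_adjoint A U) \<eta>)"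
        using T U T' U' by (simp add: S inner_add_left[of _ A] inner_add_right[of _ A] op_adjoint_inner[of _ A] bounded_ops_ell2)
    qed (use T T' U U' cl in auto)
    show "adj ?B (T \<otimes>\<^bsub>?B\<^esub> U) = adj ?B U \<otimes>\<^bsub>?B\<^esub> adj ?B T"
      unfolding S(7)
    proof (rule op_adjoint_unique)
      fix \<xi> \<eta> assume *: "\<xi> \<in> ell2 A" "\<eta> \<in> ell2 A"
      then show "ell2_inner ((T \<otimes>\<^bsub>?B\<^esub> U) \<xi>) \<eta> = ell2_inner \<xi> ((op_adjoint A U \<otimes>\<^bsub>?B\<^esub> op_adjoint A T) \<eta>)"
        using T U T' U' by (simp add: S op_adjoint_inner[of _ A] bounded_ops_ell2)
    qed (use T T' U U' cl in auto)
    show "nrm ?B (T \<oplus>\<^bsub>?B\<^esub> U) \<le> nrm ?B T + nrm ?B U" "nrm ?B (T \<otimes>\<^bsub>?B\<^esub> U) \<le> nrm ?B T * nrm ?B U"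
      using n_add[OF T U] n_mult[OF T U] by (simp_all add: S(8))
  next
    fix X :: "nat \<Rightarrow> _" assume X: "range X \<subseteq> carrier ?B"
      and C: "\<forall>e>0. \<exists>N. \<forall>m\<ge>N. \<forall>n\<ge>N. nrm ?B (X m \<ominus>\<^bsub>?B\<^esub> X n) < e"
    have XB: "X n \<in> bounded_ops A" for n using X by (auto simp: S)
    have XD: "ell2_norm (\<lambda>p. X m \<xi> p - X n \<xi> p) \<le> nrm ?B (X m \<ominus>\<^bsub>?B\<^esub> X n) * ell2_norm \<xi>" if "\<xi> \<in> ell2 A" for m n \<xi>
      using ell2_norm_le_op_norm[OF c_diff[OF XB[of m] XB[of n]] order.refl that] by (simp add: diff XB that S(8))
    \<comment> \<open>The limit is taken coordinate by coordinate. Its square-summability and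
      boundedness come afterwards from the uniform estimates \<open>unif\<close> and
      \<open>unif2\<close>.\<close>
    define T where "T \<xi> = (\<lambda>p. lim (\<lambda>n. X n \<xi> p))" for \<xi>
    have T: "(\<lambda>n. X n \<xi> p) \<longlonglongrightarrow> T \<xi> p" if \<xi>: "\<xi> \<in> ell2 A" for \<xi> p
    proof -
      have "Cauchy (\<lambda>n. X n \<xi> p)"
      proof (rule metric_CauchyI)
        fix e :: real assume "e > 0"
        then have "e / (ell2_norm \<xi> + 1) > 0" by (simp add: add_nonneg_pos)
        then obtain N where N: "\<forall>m\<ge>N. \<forall>n\<ge>N. nrm ?B (X m \<ominus>\<^bsub>?B\<^esub> X n) < e / (ell2_norm \<xi> + 1)"
          using C by blast
        have "dist (X m \<xi> p) (X n \<xi> p) < e" if "m \<ge> N" "n \<ge> N" for m n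
        proof -
          have "dist (X m \<xi> p) (X n \<xi> p) \<le> ell2_norm (\<lambda>p. X m \<xi> p - X n \<xi> p)"
            unfolding dist_norm using XB \<xi> by (intro cmod_le_ell2_norm[of "\<lambda>p. X m \<xi> p - X n \<xi> p" A] ell2_diff) auto
          also have "\<dots> \<le> nrm ?B (X m \<ominus>\<^bsub>?B\<^esub> X n) * ell2_norm \<xi>" by (rule XD[OF \<xi>])
          also have "\<dots> \<le> e / (ell2_norm \<xi> + 1) * ell2_norm \<xi>"
            using N that by (intro mult_right_mono) (auto intro: less_imp_le)
          also have "\<dots> = e * ell2_norm \<xi> / (ell2_norm \<xi> + 1)" by simp
          also have "\<dots> < e"
            using \<open>e > 0\<close> by (subst pos_divide_less_eq) (simp_all add: add_nonneg_pos algebra_simps add_pos_nonneg)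
          finally show ?thesis .
        qed
        then show "\<exists>N. \<forall>m\<ge>N. \<forall>n\<ge>N. dist (X m \<xi> p) (X n \<xi> p) < e" by blast
      qed
      then show ?thesis unfolding T_def by (simp add: Cauchy_convergent convergent_LIMSEQ_iff[symmetric])
    qed
    have T0: "T \<xi> p = 0" if "\<xi> \<in> ell2 A" "p \<notin> A" for \<xi> p
      using LIMSEQ_unique[OF T[OF that(1), of p], of 0] ell2D[OF bounded_ops_ell2[OF XB that(1)] that(2)] by simp
    \<comment> \<open>On a finite set the estimate passes to the coordinatewise limit; bounds on all
      finite sets then give the bound on the full norm.\<close>
    have unif: "L2_on (\<lambda>p. X m \<xi> p - T \<xi> p) F \<le> e * ell2_norm \<xi>"
      if \<xi>: "\<xi> \<in> ell2 A" and "finite F" and N: "\<forall>n\<ge>N. nrm ?B (X m \<ominus>\<^bsub>?B\<^esub> X n) < e" for m \<xi> F e N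
    proof (rule tendsto_upperbound)
      show "(\<lambda>n. L2_on (\<lambda>p. X m \<xi> p - X n \<xi> p) F) \<longlonglongrightarrow> L2_on (\<lambda>p. X m \<xi> p - T \<xi> p) F"
        unfolding L2_set_def by (intro tendsto_intros T[OF \<xi>])
      show "\<forall>\<^sub>F n in sequentially. L2_on (\<lambda>p. X m \<xi> p - X n \<xi> p) F \<le> e * ell2_norm \<xi>"
        unfolding eventually_sequentially
      proof (intro exI allI impI)
        fix n assume "n \<ge> N"
        have "L2_on (\<lambda>p. X m \<xi> p - X n \<xi> p) F \<le> ell2_norm (\<lambda>p. X m \<xi> p - X n \<xi> p)"
          using XB \<xi> by (intro L2_on_le_ell2_norm[OF ell2_diff \<open>finite F\<close>, of _ A]) auto
        also have "\<dots> \<le> nrm ?B (X m \<ominus>\<^bsub>?B\<^esub> X n) * ell2_norm \<xi>" by (rule XD[OF \<xi>])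
        also have "\<dots> \<le> e * ell2_norm \<xi>"
          using N \<open>n \<ge> N\<close> by (intro mult_right_mono) (auto intro: less_imp_le)
        finally show "L2_on (\<lambda>p. X m \<xi> p - X n \<xi> p) F \<le> e * ell2_norm \<xi>" .
      qed
    qed simp
    have unif2: "(\<lambda>p. X m \<xi> p - T \<xi> p) \<in> ell2 A" "ell2_norm (\<lambda>p. X m \<xi> p - T \<xi> p) \<le> e * ell2_norm \<xi>"
      if "\<xi> \<in> ell2 A" "\<forall>n\<ge>N. nrm ?B (X m \<ominus>\<^bsub>?B\<^esub> X n) < e" for m \<xi> e N
      using unif[OF that(1) _ that(2)] T0[OF that(1)] ell2D[OF bounded_ops_ell2[OF XB that(1)]]
      by (auto intro!: ell2I ell2_norm_leI)
    \<comment> \<open>Any fixed tolerance would do: T differs from \<open>X N1\<close> by an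
      operator of norm at most 1, so it is bounded because \<open>X N1\<close> is.\<close>
    obtain N1 where N1: "\<forall>m\<ge>N1. \<forall>n\<ge>N1. nrm ?B (X m \<ominus>\<^bsub>?B\<^esub> X n) < 1"
      using C zero_less_one by blast
    let ?T = "restrict T (ell2 A)"
    have eq: "T \<xi> = (\<lambda>p. X N1 \<xi> p + (-1) * (X N1 \<xi> p - T \<xi> p))" for \<xi> by auto
    have TB: "?T \<in> bounded_ops A"
    proof (rule bounded_opsI)
      fix \<xi> \<eta> c assume \<xi>: "\<xi> \<in> ell2 A"
      have d: "(\<lambda>p. X N1 \<xi> p - T \<xi> p) \<in> ell2 A" "ell2_norm (\<lambda>p. X N1 \<xi> p - T \<xi> p) \<le> 1 * ell2_norm \<xi>"
        using unif2[OF \<xi>, of N1 N1 1] N1 by auto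
      show "T \<xi> \<in> ell2 A"
        by (subst eq) (intro ell2_add ell2_scale d bounded_ops_ell2[OF XB \<xi>])
      have "ell2_norm (T \<xi>) \<le> ell2_norm (X N1 \<xi>) + ell2_norm (\<lambda>p. (-1) * (X N1 \<xi> p - T \<xi> p))"
        by (subst eq) (intro ell2_norm_add[of _ A] ell2_scale d bounded_ops_ell2[OF XB \<xi>])
      also have "\<dots> \<le> op_norm_on A (X N1) * ell2_norm \<xi> + 1 * ell2_norm \<xi>"
        unfolding ell2_norm_scale[OF d(1)] using d(2) ell2_norm_le_op_norm[OF XB order.refl \<xi>] by (intro add_mono) auto
      finally show "ell2_norm (T \<xi>) \<le> (op_norm_on A (X N1) + 1) * ell2_norm \<xi>" by (simp add: algebra_simps)
      show "T (\<lambda>p. c * \<xi> p) = (\<lambda>p. c * T \<xi> p)"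
      proof
        fix p
        have "(\<lambda>n. c * X n \<xi> p) \<longlonglongrightarrow> c * T \<xi> p" by (intro tendsto_intros T \<xi>)
        then show "T (\<lambda>p. c * \<xi> p) p = c * T \<xi> p"
          using T[OF ell2_scale[OF \<xi>, of c], of p] bounded_ops_scale[OF XB \<xi>, of _ c] LIMSEQ_unique by fastforce
      qed
      assume \<eta>: "\<eta> \<in> ell2 A"
      show "T (\<lambda>p. \<xi> p + \<eta> p) = (\<lambda>p. T \<xi> p + T \<eta> p)"
      proof
        fix p
        have "(\<lambda>n. X n \<xi> p + X n \<eta> p) \<longlonglongrightarrow> T \<xi> p + T \<eta> p" by (intro tendsto_intros T \<xi> \<eta>)
        then show "T (\<lambda>p. \<xi> p + \<eta> p) p = T \<xi> p + T \<eta> p"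
          using T[OF ell2_add[OF \<xi> \<eta>], of p] bounded_ops_add[OF XB \<xi> \<eta>] LIMSEQ_unique by fastforce
      qed
    qed
    have "(\<lambda>n. nrm ?B (X n \<ominus>\<^bsub>?B\<^esub> ?T)) \<longlonglongrightarrow> 0"
    proof (rule LIMSEQ_I)
      fix e :: real assume "e > 0"
      then obtain N where N: "\<forall>m\<ge>N. \<forall>n\<ge>N. nrm ?B (X m \<ominus>\<^bsub>?B\<^esub> X n) < e / 2"
        using C half_gt_zero by blast
      have "norm (nrm ?B (X m \<ominus>\<^bsub>?B\<^esub> ?T) - 0) < e" if "m \<ge> N" for m
      proof -
        have "op_norm_on A (X m \<ominus>\<^bsub>?B\<^esub> ?T) \<le> e / 2"
          using unif2(2)[of _ N m "e / 2"] N that \<open>e > 0\<close> by (intro op_norm_leI) (auto simp: diff XB TB)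
        then show ?thesis
          using op_norm_nonneg[OF c_diff[OF XB[of m] TB]] \<open>e > 0\<close> by (simp add: S(8))
      qed
      then show "\<exists>N. \<forall>n\<ge>N. norm (nrm ?B (X n \<ominus>\<^bsub>?B\<^esub> ?T) - 0) < e" by blast
    qed
    then show "\<exists>l\<in>carrier ?B. (\<lambda>n. nrm ?B (X n \<ominus>\<^bsub>?B\<^esub> l)) \<longlonglongrightarrow> 0"
      using TB by (auto simp: S(1))
  qed
qed


section \<open>Linear combinations of commuting projections\<close>

text \<open>If s > m > 0, some power of s/m with exponent \<open>2 ^ n\<close> exceeds 2; for m = 0
  the case n = 0 already forces s \<le> 0.\<close>

lemma le_if_pow2_le:
  fixes s m :: real
  assumes "0 \<le> m" and le: "\<And>n. s ^ 2 ^ n \<le> 2 * m ^ 2 ^ n"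
  shows "s \<le> m"
proof (rule ccontr)
  assume "\<not> s \<le> m"
  then have s: "m < s" "0 < s" using \<open>0 \<le> m\<close> by auto
  have m: "0 < m"
  proof (rule ccontr)
    assume "\<not> 0 < m"
    then have "m = 0" using \<open>0 \<le> m\<close> by simp
    then show False using le[of 0] s by simp
  qed
  then have r: "1 < s / m" using s by simp
  then obtain n where "2 < (s / m) ^ n" using real_arch_pow by blast
  also have "\<dots> \<le> (s / m) ^ 2 ^ n"
    using r by (intro power_increasing) auto
  finally show False
    using le[of n] m by (simp add: power_divide field_simps)
qed

section \<open>Norms of orthogonal sums\<close>

context cstar_algebra
begin

lemma adj_one [simp]: "adj A \<one> = \<one>"
  using adj_mult[of "adj A \<one>" \<one>] adj_adj[of \<one>] adj_closed[of \<one>] by simp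

lemma smult_zero_right [simp]: "c \<odot> \<zero> = \<zero>"
  using smult_smult[of \<zero> c 0] smult_zero[of \<zero>] by simp

lemma adj_zero [simp]: "adj A \<zero> = \<zero>"
  using adj_smult[of \<zero> 0] adj_closed[of \<zero>] by (simp add: smult_zero)

lemma nrm_zero [simp]: "nrm A \<zero> = 0"
  using nrm_eq_0[of \<zero>] by simp

lemma minus_smult: "x \<in> carrier A \<Longrightarrow> \<ominus> x = (-1) \<odot> x"
  using minus_equality[of "(-1) \<odot> x" x] smult_add_left[of x "-1" 1]
  by (simp add: smult_one smult_zero smult_closed)

lemma add_cancel_minus:
  assumes "a \<in> carrier A" "b \<in> carrier A" "w \<in> carrier A"
  shows "(a \<oplus> w) \<ominus> (b \<oplus> w) = a \<ominus> b"
  using assms by algebra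

lemma nrm_self_adjoint:
  assumes "x \<in> carrier A" "adj A x = x"
  shows "nrm A (x \<otimes> x) = (nrm A x)\<^sup>2"
  using cstar_identity[OF assms(1)] assms(2) by simp

lemma nrm_projection_le:
  assumes "x \<in> carrier A" "adj A x = x" "x \<otimes> x = x"
  shows "nrm A x \<le> 1"
  using nrm_self_adjoint[OF assms(1,2)] assms(3) by (auto simp: power2_eq_square)

text \<open>For self-adjoint orthogonal h and k the square of h \<oplus> k is the sum of the
  squares, and squaring a self-adjoint element squares its norm. Each squaring thus doubles the
  exponent; the triangle inequality is used only at n = 0.\<close>

lemma nrm_orthogonal_pow:
  assumes "h \<in> carrier A" "k \<in> carrier A" "adj A h = h" "adj A k = k" "h \<otimes> k = \<zero>" "k \<otimes> h = \<zero>"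
  shows "nrm A (h \<oplus> k) ^ 2 ^ n \<le> nrm A h ^ 2 ^ n + nrm A k ^ 2 ^ n"
  using assms
proof (induction n arbitrary: h k)
  case 0
  then show ?case using nrm_add by simp
next
  case (Suc n)
  note c = Suc.prems(1,2)
  have sq: "(h \<oplus> k) \<otimes> (h \<oplus> k) = h \<otimes> h \<oplus> k \<otimes> k"
    using Suc.prems by (simp add: l_distr r_distr)
  have 0: "(h \<otimes> h) \<otimes> (k \<otimes> k) = h \<otimes> (h \<otimes> k) \<otimes> k" "(k \<otimes> k) \<otimes> (h \<otimes> h) = k \<otimes> (k \<otimes> h) \<otimes> h"
    using c by (simp_all add: m_assoc)
  have "nrm A (h \<otimes> h \<oplus> k \<otimes> k) ^ 2 ^ n \<le> nrm A (h \<otimes> h) ^ 2 ^ n + nrm A (k \<otimes> k) ^ 2 ^ n"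
    by (rule Suc.IH) (use Suc.prems 0 in \<open>simp_all add: adj_mult\<close>)
  moreover have "nrm A (h \<otimes> h \<oplus> k \<otimes> k) = (nrm A (h \<oplus> k))\<^sup>2"
    using nrm_self_adjoint[of "h \<oplus> k"] Suc.prems sq by (simp add: adj_add)
  ultimately show ?case
    using Suc.prems by (simp add: nrm_self_adjoint power_mult)
qed

text \<open>Iterating the C*-identity replaces the factor \<open>2\<close> of the triangle inequality by its \<open>2\<^sup>n\<close>-th roots.\<close>

lemma nrm_orthogonal:
  assumes c: "a \<in> carrier A" "b \<in> carrier A"
    and 0: "adj A a \<otimes> b = \<zero>" "adj A b \<otimes> a = \<zero>" "a \<otimes> adj A b = \<zero>" "b \<otimes> adj A a = \<zero>"
    and M: "nrm A a \<le> M" "nrm A b \<le> M"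
  shows "nrm A (a \<oplus> b) \<le> M"
proof -
  note cl = c adj_closed[OF c(1)] adj_closed[OF c(2)]
  \<comment> \<open>These two elements are self-adjoint and orthogonal, and their sum is
    \<open>adj A x \<otimes> x\<close> for x = a \<oplus> b.\<close>
  let ?h = "adj A a \<otimes> a" and ?k = "adj A b \<otimes> b"
  have M0: "0 \<le> M" using M(1) nrm_nonneg[OF c(1)] by simp
  have "?h \<otimes> ?k = adj A a \<otimes> (a \<otimes> adj A b) \<otimes> b" "?k \<otimes> ?h = adj A b \<otimes> (b \<otimes> adj A a) \<otimes> a"
    using cl by (simp_all add: m_assoc)
  then have hk: "?h \<otimes> ?k = \<zero>" "?k \<otimes> ?h = \<zero>" using 0 cl by simp_all
  have "adj A (a \<oplus> b) \<otimes> (a \<oplus> b) = ?h \<oplus> ?k"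
    using cl 0 by (simp add: adj_add l_distr r_distr)
  then have s: "nrm A (?h \<oplus> ?k) = (nrm A (a \<oplus> b))\<^sup>2"
    using cstar_identity[of "a \<oplus> b"] c by simp
  have "nrm A (?h \<oplus> ?k) \<le> M\<^sup>2"
  proof (rule le_if_pow2_le)
    fix n
    have "nrm A (?h \<oplus> ?k) ^ 2 ^ n \<le> nrm A ?h ^ 2 ^ n + nrm A ?k ^ 2 ^ n"
      by (rule nrm_orthogonal_pow) (use cl hk in \<open>simp_all add: adj_mult adj_adj\<close>)
    also have "\<dots> = ((nrm A a)\<^sup>2) ^ 2 ^ n + ((nrm A b)\<^sup>2) ^ 2 ^ n"
      using c by (simp add: cstar_identity)
    also have "\<dots> \<le> (M\<^sup>2) ^ 2 ^ n + (M\<^sup>2) ^ 2 ^ n"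
      using M nrm_nonneg c by (intro add_mono power_mono) auto
    finally show "nrm A (?h \<oplus> ?k) ^ 2 ^ n \<le> 2 * (M\<^sup>2) ^ 2 ^ n" by simp
  qed simp
  then show ?thesis unfolding s by (rule power2_le_imp_le[OF _ M0])
qed

text \<open>With respect to q and its complement x is block diagonal, because x, and by taking
  adjoints also \<open>adj A x\<close>, commutes with q. The two blocks are orthogonal from both
  sides, so the larger one controls the norm.\<close>

lemma nrm_cut:
  assumes c: "x \<in> carrier A" "q \<in> carrier A"
    and q: "adj A q = q" "q \<otimes> q = q" and xq: "x \<otimes> q = q \<otimes> x"
    and M: "nrm A (x \<otimes> q) \<le> M" "nrm A (x \<ominus> x \<otimes> q) \<le> M"
  shows "nrm A x \<le> M"
proof -
  let ?y = "adj A x"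
  have y: "?y \<in> carrier A" using c adj_closed by simp
  have yq: "?y \<otimes> q = q \<otimes> ?y"
    using arg_cong[OF xq, of "adj A"] c q by (simp add: adj_mult)
  have a: "adj A (x \<otimes> q) = ?y \<otimes> q" using c q yq by (simp add: adj_mult)
  have b: "adj A (x \<ominus> x \<otimes> q) = ?y \<ominus> ?y \<otimes> q"
    using c a by (simp add: minus_eq minus_smult adj_add adj_smult smult_closed adj_closed)
  have key: "(u \<otimes> q) \<otimes> (v \<ominus> v \<otimes> q) = \<zero>" "(v \<ominus> v \<otimes> q) \<otimes> (u \<otimes> q) = \<zero>"
    if u: "u \<in> carrier A" "v \<in> carrier A" "u \<otimes> q = q \<otimes> u" "v \<otimes> q = q \<otimes> v" for u v
  proof -
    have "(u \<otimes> q) \<otimes> (v \<ominus> v \<otimes> q) = u \<otimes> (q \<otimes> v) \<ominus> u \<otimes> ((q \<otimes> v) \<otimes> q)"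
      using c u(1,2) by (simp add: minus_eq r_distr m_assoc r_minus)
    also have "(q \<otimes> v) \<otimes> q = q \<otimes> v"
      using c u q by (simp flip: u(4) add: m_assoc)
    finally show "(u \<otimes> q) \<otimes> (v \<ominus> v \<otimes> q) = \<zero>"
      using c u by (simp add: minus_eq r_neg)
    have "(v \<ominus> v \<otimes> q) \<otimes> (u \<otimes> q) = v \<otimes> (u \<otimes> q) \<ominus> v \<otimes> (q \<otimes> (u \<otimes> q))"
      using c u(1,2) by (simp add: minus_eq l_distr m_assoc l_minus)
    also have "q \<otimes> (u \<otimes> q) = u \<otimes> q"
      using c u q by (simp flip: m_assoc)
    finally show "(v \<ominus> v \<otimes> q) \<otimes> (u \<otimes> q) = \<zero>"
      using c u by (simp add: minus_eq r_neg)
  qed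
  have "x = x \<otimes> q \<oplus> (x \<ominus> x \<otimes> q)"
    using c by (simp add: minus_eq a_lcomm r_neg)
  moreover have "nrm A (x \<otimes> q \<oplus> (x \<ominus> x \<otimes> q)) \<le> M"
    by (rule nrm_orthogonal) (use c y M key[OF _ _ xq yq] key[OF _ _ yq xq] in \<open>simp_all only: a b m_closed minus_closed\<close>)
  ultimately show ?thesis by simp
qed

end

section \<open>Formal linear combinations of ideals\<close>

definition comb_val :: "'b cstar \<Rightarrow> ('g set \<Rightarrow> 'b) \<Rightarrow> (complex \<times> 'g set) list \<Rightarrow> 'b" where
  "comb_val A E L = foldr (\<lambda>(c, S) x. c \<odot>\<^bsub>A\<^esub> E S \<oplus>\<^bsub>A\<^esub> x) L \<zero>\<^bsub>A\<^esub>"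

definition comb_fun :: "(complex \<times> 'g set) list \<Rightarrow> 'g \<Rightarrow> complex" where
  "comb_fun L p = (\<Sum>(c, S)\<leftarrow>L. c * indicator S p)"

definition comb_mult :: "(complex \<times> 'g set) list \<Rightarrow> (complex \<times> 'g set) list \<Rightarrow> (complex \<times> 'g set) list" where
  "comb_mult L M = concat (map (\<lambda>(c, S). map (\<lambda>(d, T). (c * d, S \<inter> T)) M) L)"

definition comb_cnj :: "(complex \<times> 'g set) list \<Rightarrow> (complex \<times> 'g set) list" where
  "comb_cnj L = map (\<lambda>(c, S). (cnj c, S)) L"

text \<open>The product of (T4), expanded formally. The empty product is represented by P, whose
  indicator is 1 on P and whose projection is the unit.\<close>

primrec comb_diff :: "'g set \<Rightarrow> 'g set \<Rightarrow> 'g set list \<Rightarrow> (complex \<times> 'g set) list" where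
  "comb_diff P S [] = [(1, P)]"
| "comb_diff P S (T # Ts) = comb_mult [(1, S), (-1, T)] (comb_diff P S Ts)"

text \<open>Lists are used because a function may be a combination of indicators in several ways.
  That \<open>comb_fun\<close> determines \<open>comb_val\<close> is not built into the encoding; it
  is a property of representations, proved from (T2) and (T4).\<close>

definition combs :: "'g set set \<Rightarrow> (complex \<times> 'g set) list set" where
  "combs J = lists (UNIV \<times> J)"

lemma comb_val_simps [simp]:
  "comb_val A E [] = \<zero>\<^bsub>A\<^esub>"
  "comb_val A E ((c, S) # L) = c \<odot>\<^bsub>A\<^esub> E S \<oplus>\<^bsub>A\<^esub> comb_val A E L"
  by (simp_all add: comb_val_def)

lemma comb_fun_simps [simp]:
  "comb_fun [] p = 0"
  "comb_fun ((c, S) # L) p = c * indicator S p + comb_fun L p"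
  "comb_fun (L @ M) p = comb_fun L p + comb_fun M p"
  by (simp_all add: comb_fun_def)

lemma comb_mult_simps [simp]:
  "comb_mult [] M = []"
  "comb_mult ((c, S) # L) M = map (\<lambda>(d, T). (c * d, S \<inter> T)) M @ comb_mult L M"
  by (simp_all add: comb_mult_def)

lemma comb_cnj_simps [simp]:
  "comb_cnj [] = []" "comb_cnj ((c, S) # L) = (cnj c, S) # comb_cnj L"
  by (simp_all add: comb_cnj_def)

lemma combs_simps [simp]:
  "[] \<in> combs J" "(c, S) # L \<in> combs J \<longleftrightarrow> S \<in> J \<and> L \<in> combs J"
  "L @ M \<in> combs J \<longleftrightarrow> L \<in> combs J \<and> M \<in> combs J"
  by (auto simp: combs_def)

lemma comb_fun_scale:
  "comb_fun (map (\<lambda>(d, T). (c * d, S \<inter> T)) M) p = c * indicator S p * comb_fun M p"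
  by (induction M) (auto simp: algebra_simps indicator_inter_arith)

lemma comb_fun_mult: "comb_fun (comb_mult L M) p = comb_fun L p * comb_fun M p"
  by (induction L) (auto simp: algebra_simps comb_fun_scale)

lemma comb_fun_cnj: "comb_fun (comb_cnj L) p = cnj (comb_fun L p)"
  by (induction L) (auto simp: indicator_def)

lemma comb_fun_diff:
  "comb_fun (comb_diff P S Ts) p = indicator P p * (\<Prod>T\<leftarrow>Ts. indicator S p - indicator T p)"
  by (induction Ts) (simp_all add: comb_fun_mult mult_ac del: comb_mult_simps)

text \<open>A unital representation of the intersection semilattice J by projections:
  multiplicativity on \<open>S \<inter> S\<close> gives idempotence, and symmetry of the
  intersection gives commutation. Instances arise from representations of the Toeplitz relations and
  from unital homomorphisms defined on the indicator operators.\<close>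

locale meet_rep = cstar_algebra A for A :: "'b cstar" (structure) +
  fixes J :: "'g set set" and P :: "'g set" and E :: "'g set \<Rightarrow> 'b"
  assumes top_mem: "P \<in> J" and sub_top: "S \<in> J \<Longrightarrow> S \<subseteq> P"
    and Int_mem: "S \<in> J \<Longrightarrow> T \<in> J \<Longrightarrow> S \<inter> T \<in> J"
    and E_closed: "S \<in> J \<Longrightarrow> E S \<in> carrier A"
    and E_adj: "S \<in> J \<Longrightarrow> adj A (E S) = E S"
    and E_Int: "S \<in> J \<Longrightarrow> T \<in> J \<Longrightarrow> E (S \<inter> T) = E S \<otimes> E T"
    and E_top: "E P = \<one>"
begin

lemma comb_val_closed [simp]: "L \<in> combs J \<Longrightarrow> comb_val A E L \<in> carrier A"
  by (induction L) (auto simp: smult_closed E_closed)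

lemma comb_val_append:
  "L \<in> combs J \<Longrightarrow> M \<in> combs J \<Longrightarrow> comb_val A E (L @ M) = comb_val A E L \<oplus> comb_val A E M"
  by (induction L) (auto simp: a_assoc smult_closed E_closed)

lemma scale_combs: "S \<in> J \<Longrightarrow> M \<in> combs J \<Longrightarrow> map (\<lambda>(d, T). (c * d, S \<inter> T)) M \<in> combs J"
  by (induction M) (auto simp: Int_mem)

lemma mult_combs [simp]: "L \<in> combs J \<Longrightarrow> M \<in> combs J \<Longrightarrow> comb_mult L M \<in> combs J"
  by (induction L) (auto simp: scale_combs)

lemma cnj_combs [simp]: "L \<in> combs J \<Longrightarrow> comb_cnj L \<in> combs J"
  by (induction L) auto

lemma diff_combs [simp]: "S \<in> J \<Longrightarrow> set Ts \<subseteq> J \<Longrightarrow> comb_diff P S Ts \<in> combs J"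
  by (induction Ts) (auto simp: top_mem simp del: comb_mult_simps)

lemma comb_val_scale:
  assumes "S \<in> J" "M \<in> combs J"
  shows "comb_val A E (map (\<lambda>(d, T). (c * d, S \<inter> T)) M) = (c \<odot> E S) \<otimes> comb_val A E M"
  using assms(2)
proof (induction M)
  case Nil
  then show ?case using assms by (simp add: smult_closed E_closed)
next
  case (Cons x M)
  then show ?case using assms(1)
    by (cases x) (simp add: r_distr smult_closed E_closed E_Int smult_mult_left smult_mult_right smult_smult mult.commute)
qed

lemma comb_val_mult:
  "L \<in> combs J \<Longrightarrow> M \<in> combs J \<Longrightarrow> comb_val A E (comb_mult L M) = comb_val A E L \<otimes> comb_val A E M"
  by (induction L)
    (auto simp: comb_val_append comb_val_scale scale_combs l_distr smult_closed E_closed)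

lemma comb_val_cnj: "L \<in> combs J \<Longrightarrow> comb_val A E (comb_cnj L) = adj A (comb_val A E L)"
  by (induction L) (auto simp: adj_add adj_smult smult_closed E_closed E_adj)

lemma comb_val_minus:
  "L \<in> combs J \<Longrightarrow> M \<in> combs J \<Longrightarrow>
    comb_val A E (L @ comb_mult [(-1, P)] M) = comb_val A E L \<ominus> comb_val A E M"
  by (simp add: comb_val_append comb_val_mult top_mem E_top minus_eq minus_smult
      smult_mult_left smult_closed del: comb_mult_simps)

lemma comb_val_diff:
  assumes "S \<in> J" "set Ts \<subseteq> J"
  shows "comb_val A E (comb_diff P S Ts) = foldr (\<lambda>T x. (E S \<ominus> E T) \<otimes> x) Ts \<one>"
  using assms(2)
proof (induction Ts)
  case Nil
  show ?case by (simp add: E_top smult_one)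
next
  case (Cons T Ts)
  then have "comb_val A E (comb_diff P S (T # Ts)) =
      comb_val A E [(1, S), (-1, T)] \<otimes> comb_val A E (comb_diff P S Ts)"
    unfolding comb_diff.simps using assms(1) by (intro comb_val_mult) auto
  then show ?case
    using Cons assms(1) by (simp add: smult_one minus_eq minus_smult E_closed smult_closed)
qed

lemma E_commute: "S \<in> J \<Longrightarrow> T \<in> J \<Longrightarrow> E S \<otimes> E T = E T \<otimes> E S"
  using E_Int[of S T] E_Int[of T S] by (simp add: Int_commute)

lemma E_idem: "S \<in> J \<Longrightarrow> E S \<otimes> E S = E S"
  using E_Int[of S S] by simp

lemma comb_val_commute:
  "L \<in> combs J \<Longrightarrow> S \<in> J \<Longrightarrow> comb_val A E L \<otimes> E S = E S \<otimes> comb_val A E L"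
  by (induction L)
    (auto simp: l_distr r_distr smult_closed E_closed smult_mult_left smult_mult_right E_commute)

text \<open>The atom \<open>E S\<close> times factors 1 - \<open>E T\<close>, built up so that
  removing a further set is one step x \<mapsto> x - \<open>E T\<close> x, which produces the
  complementary block of \<open>nrm_cut\<close>.\<close>

definition cut_proj :: "'g set \<Rightarrow> 'g set list \<Rightarrow> 'b" where
  "cut_proj S Ts = foldr (\<lambda>T x. x \<ominus> E T \<otimes> x) Ts (E S)"

lemma cut_proj_simps [simp]: "cut_proj S [] = E S" "cut_proj S (T # Ts) = cut_proj S Ts \<ominus> E T \<otimes> cut_proj S Ts"
  by (simp_all add: cut_proj_def)

lemma cut_closed [simp]: "S \<in> J \<Longrightarrow> set Ts \<subseteq> J \<Longrightarrow> cut_proj S Ts \<in> carrier A"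
  by (induction Ts) (auto simp: E_closed)

text \<open>Multiplication by \<open>E R\<close> only replaces S by \<open>S \<inter> R\<close>, so
  both halves of an atom split by R are again atoms.\<close>

lemma E_cut:
  assumes "S \<in> J" "R \<in> J" "set Ts \<subseteq> J"
  shows "E R \<otimes> cut_proj S Ts = cut_proj (S \<inter> R) Ts" "cut_proj S Ts \<otimes> E R = cut_proj (S \<inter> R) Ts"
proof -
  have 1: "E R \<otimes> cut_proj S Ts = cut_proj (S \<inter> R) Ts" if "R \<in> J" for R
    using assms(3)
  proof (induction Ts)
    case Nil
    then show ?case using assms that by (simp add: E_Int E_commute)
  next
    case (Cons T Ts)
    have "E R \<otimes> (E T \<otimes> cut_proj S Ts) = (E R \<otimes> E T) \<otimes> cut_proj S Ts"
      using Cons assms that by (simp add: E_closed m_assoc)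
    also have "\<dots> = E T \<otimes> (E R \<otimes> cut_proj S Ts)"
      using Cons assms that by (subst E_commute) (simp_all add: E_closed m_assoc)
    finally have "E R \<otimes> (E T \<otimes> cut_proj S Ts) = E T \<otimes> (E R \<otimes> cut_proj S Ts)" .
    then show ?case using Cons assms that by (simp add: minus_eq r_distr r_minus E_closed)
  qed
  show "E R \<otimes> cut_proj S Ts = cut_proj (S \<inter> R) Ts"
    by (rule 1) fact
  show "cut_proj S Ts \<otimes> E R = cut_proj (S \<inter> R) Ts"
    using assms(3)
  proof (induction Ts)
    case Nil
    then show ?case using assms by (simp add: E_Int)
  next
    case (Cons T Ts)
    then show ?case using assms 1 by (simp add: minus_eq l_distr l_minus E_closed m_assoc)
  qed
qed

lemma cut_projection:
  assumes "S \<in> J" "set Ts \<subseteq> J"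
  shows "adj A (cut_proj S Ts) = cut_proj S Ts" "cut_proj S Ts \<otimes> cut_proj S Ts = cut_proj S Ts"
proof -
  show "adj A (cut_proj S Ts) = cut_proj S Ts"
    using assms(2)
  proof (induction Ts)
    case Nil
    then show ?case using assms by (simp add: E_adj)
  next
    case (Cons T Ts)
    moreover from this have "cut_proj S Ts \<otimes> E T = E T \<otimes> cut_proj S Ts"
      using assms by (simp add: E_cut)
    ultimately have "adj A (E T \<otimes> cut_proj S Ts) = E T \<otimes> cut_proj S Ts"
      using assms by (simp add: adj_mult E_closed E_adj)
    then show ?case
      using Cons assms by (simp add: minus_eq minus_smult adj_add adj_smult E_closed smult_closed)
  qed
  show "cut_proj S Ts \<otimes> cut_proj S Ts = cut_proj S Ts"
    using assms(2)
  proof (induction Ts)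
    case Nil
    then show ?case using assms by (simp add: E_idem)
  next
    case (Cons T Ts)
    let ?Q = "cut_proj S Ts" and ?e = "E T"
    have c: "?Q \<in> carrier A" "?e \<in> carrier A" using Cons assms by (simp_all add: E_closed)
    have "?e \<otimes> ?Q = ?Q \<otimes> ?e" using Cons assms E_cut[of S T Ts] by simp
    then have "?Q \<otimes> (?e \<otimes> ?Q) = ?e \<otimes> ?Q"
      using Cons c by (simp flip: m_assoc)
    moreover have "(?e \<otimes> ?Q) \<otimes> (?e \<otimes> ?Q) = ?e \<otimes> (?Q \<otimes> (?e \<otimes> ?Q))"
      using c by (simp add: m_assoc)
    moreover have "?e \<otimes> (?e \<otimes> ?Q) = ?e \<otimes> ?Q"
      using Cons c by (simp add: E_idem flip: m_assoc)
    ultimately show ?case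
      using Cons c by (simp add: minus_eq l_distr r_distr l_minus r_minus m_assoc a_ac minus_minus r_neg minus_add)
  qed
qed

lemma cut_absorb:
  assumes "S \<in> J" "set Ts \<subseteq> J" "T \<in> set Ts"
  shows "cut_proj S Ts \<otimes> E T = \<zero>"
  using assms(2,3)
proof (induction Ts)
  case (Cons R Ts)
  note c = assms(1) E_closed cut_closed[OF assms(1)]
  show ?case
  proof (cases "T = R")
    case True
    have "cut_proj S (R # Ts) \<otimes> E R = cut_proj S Ts \<otimes> E R \<ominus> E R \<otimes> (cut_proj S Ts \<otimes> E R)"
      using Cons c by (simp add: minus_eq l_distr l_minus m_assoc)
    also have "cut_proj S Ts \<otimes> E R = E R \<otimes> cut_proj S Ts" using Cons c by (simp add: E_cut)
    also have "E R \<otimes> (E R \<otimes> cut_proj S Ts) = E R \<otimes> cut_proj S Ts"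
      using Cons c by (simp add: E_idem flip: m_assoc)
    finally show ?thesis using True Cons c by (simp add: minus_eq r_neg)
  next
    case False
    then have 0: "cut_proj S Ts \<otimes> E T = \<zero>" using Cons by simp
    have "T \<in> J" using Cons by auto
    then have "cut_proj S (R # Ts) \<otimes> E T = cut_proj S Ts \<otimes> E T \<ominus> E R \<otimes> (cut_proj S Ts \<otimes> E T)"
      using Cons.prems assms(1) E_closed cut_closed[OF assms(1)]
      by (simp add: minus_eq l_distr l_minus m_assoc)
    then show ?thesis using 0 Cons c by (simp add: minus_eq)
  qed
qed simp

text \<open>If the product \<open>\<Prod>(E S - E (S \<inter> T))\<close> of relation (T4) vanishes, then so does the atom \<open>cut_proj S Ts\<close>, which it fixes.\<close>

lemma cut_eq_zero:
  assumes "S \<in> J" "set Ts \<subseteq> J" "set Us \<subseteq> J" "\<And>U. U \<in> set Us \<Longrightarrow> \<exists>T\<in>set Ts. U = S \<inter> T"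
    and "foldr (\<lambda>U x. (E S \<ominus> E U) \<otimes> x) Us \<one> = \<zero>"
  shows "cut_proj S Ts = \<zero>"
proof -
  let ?Q = "cut_proj S Ts"
  have Q: "?Q \<in> carrier A" using assms by simp
  have fc: "foldr (\<lambda>U x. (E S \<ominus> E U) \<otimes> x) Us \<one> \<in> carrier A" if "set Us \<subseteq> J" for Us
    using that assms(1) by (induction Us) (auto simp: E_closed)
  have "?Q \<otimes> foldr (\<lambda>U x. (E S \<ominus> E U) \<otimes> x) Us \<one> = ?Q"
    using assms(3,4)
  proof (induction Us)
    case Nil
    then show ?case using Q by simp
  next
    case (Cons U Us)
    obtain T where T: "T \<in> set Ts" "U = S \<inter> T" using Cons by auto
    then have "T \<in> J" using assms by auto
    have QS: "?Q \<otimes> E S = ?Q" using E_cut(2)[of S S Ts] assms by simp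
    have "?Q \<otimes> E U = (?Q \<otimes> E S) \<otimes> E T"
      using T \<open>T \<in> J\<close> assms Q by (simp add: E_Int E_closed m_assoc)
    also have "\<dots> = \<zero>" using QS cut_absorb[OF assms(1,2) T(1)] by simp
    finally have "?Q \<otimes> (E S \<ominus> E U) = ?Q"
      using QS Q Cons assms by (simp add: minus_eq r_distr r_minus E_closed)
    moreover have "?Q \<otimes> ((E S \<ominus> E U) \<otimes> y) = (?Q \<otimes> (E S \<ominus> E U)) \<otimes> y" if "y \<in> carrier A" for y
      using Q Cons assms that by (simp add: E_closed m_assoc)
    ultimately show ?case using Cons fc[of Us] by simp
  qed
  then show ?thesis using assms(5) Q by simp
qed

end

text \<open>An atom supported on no point is zero: for \<open>Ts = []\<close> this is the content of
  (T2), for nonempty S that of (T4). Nothing is said of atoms that have points; they may vanish as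
  well.\<close>

locale faithful_meet_rep = meet_rep +
  assumes cut_zero: "S \<in> J \<Longrightarrow> set Ts \<subseteq> J \<Longrightarrow> S \<subseteq> \<Union>(set Ts) \<Longrightarrow> cut_proj S Ts = \<zero>"
begin

text \<open>Each term (d, R) splits the current atom by R: inside R the coefficient d is added to
  the scalar c, outside R the term is dropped. When the list is exhausted, c is the value of the
  function on the whole atom; an atom without points contributes zero, and any other has a point at
  which the hypothesis bounds c by M.\<close>

lemma comb_val_cut_bound:
  assumes "L \<in> combs J" "S \<in> J" "set Ts \<subseteq> J" "0 \<le> M"
    and "\<And>p. p \<in> S - \<Union>(set Ts) \<Longrightarrow> cmod (c + comb_fun L p) \<le> M"
  shows "nrm A ((c \<odot> \<one> \<oplus> comb_val A E L) \<otimes> cut_proj S Ts) \<le> M"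
  using assms
proof (induction L arbitrary: c S Ts)
  case Nil
  have *: "nrm A ((c \<odot> \<one> \<oplus> comb_val A E []) \<otimes> cut_proj S Ts) = cmod c * nrm A (cut_proj S Ts)"
    using Nil by (simp add: smult_closed smult_mult_left nrm_smult)
  show ?case
  proof (cases "S \<subseteq> \<Union>(set Ts)")
    case True
    then show ?thesis using * Nil cut_zero by simp
  next
    case False
    then have "cmod c \<le> M" using Nil by fastforce
    moreover have "nrm A (cut_proj S Ts) \<le> 1"
      using Nil cut_projection by (simp add: nrm_projection_le)
    ultimately show ?thesis
      using * Nil mult_mono[of "cmod c" M "nrm A (cut_proj S Ts)" 1] nrm_nonneg by simp
  qed
next
  case (Cons x L)
  obtain d R where x: "x = (d, R)" by (cases x)
  have R: "R \<in> J" and L: "L \<in> combs J" using Cons.prems by (simp_all add: x)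
  let ?v = "comb_val A E L" and ?e = "E R" and ?Q = "cut_proj S Ts"
  define z where "z = c \<odot> \<one> \<oplus> ?v"
  have c: "?v \<in> carrier A" "?e \<in> carrier A" "?Q \<in> carrier A" "z \<in> carrier A" "c \<odot> \<one> \<in> carrier A"
    using Cons.prems R L by (simp_all add: E_closed z_def smult_closed)
  have ze: "z \<otimes> ?e = ?e \<otimes> z"
    using c comb_val_commute[OF L R] by (simp add: z_def l_distr r_distr smult_mult_left smult_mult_right)
  have eQ: "?Q \<otimes> ?e = ?e \<otimes> ?Q" using E_cut Cons.prems R by simp
  have ee: "?e \<otimes> (?e \<otimes> ?Q) = ?e \<otimes> ?Q" using E_idem[OF R] c by (simp flip: m_assoc)
  define y where "y = (z \<oplus> d \<odot> ?e) \<otimes> ?Q"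
  have y: "(c \<odot> \<one> \<oplus> comb_val A E (x # L)) \<otimes> ?Q = y"
    using c by (simp add: y_def z_def x a_ac smult_closed)
  have yz: "y = z \<otimes> ?Q \<oplus> d \<odot> (?e \<otimes> ?Q)"
    using c by (simp add: y_def l_distr smult_closed smult_mult_left)
  have ye: "y \<otimes> ?e = z \<otimes> (?e \<otimes> ?Q) \<oplus> d \<odot> (?e \<otimes> ?Q)"
    using c eQ ee by (simp add: yz l_distr smult_closed smult_mult_left m_assoc)
  have "?e \<otimes> (z \<otimes> ?Q) = z \<otimes> (?e \<otimes> ?Q)" using ze c by (simp flip: m_assoc)
  then have ey: "?e \<otimes> y = y \<otimes> ?e"
    unfolding ye using c ee by (simp add: yz r_distr smult_closed smult_mult_right)
  \<comment> \<open>Inside R the projection \<open>E R\<close> acts as the unit, so d joins the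
    scalar part.\<close>
  have 1: "y \<otimes> ?e = ((c + d) \<odot> \<one> \<oplus> ?v) \<otimes> cut_proj (S \<inter> R) Ts"
  proof -
    have "(c + d) \<odot> \<one> \<oplus> ?v = z \<oplus> d \<odot> \<one>"
      using c smult_closed[of \<one> d] by (simp add: z_def smult_add_left a_ac)
    moreover have "cut_proj (S \<inter> R) Ts = ?e \<otimes> ?Q" using E_cut(1) Cons.prems R by simp
    ultimately show ?thesis
      using c by (simp add: ye l_distr smult_closed smult_mult_left)
  qed
  \<comment> \<open>Outside R the term with coefficient d cancels.\<close>
  have 2: "y \<ominus> y \<otimes> ?e = (c \<odot> \<one> \<oplus> ?v) \<otimes> cut_proj S (R # Ts)"
  proof -
    have "y \<ominus> y \<otimes> ?e = z \<otimes> ?Q \<ominus> z \<otimes> (?e \<otimes> ?Q)"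
      unfolding ye unfolding yz by (rule add_cancel_minus) (use c in \<open>simp_all add: smult_closed\<close>)
    then show ?thesis using c by (simp add: z_def[symmetric] minus_eq r_distr r_minus)
  qed
  have "nrm A y \<le> M"
  proof (rule nrm_cut)
    show "nrm A (y \<otimes> ?e) \<le> M"
      unfolding 1
    proof (rule Cons.IH)
      fix p assume p: "p \<in> S \<inter> R - \<Union>(set Ts)"
      then have "cmod (c + comb_fun (x # L) p) \<le> M" by (intro Cons.prems(5)) auto
      then show "cmod (c + d + comb_fun L p) \<le> M" using p by (simp add: x add.assoc)
    qed (use Cons.prems R L in \<open>auto simp: Int_mem\<close>)
    show "nrm A (y \<ominus> y \<otimes> ?e) \<le> M"
      unfolding 2
    proof (rule Cons.IH)
      fix p assume p: "p \<in> S - \<Union>(set (R # Ts))"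
      then have "cmod (c + comb_fun (x # L) p) \<le> M" by (intro Cons.prems(5)) auto
      then show "cmod (c + comb_fun L p) \<le> M" using p by (simp add: x)
    qed (use Cons.prems R L in auto)
    show "y \<in> carrier A" using c by (simp add: yz smult_closed)
  qed (use c R E_adj E_idem ey in simp_all)
  then show ?case using y by simp
qed

text \<open>The recursion starts with scalar 0 and the atom of P, which is the unit.\<close>

lemma comb_val_bound:
  assumes "L \<in> combs J" "0 \<le> M" "\<And>p. p \<in> P \<Longrightarrow> cmod (comb_fun L p) \<le> M"
  shows "nrm A (comb_val A E L) \<le> M"
  using comb_val_cut_bound[OF assms(1) top_mem, of "[]" M 0] assms
  by (simp add: smult_zero E_top)

lemma comb_val_bound_minus:
  assumes "L \<in> combs J" "M \<in> combs J" "0 \<le> e"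
    and "\<And>p. p \<in> P \<Longrightarrow> cmod (comb_fun L p - comb_fun M p) \<le> e"
  shows "nrm A (comb_val A E L \<ominus> comb_val A E M) \<le> e"
proof -
  have "nrm A (comb_val A E (L @ comb_mult [(-1, P)] M)) \<le> e"
    by (rule comb_val_bound) (use assms top_mem in \<open>auto simp: comb_fun_mult simp del: comb_mult_simps\<close>)
  then show ?thesis using assms by (simp only: comb_val_minus)
qed

end


section \<open>Multiplication operators and the left regular representation\<close>

lemma B_ell2_diff:
  assumes "S \<in> bounded_ops A" "T \<in> bounded_ops A" "\<xi> \<in> ell2 A"
  shows "(S \<ominus>\<^bsub>B_ell2 A\<^esub> T) \<xi> = (\<lambda>p. S \<xi> p - T \<xi> p)"
proof -
  interpret cstar_algebra "B_ell2 A" by (rule cstar_algebra_B_ell2)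
  have "S \<ominus>\<^bsub>B_ell2 A\<^esub> T = S \<oplus>\<^bsub>B_ell2 A\<^esub> (-1) \<odot>\<^bsub>B_ell2 A\<^esub> T"
    using assms by (simp add: minus_eq minus_smult B_ell2_simps(1))
  then show ?thesis using assms by (simp add: B_ell2_simps)
qed

lemma bounded_ops_closed:
  "\<one>\<^bsub>B_ell2 A\<^esub> \<in> bounded_ops A"
  "S \<in> bounded_ops A \<Longrightarrow> T \<in> bounded_ops A \<Longrightarrow> S \<otimes>\<^bsub>B_ell2 A\<^esub> T \<in> bounded_ops A"
proof -
  interpret cstar_algebra "B_ell2 A" by (rule cstar_algebra_B_ell2)
  show "\<one>\<^bsub>B_ell2 A\<^esub> \<in> bounded_ops A"
    "S \<in> bounded_ops A \<Longrightarrow> T \<in> bounded_ops A \<Longrightarrow> S \<otimes>\<^bsub>B_ell2 A\<^esub> T \<in> bounded_ops A"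
    using one_closed m_closed[of S T] unfolding B_ell2_simps(1) by simp_all
qed

definition mult_op :: "'g set \<Rightarrow> ('g \<Rightarrow> complex) \<Rightarrow> ('g \<Rightarrow> complex) \<Rightarrow> ('g \<Rightarrow> complex)" where
  "mult_op A g = (\<lambda>\<xi>\<in>ell2 A. \<lambda>p. g p * \<xi> p)"

definition bounded_fun :: "'g set \<Rightarrow> ('g \<Rightarrow> complex) \<Rightarrow> bool" where
  "bounded_fun A g \<longleftrightarrow> (\<exists>M\<ge>0. \<forall>p\<in>A. cmod (g p) \<le> M)"

lemma mult_op_cong:
  assumes "\<And>p. p \<in> A \<Longrightarrow> g p = h p"
  shows "mult_op A g = mult_op A h"
  unfolding mult_op_def
proof (intro restrict_ext ext)
  fix \<xi> p assume "\<xi> \<in> ell2 A"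
  then show "g p * \<xi> p = h p * \<xi> p" using assms[of p] ell2D[of \<xi> A p] by (cases "p \<in> A") auto
qed

lemma
  assumes g: "\<And>p. p \<in> A \<Longrightarrow> cmod (g p) \<le> M" "0 \<le> M" and \<xi>: "\<xi> \<in> ell2 A"
  shows mult_on_ell2: "(\<lambda>p. g p * \<xi> p) \<in> ell2 A"
    and mult_on_ell2_norm: "ell2_norm (\<lambda>p. g p * \<xi> p) \<le> M * ell2_norm \<xi>"
proof -
  have *: "(\<lambda>p. g p * \<xi> p) = (\<lambda>p. (if p \<in> A then g p else 0) * \<xi> p)"
    using ell2D[OF \<xi>] by auto
  show "(\<lambda>p. g p * \<xi> p) \<in> ell2 A" "ell2_norm (\<lambda>p. g p * \<xi> p) \<le> M * ell2_norm \<xi>"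
    unfolding * using g \<xi> by (auto intro!: ell2_mult[where M = M] ell2_norm_mult)
qed

lemma mult_op_bounded:
  assumes "bounded_fun A g"
  shows "mult_op A g \<in> bounded_ops A"
proof -
  obtain M where M: "M \<ge> 0" "\<And>p. p \<in> A \<Longrightarrow> cmod (g p) \<le> M" using assms by (auto simp: bounded_fun_def)
  show ?thesis
    unfolding mult_op_def
  proof (rule bounded_opsI)
    fix \<xi> assume "\<xi> \<in> ell2 A"
    then show "(\<lambda>p. g p * \<xi> p) \<in> ell2 A" "ell2_norm (\<lambda>p. g p * \<xi> p) \<le> M * ell2_norm \<xi>"
      using M mult_on_ell2 mult_on_ell2_norm by blast+
  qed (simp_all add: algebra_simps)
qed

lemma mult_op_adjoint:
  assumes g: "bounded_fun A g"
  shows "op_adjoint A (mult_op A g) = mult_op A (\<lambda>p. cnj (g p))"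
proof (rule op_adjoint_unique)
  show "mult_op A g \<in> bounded_ops A" "mult_op A (\<lambda>p. cnj (g p)) \<in> bounded_ops A"
    using g by (auto intro!: mult_op_bounded simp: bounded_fun_def)
  fix \<xi> \<eta> assume "\<xi> \<in> ell2 A" "\<eta> \<in> ell2 A"
  then show "ell2_inner (mult_op A g \<xi>) \<eta> = ell2_inner \<xi> (mult_op A (\<lambda>p. cnj (g p)) \<eta>)"
    by (simp add: mult_op_def ell2_inner_def mult_ac)
qed

lemma mult_op_simps:
  "mult_op A g \<oplus>\<^bsub>B_ell2 A\<^esub> mult_op A h = mult_op A (\<lambda>p. g p + h p)"
  "c \<odot>\<^bsub>B_ell2 A\<^esub> mult_op A g = mult_op A (\<lambda>p. c * g p)"
  "\<one>\<^bsub>B_ell2 A\<^esub> = mult_op A (\<lambda>p. 1)"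
  "\<zero>\<^bsub>B_ell2 A\<^esub> = mult_op A (\<lambda>p. 0)"
  by (auto simp: B_ell2_simps mult_op_def algebra_simps intro!: restrict_ext)

lemma mult_op_mult:
  assumes "bounded_fun A h"
  shows "mult_op A g \<otimes>\<^bsub>B_ell2 A\<^esub> mult_op A h = mult_op A (\<lambda>p. g p * h p)"
proof -
  have "(\<lambda>p. h p * \<xi> p) \<in> ell2 A" if "\<xi> \<in> ell2 A" for \<xi>
    using assms that mult_on_ell2 by (fastforce simp: bounded_fun_def)
  then show ?thesis by (auto simp: B_ell2_simps mult_op_def mult_ac intro!: restrict_ext)
qed

text \<open>The diagonal matrix coefficient. It recovers the function from a multiplication operator
  and makes sense for every operator, in particular for norm limits.\<close>

definition symbol :: "(('g \<Rightarrow> complex) \<Rightarrow> ('g \<Rightarrow> complex)) \<Rightarrow> 'g \<Rightarrow> complex" where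
  "symbol T p = T (delta p) p"

lemma symbol_mult_op: "p \<in> A \<Longrightarrow> symbol (mult_op A g) p = g p"
  by (simp add: symbol_def mult_op_def delta_ell2) (simp add: delta_def)

lemma cmod_le_op_norm:
  assumes T: "T \<in> bounded_ops A" and "B \<subseteq> A" "p \<in> B"
  shows "cmod (symbol T p) \<le> op_norm_on B T"
proof -
  have "cmod (T (delta p) p) \<le> ell2_norm (T (delta p))"
    using T assms delta_ell2(1)[of p A] by (intro cmod_le_ell2_norm[of _ A]) auto
  also have "\<dots> \<le> op_norm_on B T * ell2_norm (delta p)"
    using T assms by (intro ell2_norm_le_op_norm[of _ A] delta_ell2) auto
  finally show ?thesis by (simp add: delta_ell2 symbol_def)
qed

section \<open>Elements of \<open>D_r\<close> as functions on P\<close>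

lemma indicator_op_eq: "indicator_op A S = mult_op A (indicator S)"
  by (simp add: indicator_op_def mult_op_def)

lemma comb_fun_eq:
  "comb_fun [] = (\<lambda>p. 0)" "comb_fun ((c, S) # L) = (\<lambda>p. c * indicator S p + comb_fun L p)"
  by (simp_all add: fun_eq_iff)

lemma bounded_fun_comb: "bounded_fun A (comb_fun L)"
proof (induction L)
  case Nil
  then show ?case by (auto simp: bounded_fun_def)
next
  case (Cons x L)
  obtain c S where x: "x = (c, S)" by (cases x)
  obtain M where M: "M \<ge> 0" "\<forall>p\<in>A. cmod (comb_fun L p) \<le> M" using Cons by (auto simp: bounded_fun_def)
  have "cmod (comb_fun (x # L) p) \<le> cmod c + M" if "p \<in> A" for p
    using norm_triangle_ineq[of "c * indicator S p" "comb_fun L p"] M that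
    by (auto simp: x norm_mult indicator_def intro: order_trans)
  then show ?case using M by (auto simp: bounded_fun_def intro!: exI[of _ "cmod c + M"])
qed

lemma bounded_fun_indicator: "bounded_fun A (indicator S)"
  by (auto simp: bounded_fun_def indicator_def intro!: exI[of _ 1])

text \<open>The uniform closure on P of the span of the indicators: these are the functions by which
  elements of \<open>D_r\<close> multiply.\<close>

definition comb_approx :: "'g set set \<Rightarrow> 'g set \<Rightarrow> ('g \<Rightarrow> complex) \<Rightarrow> bool" where
  "comb_approx J P g \<longleftrightarrow> (\<forall>e>0. \<exists>L\<in>combs J. \<forall>p\<in>P. cmod (g p - comb_fun L p) < e)"

lemma comb_approx_bounded:
  assumes "comb_approx J P g"
  shows "bounded_fun P g"
proof -
  obtain L where L: "\<forall>p\<in>P. cmod (g p - comb_fun L p) < 1"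
    using assms zero_less_one unfolding comb_approx_def by blast
  obtain M where M: "M \<ge> 0" "\<forall>p\<in>P. cmod (comb_fun L p) \<le> M"
    using bounded_fun_comb[of P L] by (auto simp: bounded_fun_def)
  have "cmod (g p) \<le> 1 + M" if "p \<in> P" for p
    using norm_triangle_ineq[of "g p - comb_fun L p" "comb_fun L p"] L M that by fastforce
  then show ?thesis using M by (auto simp: bounded_fun_def intro!: exI[of _ "1 + M"])
qed

lemma scale_combs_simple: "L \<in> combs J \<Longrightarrow> map (\<lambda>(d, T). (c * d, T)) L \<in> combs J"
  by (induction L) auto

lemma comb_fun_scale_simple: "comb_fun (map (\<lambda>(d, T). (c * d, T)) L) p = c * comb_fun L p"
  by (induction L) (auto simp: algebra_simps)

definition approx_ops :: "'g set set \<Rightarrow> 'g set \<Rightarrow> (('g \<Rightarrow> complex) \<Rightarrow> ('g \<Rightarrow> complex)) set" where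
  "approx_ops J P = mult_op P ` {g. comb_approx J P g}"

lemma comb_approx_comb: "L \<in> combs J \<Longrightarrow> comb_approx J P (comb_fun L)"
  unfolding comb_approx_def by (auto intro!: bexI[of _ L])

lemma comb_approx_add:
  assumes "comb_approx J P g" "comb_approx J P h"
  shows "comb_approx J P (\<lambda>p. g p + h p)"
  unfolding comb_approx_def
proof (intro allI impI)
  fix e :: real assume "e > 0"
  then have "e / 2 > 0" by simp
  then obtain L M where L: "L \<in> combs J" "\<forall>p\<in>P. cmod (g p - comb_fun L p) < e / 2"
    and M: "M \<in> combs J" "\<forall>p\<in>P. cmod (h p - comb_fun M p) < e / 2"
    using assms unfolding comb_approx_def by meson
  have "cmod (g p + h p - comb_fun (L @ M) p) < e" if "p \<in> P" for p
    using norm_triangle_ineq[of "g p - comb_fun L p" "h p - comb_fun M p"] L M that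
    by (fastforce simp: algebra_simps)
  then show "\<exists>L\<in>combs J. \<forall>p\<in>P. cmod (g p + h p - comb_fun L p) < e"
    using L M by (intro bexI[of _ "L @ M"]) auto
qed

lemma comb_approx_scale:
  assumes "comb_approx J P g"
  shows "comb_approx J P (\<lambda>p. c * g p)"
  unfolding comb_approx_def
proof (intro allI impI)
  fix e :: real assume "e > 0"
  then have "e / (cmod c + 1) > 0" by (simp add: add_nonneg_pos)
  then obtain L where L: "L \<in> combs J" "\<forall>p\<in>P. cmod (g p - comb_fun L p) < e / (cmod c + 1)"
    using assms unfolding comb_approx_def by meson
  have "cmod (c * g p - c * comb_fun L p) < e" if "p \<in> P" for p
  proof -
    have "cmod (c * g p - c * comb_fun L p) = cmod c * cmod (g p - comb_fun L p)"
      by (simp flip: norm_mult add: algebra_simps)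
    also have "\<dots> \<le> cmod c * (e / (cmod c + 1))"
      using L that by (intro mult_left_mono) (auto intro: less_imp_le)
    also have "\<dots> = e * cmod c / (cmod c + 1)" by simp
    also have "\<dots> < e"
      using \<open>e > 0\<close> by (subst pos_divide_less_eq) (simp_all add: add_nonneg_pos algebra_simps add_pos_nonneg)
    finally show ?thesis .
  qed
  then show "\<exists>L\<in>combs J. \<forall>p\<in>P. cmod (c * g p - comb_fun L p) < e"
    using L by (intro bexI[of _ "map (\<lambda>(d, T). (c * d, T)) L"])
      (auto simp: comb_fun_scale_simple scale_combs_simple)
qed

text \<open>\<open>D_r\<close> is the smallest closed subspace containing the indicators, so one
  closed subspace of multiplication operators containing them describes the form of all its
  elements. The point is closedness: the symbol of a norm limit x is a uniform limit of functions,
  and x turns out to be multiplication by it.\<close>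

lemma closed_subspace_approx_ops: "closed_subspace (B_ell2 P) (approx_ops J P)"
  unfolding closed_subspace_def
proof (intro conjI ballI allI impI)
  have B: "mult_op P g \<in> bounded_ops P" if "comb_approx J P g" for g
    using that by (intro mult_op_bounded comb_approx_bounded)
  then show "approx_ops J P \<subseteq> carrier (B_ell2 P)" by (auto simp: approx_ops_def B_ell2_simps)
  show "\<zero>\<^bsub>B_ell2 P\<^esub> \<in> approx_ops J P"
    using comb_approx_comb[of "[]" J P] by (simp add: mult_op_simps approx_ops_def comb_fun_eq)
  fix x assume "x \<in> approx_ops J P"
  then obtain g where g: "x = mult_op P g" "comb_approx J P g" by (auto simp: approx_ops_def)
  then show "c \<odot>\<^bsub>B_ell2 P\<^esub> x \<in> approx_ops J P" for c
    by (simp add: mult_op_simps approx_ops_def comb_approx_scale)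
  fix y assume "y \<in> approx_ops J P"
  then obtain h where "y = mult_op P h" "comb_approx J P h" by (auto simp: approx_ops_def)
  then show "x \<oplus>\<^bsub>B_ell2 P\<^esub> y \<in> approx_ops J P"
    using g by (simp add: mult_op_simps approx_ops_def comb_approx_add)
next
  fix x assume x: "x \<in> carrier (B_ell2 P)"
    and lim: "\<forall>e>0. \<exists>v\<in>approx_ops J P. nrm (B_ell2 P) (x \<ominus>\<^bsub>B_ell2 P\<^esub> v) < e"
  interpret cstar_algebra "B_ell2 P" by (rule cstar_algebra_B_ell2)
  have xB: "x \<in> bounded_ops P" using x by (simp add: B_ell2_simps)
  have ex: "\<exists>h. comb_approx J P h \<and> (\<forall>\<xi>\<in>ell2 P. \<forall>p. cmod (x \<xi> p - h p * \<xi> p) \<le> e * ell2_norm \<xi>)" if "e > 0" for e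
  proof -
    obtain h where h: "comb_approx J P h" "nrm (B_ell2 P) (x \<ominus>\<^bsub>B_ell2 P\<^esub> mult_op P h) < e"
      using lim \<open>e > 0\<close> by (auto simp: approx_ops_def)
    let ?d = "x \<ominus>\<^bsub>B_ell2 P\<^esub> mult_op P h"
    have hB: "mult_op P h \<in> bounded_ops P" using h by (intro mult_op_bounded comb_approx_bounded)
    then have d: "?d \<in> bounded_ops P" using xB minus_closed[of x "mult_op P h"] by (simp add: B_ell2_simps)
    have "cmod (x \<xi> p - h p * \<xi> p) \<le> e * ell2_norm \<xi>" if \<xi>: "\<xi> \<in> ell2 P" for \<xi> p
    proof -
      have "cmod (x \<xi> p - h p * \<xi> p) = cmod (?d \<xi> p)"
        using \<xi> by (simp add: B_ell2_diff[OF xB hB \<xi>]) (simp add: mult_op_def)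
      also have "\<dots> \<le> ell2_norm (?d \<xi>)" using d \<xi> by (intro cmod_le_ell2_norm[of _ P]) auto
      also have "\<dots> \<le> op_norm_on P ?d * ell2_norm \<xi>" using d \<xi> by (intro ell2_norm_le_op_norm[of _ P]) auto
      also have "\<dots> \<le> e * ell2_norm \<xi>" using h by (intro mult_right_mono) (auto simp: B_ell2_simps(8))
      finally show ?thesis .
    qed
    then show ?thesis using h by blast
  qed
  have sym: "cmod (symbol x p - h p) \<le> e"
    if h: "\<forall>\<xi>\<in>ell2 P. \<forall>p. cmod (x \<xi> p - h p * \<xi> p) \<le> e * ell2_norm \<xi>" "p \<in> P" for h e p
    using h(1)[rule_format, OF delta_ell2(1)[OF h(2)], of p] by (simp add: symbol_def delta_ell2) (simp add: delta_def)
  have "comb_approx J P (symbol x)"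
    unfolding comb_approx_def
  proof (intro allI impI)
    fix e :: real assume "e > 0"
    then obtain h where h: "comb_approx J P h" "\<forall>\<xi>\<in>ell2 P. \<forall>p. cmod (x \<xi> p - h p * \<xi> p) \<le> e / 2 * ell2_norm \<xi>"
      using ex half_gt_zero by blast
    then obtain L where L: "L \<in> combs J" "\<forall>p\<in>P. cmod (h p - comb_fun L p) < e / 2"
      using half_gt_zero[OF \<open>e > 0\<close>] unfolding comb_approx_def by blast
    have "cmod (symbol x p - comb_fun L p) < e" if "p \<in> P" for p
    proof -
      have "cmod (symbol x p - comb_fun L p) \<le> cmod (symbol x p - h p) + cmod (h p - comb_fun L p)"
        using norm_triangle_ineq[of "symbol x p - h p" "h p - comb_fun L p"] by simp
      also have "\<dots> < e / 2 + e / 2" using sym[OF h(2) that] L(2) that by (intro add_le_less_mono) auto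
      finally show ?thesis by simp
    qed
    then show "\<exists>L\<in>combs J. \<forall>p\<in>P. cmod (symbol x p - comb_fun L p) < e" using L by blast
  qed
  moreover have "x = mult_op P (symbol x)"
  proof (rule bounded_ops_eqI[OF xB])
    show "mult_op P (symbol x) \<in> bounded_ops P"
      using calculation by (intro mult_op_bounded comb_approx_bounded)
    fix \<xi> assume \<xi>: "\<xi> \<in> ell2 P"
    have "x \<xi> p = symbol x p * \<xi> p" for p
    proof (cases "p \<in> P")
      case False
      then show ?thesis using ell2D[OF \<xi>] ell2D[OF bounded_ops_ell2[OF xB \<xi>]] by simp
    next
      case True
      \<comment> \<open>Replacing x by a nearby multiplication operator costs an error proportional
        to \<open>ell2_norm \<xi>\<close>, replacing its function by \<open>symbol x\<close> one
        proportional to \<open>cmod (\<xi> p)\<close>; the summand 1 keeps K positive.\<close>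
      let ?K = "ell2_norm \<xi> + cmod (\<xi> p) + 1"
      have K: "?K > 0" by (simp add: add_nonneg_pos)
      have "cmod (x \<xi> p - symbol x p * \<xi> p) \<le> 0 + e" if "e > 0" for e
      proof -
        have e: "e / ?K > 0" using that K by simp
        obtain h where h: "\<forall>\<xi>\<in>ell2 P. \<forall>p. cmod (x \<xi> p - h p * \<xi> p) \<le> e / ?K * ell2_norm \<xi>"
          using ex[OF e] by blast
        have "cmod (x \<xi> p - symbol x p * \<xi> p) \<le> cmod (x \<xi> p - h p * \<xi> p) + cmod ((h p - symbol x p) * \<xi> p)"
          using norm_triangle_ineq[of "x \<xi> p - h p * \<xi> p" "(h p - symbol x p) * \<xi> p"] by (simp add: algebra_simps)
        also have "\<dots> \<le> e / ?K * ell2_norm \<xi> + e / ?K * cmod (\<xi> p)"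
          unfolding norm_mult using h \<xi> sym[OF h True]
          by (intro add_mono mult_right_mono) (auto simp: norm_minus_commute)
        also have "\<dots> \<le> e / ?K * ?K"
          unfolding distrib_left[symmetric] using e by (intro mult_left_mono) auto
        finally show ?thesis using K by simp
      qed
      then have "cmod (x \<xi> p - symbol x p * \<xi> p) \<le> 0" by (rule field_le_epsilon)
      then show ?thesis by simp
    qed
    then show "x \<xi> = mult_op P (symbol x) \<xi>" using \<xi> by (auto simp: mult_op_def)
  qed
  ultimately show "x \<in> approx_ops J P" by (auto simp: approx_ops_def)
qed

lemma D_r_carrier_subset: "carrier (D_r G P) \<subseteq> approx_ops (constructible G P) P"
proof -
  have "indicator_op P S \<in> approx_ops (constructible G P) P" if "S \<in> constructible G P" for S
  proof -
    have "comb_fun [(1, S)] = indicator S" by (auto simp: fun_eq_iff)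
    then show ?thesis
      using comb_approx_comb[of "[(1, S)]" "constructible G P" P] that
      by (simp add: approx_ops_def indicator_op_eq)
  qed
  then show ?thesis
    using closed_subspace_approx_ops[of P "constructible G P"] by (auto simp: D_r_def closed_span_def)
qed

lemma D_r_elem:
  assumes "T \<in> carrier (D_r G P)"
  shows "T = mult_op P (symbol T)" "comb_approx (constructible G P) P (symbol T)" "T \<in> bounded_ops P"
proof -
  obtain g where g: "T = mult_op P g" "comb_approx (constructible G P) P g"
    using D_r_carrier_subset[of G P] assms by (auto simp: approx_ops_def)
  then have s: "symbol T p = g p" if "p \<in> P" for p using that symbol_mult_op by simp
  show "T = mult_op P (symbol T)" unfolding g(1) by (rule mult_op_cong) (simp add: s flip: g(1))
  show "comb_approx (constructible G P) P (symbol T)"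
    using g(2) s unfolding comb_approx_def by simp
  show "T \<in> bounded_ops P" unfolding g(1) by (rule mult_op_bounded[OF comb_approx_bounded[OF g(2)]])
qed

lemma D_r_simps:
  "x \<otimes>\<^bsub>D_r G P\<^esub> y = x \<otimes>\<^bsub>B_ell2 P\<^esub> y" "x \<oplus>\<^bsub>D_r G P\<^esub> y = x \<oplus>\<^bsub>B_ell2 P\<^esub> y"
  "c \<odot>\<^bsub>D_r G P\<^esub> x = c \<odot>\<^bsub>B_ell2 P\<^esub> x" "\<one>\<^bsub>D_r G P\<^esub> = \<one>\<^bsub>B_ell2 P\<^esub>"
  "\<zero>\<^bsub>D_r G P\<^esub> = \<zero>\<^bsub>B_ell2 P\<^esub>" "adj (D_r G P) x = adj (B_ell2 P) x"
  by (simp_all add: D_r_def)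

lemma indicator_op_D_r: "S \<in> constructible G P \<Longrightarrow> indicator_op P S \<in> carrier (D_r G P)"
  by (auto simp: D_r_def closed_span_def)

lemma D_r_closed:
  "\<zero>\<^bsub>B_ell2 P\<^esub> \<in> carrier (D_r G P)"
  "x \<in> carrier (D_r G P) \<Longrightarrow> y \<in> carrier (D_r G P) \<Longrightarrow> x \<oplus>\<^bsub>B_ell2 P\<^esub> y \<in> carrier (D_r G P)"
  "x \<in> carrier (D_r G P) \<Longrightarrow> c \<odot>\<^bsub>B_ell2 P\<^esub> x \<in> carrier (D_r G P)"
  by (auto simp: D_r_def closed_span_def closed_subspace_def)

text \<open>Common form of the left translation operators and their adjoints: D = pP with
  \<open>inv p \<otimes> r\<close> for the former, D = P with \<open>p \<otimes> r\<close> for the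
  latter.\<close>

definition comp_op :: "'g set \<Rightarrow> 'g set \<Rightarrow> ('g \<Rightarrow> 'g) \<Rightarrow> ('g \<Rightarrow> complex) \<Rightarrow> ('g \<Rightarrow> complex)" where
  "comp_op P D f = (\<lambda>\<xi>\<in>ell2 P. \<lambda>r. if r \<in> D then \<xi> (f r) else 0)"

lemma comp_op_bounded:
  assumes "D \<subseteq> P" "inj_on f D"
  shows "comp_op P D f \<in> bounded_ops P"
proof -
  have le: "L2_on (\<lambda>r. if r \<in> D then \<xi> (f r) else 0) F \<le> 1 * ell2_norm \<xi>" if "finite F" "\<xi> \<in> ell2 P" for \<xi> F
  proof -
    have "(\<Sum>r\<in>F. (cmod (if r \<in> D then \<xi> (f r) else 0))\<^sup>2) = (\<Sum>r\<in>F \<inter> D. (cmod (\<xi> (f r)))\<^sup>2)"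
      using that by (intro sum.mono_neutral_cong_right) auto
    also have "\<dots> = (\<Sum>s\<in>f ` (F \<inter> D). (cmod (\<xi> s))\<^sup>2)"
      using assms by (subst sum.reindex) (auto intro: inj_on_subset)
    finally have "L2_on (\<lambda>r. if r \<in> D then \<xi> (f r) else 0) F = L2_on \<xi> (f ` (F \<inter> D))"
      by (simp add: L2_set_def)
    then show ?thesis using that by (simp add: L2_on_le_ell2_norm)
  qed
  show ?thesis
    unfolding comp_op_def
  proof (rule bounded_opsI)
    fix \<xi> assume \<xi>: "\<xi> \<in> ell2 P"
    show "(\<lambda>r. if r \<in> D then \<xi> (f r) else 0) \<in> ell2 P"
      using assms by (intro ell2I[OF _ le[OF _ \<xi>]]) auto
    show "ell2_norm (\<lambda>r. if r \<in> D then \<xi> (f r) else 0) \<le> 1 * ell2_norm \<xi>"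
      using assms by (intro ell2_norm_leI[of P, OF _ le[OF _ \<xi>]]) auto
  qed auto
qed

text \<open>Substituting the bijection f turns the sum over D that defines one inner product into
  the sum over D' that defines the other.\<close>

lemma comp_op_adjoint:
  assumes "D \<subseteq> P" "D' \<subseteq> P" "bij_betw f D D'" and g: "\<And>r. r \<in> D \<Longrightarrow> g (f r) = r"
  shows "op_adjoint P (comp_op P D f) = comp_op P D' g"
proof (rule op_adjoint_unique)
  have "inj_on g D'"
    using assms by (auto simp: inj_on_def bij_betw_def)
  then show "comp_op P D f \<in> bounded_ops P" "comp_op P D' g \<in> bounded_ops P"
    using assms by (auto intro!: comp_op_bounded simp: bij_betw_def)
  fix \<xi> \<eta> assume *: "\<xi> \<in> ell2 P" "\<eta> \<in> ell2 P"
  have "ell2_inner (comp_op P D f \<xi>) \<eta> = (\<Sum>\<^sub>\<infinity>r\<in>D. cnj (\<xi> (f r)) * \<eta> (g (f r)))"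
    unfolding ell2_inner_def using * g by (intro infsum_cong_neutral) (auto simp: comp_op_def)
  also have "\<dots> = (\<Sum>\<^sub>\<infinity>s\<in>D'. cnj (\<xi> s) * \<eta> (g s))"
    by (rule infsum_reindex_bij_betw[OF assms(3)])
  also have "\<dots> = ell2_inner \<xi> (comp_op P D' g \<eta>)"
    unfolding ell2_inner_def using * by (intro infsum_cong_neutral) (auto simp: comp_op_def)
  finally show "ell2_inner (comp_op P D f \<xi>) \<eta> = ell2_inner \<xi> (comp_op P D' g \<eta>)" .
qed

lemma word_op_simps [simp]:
  "word_op B w [] = \<one>\<^bsub>B\<^esub>"
  "word_op B w ((p, q) # \<alpha>) = adj B (w p) \<otimes>\<^bsub>B\<^esub> (w q \<otimes>\<^bsub>B\<^esub> word_op B w \<alpha>)"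
  by (simp_all add: word_op_def)

section \<open>The left regular representation on words\<close>

context group_submonoid
begin

lemma left_reg_eq: "left_reg G P p = comp_op P (p <#\<^bsub>G\<^esub> P) (\<lambda>r. inv p \<otimes> r)"
  by (simp add: left_reg_def comp_op_def)

lemma coset_subset_P: "p \<in> P \<Longrightarrow> p <#\<^bsub>G\<^esub> P \<subseteq> P"
  by (auto simp: l_coset_def)

lemma left_reg_bounded: "p \<in> P \<Longrightarrow> left_reg G P p \<in> bounded_ops P"
  unfolding left_reg_eq using coset_subset_P
  by (intro comp_op_bounded) (auto simp: inj_on_def mem_coset_iff)

lemma left_reg_adjoint:
  assumes "p \<in> P"
  shows "op_adjoint P (left_reg G P p) = comp_op P P (\<lambda>r. p \<otimes> r)"
  unfolding left_reg_eq
proof (rule comp_op_adjoint)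
  show "bij_betw (\<lambda>r. inv p \<otimes> r) (p <#\<^bsub>G\<^esub> P) P"
    using assms by (intro bij_betw_byWitness[of _ "\<lambda>r. p \<otimes> r"])
      (auto simp: mem_coset_iff simp flip: m_assoc)
qed (use assms coset_subset_P in \<open>auto simp: mem_coset_iff simp flip: m_assoc\<close>)

text \<open>The operator of a word is its partial translation: the basis vector at s goes to the one
  at \<open>word_elt G \<alpha> \<otimes> s\<close> if s lies in K(\<alpha>), and to zero otherwise.
  Evaluation at r looks back at s, which accounts for the inverse.\<close>

lemma word_op_left_reg:
  assumes "\<alpha> \<in> words P"
  shows "word_op (B_ell2 P) (left_reg G P) \<alpha> \<in> bounded_ops P"
    and "\<xi> \<in> ell2 P \<Longrightarrow> word_op (B_ell2 P) (left_reg G P) \<alpha> \<xi> =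
      (\<lambda>r. if r \<in> P \<and> inv (word_elt G \<alpha>) \<otimes> r \<in> K_ideal G P \<alpha> then \<xi> (inv (word_elt G \<alpha>) \<otimes> r) else 0)"
proof -
  let ?W = "word_op (B_ell2 P) (left_reg G P)"
  have "?W \<alpha> \<in> bounded_ops P \<and> (\<forall>\<xi>\<in>ell2 P. ?W \<alpha> \<xi> =
      (\<lambda>r. if r \<in> P \<and> inv (word_elt G \<alpha>) \<otimes> r \<in> K_ideal G P \<alpha> then \<xi> (inv (word_elt G \<alpha>) \<otimes> r) else 0))"
    using assms
  proof (induction \<alpha>)
    case Nil
    have "?W [] \<in> bounded_ops P" using bounded_ops_closed(1) by simp
    moreover have "?W [] \<xi> = (\<lambda>r. if r \<in> P then \<xi> r else 0)" if "\<xi> \<in> ell2 P" for \<xi>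
      using that by (auto simp: B_ell2_simps(3) ell2D)
    ultimately show ?case by (auto simp: fun_eq_iff simp del: word_op_simps)
  next
    case (Cons x \<alpha>)
    obtain p q where x: "x = (p, q)" by (cases x)
    with Cons.prems have w: "p \<in> P" "q \<in> P" "\<alpha> \<in> words P" by auto
    have c: "op_adjoint P (left_reg G P p) \<in> bounded_ops P" "left_reg G P q \<in> bounded_ops P" "?W \<alpha> \<in> bounded_ops P"
      using w Cons.IH op_adjoint_bounded left_reg_bounded by auto
    then have "?W (x # \<alpha>) \<in> bounded_ops P"
      by (simp add: x B_ell2_simps(7) bounded_ops_closed)
    moreover have "?W (x # \<alpha>) \<xi> r =
        (if r \<in> P \<and> inv (word_elt G (x # \<alpha>)) \<otimes> r \<in> K_ideal G P (x # \<alpha>) then \<xi> (inv (word_elt G (x # \<alpha>)) \<otimes> r) else 0)"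
      if \<xi>: "\<xi> \<in> ell2 P" for \<xi> r
    proof -
      have W\<xi>: "?W \<alpha> \<xi> \<in> ell2 P" "left_reg G P q (?W \<alpha> \<xi>) \<in> ell2 P" using c \<xi> by auto
      have "?W (x # \<alpha>) \<xi> r = (if r \<in> P then if p \<otimes> r \<in> q <#\<^bsub>G\<^esub> P then ?W \<alpha> \<xi> (inv q \<otimes> (p \<otimes> r)) else 0 else 0)"
        using \<xi> W\<xi> by (simp add: x B_ell2_simps(2,7) left_reg_adjoint[OF w(1)] comp_op_def) (simp add: left_reg_eq comp_op_def W\<xi>)
      moreover have "(if r \<in> P then if p \<otimes> r \<in> q <#\<^bsub>G\<^esub> P then ?W \<alpha> \<xi> (inv q \<otimes> (p \<otimes> r)) else 0 else 0) =
        (if r \<in> P \<and> inv (word_elt G (x # \<alpha>)) \<otimes> r \<in> K_ideal G P (x # \<alpha>) then \<xi> (inv (word_elt G (x # \<alpha>)) \<otimes> r) else 0)"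
      proof (cases "r \<in> P")
        case True
        have e: "inv (word_elt G (x # \<alpha>)) \<otimes> r = inv (word_elt G \<alpha>) \<otimes> (inv q \<otimes> (p \<otimes> r))"
          using w True by (simp add: x inv_mult_group m_assoc)
        have "word_elt G (x # \<alpha>) \<otimes> (inv (word_elt G (x # \<alpha>)) \<otimes> r) = r"
          using Cons.prems True word_elt_closed[OF Cons.prems] by (simp del: word_elt_simps flip: m_assoc)
        moreover have "word_elt G \<alpha> \<otimes> (inv (word_elt G \<alpha>) \<otimes> (inv q \<otimes> (p \<otimes> r))) = inv q \<otimes> (p \<otimes> r)"
          using w True by (simp flip: m_assoc)
        ultimately have "inv (word_elt G (x # \<alpha>)) \<otimes> r \<in> K_ideal G P (x # \<alpha>) \<longleftrightarrow>
            inv q \<otimes> (p \<otimes> r) \<in> P \<and> inv (word_elt G \<alpha>) \<otimes> (inv q \<otimes> (p \<otimes> r)) \<in> K_ideal G P \<alpha>"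
          unfolding mem_K_ideal_Cons[OF Cons.prems] e using True word_elt_K_ideal[OF w(3)] by force
        then show ?thesis
          using Cons.IH[OF w(3)] \<xi> w True e by (auto simp: mem_coset_iff simp del: word_elt_simps)
      qed simp
      ultimately show ?thesis by simp
    qed
    ultimately show ?case by (auto simp: fun_eq_iff simp del: word_op_simps word_elt_simps)
  qed
  then show "?W \<alpha> \<in> bounded_ops P" "\<xi> \<in> ell2 P \<Longrightarrow> ?W \<alpha> \<xi> =
      (\<lambda>r. if r \<in> P \<and> inv (word_elt G \<alpha>) \<otimes> r \<in> K_ideal G P \<alpha> then \<xi> (inv (word_elt G \<alpha>) \<otimes> r) else 0)"
    by auto
qed

lemma word_op_left_reg_neutral:
  assumes "\<alpha> \<in> neutral_words G P"
  shows "word_op (B_ell2 P) (left_reg G P) \<alpha> = indicator_op P (K_ideal G P \<alpha>)"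
proof (rule bounded_ops_eqI)
  show "indicator_op P (K_ideal G P \<alpha>) \<in> bounded_ops P"
    unfolding indicator_op_eq by (intro mult_op_bounded bounded_fun_indicator)
  fix \<xi> assume \<xi>: "\<xi> \<in> ell2 P"
  show "word_op (B_ell2 P) (left_reg G P) \<alpha> \<xi> = indicator_op P (K_ideal G P \<alpha>) \<xi>"
    using word_op_left_reg(2)[OF _ \<xi>, of \<alpha>] assms \<xi> K_ideal_subset[of \<alpha>]
    by (auto simp: neutral_wordsD indicator_op_def fun_eq_iff indicator_def)
qed (intro word_op_left_reg(1) neutral_wordsD(1) assms)

end


section \<open>Homomorphisms and strong covariance\<close>

context faithful_meet_rep
begin

text \<open>The graph of the homomorphism to be constructed: g and b are approximated by the same
  formal combinations, one uniformly on P, the other in norm. Working with the graph avoids choosing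
  approximants, and each algebraic rule becomes a closure property.\<close>

definition tracks :: "('b \<Rightarrow> complex) \<Rightarrow> 'a \<Rightarrow> bool" where
  "tracks g b \<longleftrightarrow> b \<in> carrier A \<and> (\<forall>e>0. \<exists>L\<in>combs J. (\<forall>p\<in>P. cmod (g p - comb_fun L p) < e) \<and>
     nrm A (b \<ominus> comb_val A E L) < e)"

lemma tracksD: "tracks g b \<Longrightarrow> b \<in> carrier A"
  by (simp add: tracks_def)

lemma tracks_cong: "(\<And>p. p \<in> P \<Longrightarrow> g p = h p) \<Longrightarrow> tracks g b = tracks h b"
  by (simp add: tracks_def)

lemma nrm_self_minus [simp]: "x \<in> carrier A \<Longrightarrow> nrm A (x \<ominus> x) = 0"
  by (simp add: minus_eq r_neg)

lemma tracks_comb: "L \<in> combs J \<Longrightarrow> tracks (comb_fun L) (comb_val A E L)"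
  by (auto simp: tracks_def intro!: bexI[of _ L])

text \<open>Two combinations close to g are uniformly close to each other, hence by the norm
  estimate so are their values. All tolerances are e/4: two of them add up to e/2 in the function
  estimate, two more connect b and b' to the values.\<close>

lemma tracks_unique:
  assumes "tracks g b" "tracks g b'"
  shows "b = b'"
proof -
  have c: "b \<in> carrier A" "b' \<in> carrier A" using assms tracksD by auto
  have "nrm A (b \<ominus> b') \<le> 0 + e" if "e > 0" for e
  proof -
    have e: "e / 4 > 0" using that by simp
    obtain L where L: "L \<in> combs J" "\<forall>p\<in>P. cmod (g p - comb_fun L p) < e / 4" "nrm A (b \<ominus> comb_val A E L) < e / 4"
      using assms(1) e unfolding tracks_def by blast
    obtain M where M: "M \<in> combs J" "\<forall>p\<in>P. cmod (g p - comb_fun M p) < e / 4" "nrm A (b' \<ominus> comb_val A E M) < e / 4"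
      using assms(2) e unfolding tracks_def by blast
    have "cmod (comb_fun L p - comb_fun M p) \<le> e / 2" if "p \<in> P" for p
    proof -
      have "cmod (comb_fun L p - comb_fun M p) \<le> cmod (g p - comb_fun M p) + cmod (g p - comb_fun L p)"
        using norm_triangle_ineq4[of "g p - comb_fun M p" "g p - comb_fun L p"] by simp
      then show ?thesis using L(2) M(2) that by fastforce
    qed
    then have "nrm A (comb_val A E L \<ominus> comb_val A E M) \<le> e / 2"
      using L(1) M(1) \<open>e > 0\<close> by (intro comb_val_bound_minus) auto
    moreover have "nrm A (b \<ominus> b') \<le> nrm A (b \<ominus> comb_val A E L) + nrm A (comb_val A E L \<ominus> b')"
      using c L(1) by (intro nrm_tri) auto
    moreover have "nrm A (comb_val A E L \<ominus> b') \<le> nrm A (comb_val A E L \<ominus> comb_val A E M) + nrm A (comb_val A E M \<ominus> b')"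
      using c L(1) M(1) by (intro nrm_tri) auto
    moreover have "nrm A (comb_val A E M \<ominus> b') = nrm A (b' \<ominus> comb_val A E M)"
      using c M(1) by (intro nrm_minus) auto
    ultimately show ?thesis using L(3) M(3) by simp
  qed
  then have "nrm A (b \<ominus> b') \<le> 0" by (rule field_le_epsilon)
  then have "b \<ominus> b' = \<zero>" using nrm_nonneg[of "b \<ominus> b'"] nrm_eq_0[of "b \<ominus> b'"] c by simp
  then show ?thesis using c by (simp add: minus_eq add.inv_solve_right')
qed

text \<open>The norm estimate makes the values of approximating combinations a Cauchy sequence, and
  completeness provides b.\<close>

lemma tracks_exists:
  assumes "comb_approx J P g"
  shows "\<exists>b. tracks g b"
proof -
  have "\<exists>L. L \<in> combs J \<and> (\<forall>p\<in>P. cmod (g p - comb_fun L p) < inverse (real (Suc n)))" for n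
    using assms unfolding comb_approx_def by (meson inverse_positive_iff_positive of_nat_0_less_iff zero_less_Suc)
  then obtain L where L: "\<And>n. L n \<in> combs J" "\<And>n p. p \<in> P \<Longrightarrow> cmod (g p - comb_fun (L n) p) < inverse (real (Suc n))"
    by metis
  let ?v = "\<lambda>n. comb_val A E (L n)"
  have close: "nrm A (?v m \<ominus> ?v n) \<le> inverse (real (Suc m)) + inverse (real (Suc n))" for m n
  proof (rule comb_val_bound_minus)
    fix p assume p: "p \<in> P"
    have "cmod (comb_fun (L m) p - comb_fun (L n) p) \<le> cmod (g p - comb_fun (L n) p) + cmod (g p - comb_fun (L m) p)"
      using norm_triangle_ineq4[of "g p - comb_fun (L n) p" "g p - comb_fun (L m) p"] by simp
    then show "cmod (comb_fun (L m) p - comb_fun (L n) p) \<le> inverse (real (Suc m)) + inverse (real (Suc n))"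
      using L(2)[OF p, of m] L(2)[OF p, of n] by linarith
  qed (use L in auto)
  have small: "\<exists>N. \<forall>n\<ge>N. inverse (real (Suc n)) < e" if "e > 0" for e
  proof -
    have "eventually (\<lambda>n. inverse (real (Suc n)) < e) sequentially"
      using order_tendstoD(2)[OF LIMSEQ_inverse_real_of_nat that] .
    then show ?thesis by (simp add: eventually_sequentially)
  qed
  have "\<forall>e>0. \<exists>N. \<forall>m\<ge>N. \<forall>n\<ge>N. nrm A (?v m \<ominus> ?v n) < e"
  proof (intro allI impI)
    fix e :: real assume "e > 0"
    then obtain N where N: "\<forall>n\<ge>N. inverse (real (Suc n)) < e / 2" using small[of "e / 2"] by auto
    have "nrm A (?v m \<ominus> ?v n) < e" if "m \<ge> N" "n \<ge> N" for m n
      using close[of m n] N[rule_format, OF that(1)] N[rule_format, OF that(2)] by linarith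
    then show "\<exists>N. \<forall>m\<ge>N. \<forall>n\<ge>N. nrm A (?v m \<ominus> ?v n) < e" by blast
  qed
  moreover have "range ?v \<subseteq> carrier A" using L by auto
  ultimately obtain b where b: "b \<in> carrier A" "(\<lambda>n. nrm A (?v n \<ominus> b)) \<longlonglongrightarrow> 0"
    using complete[of ?v] by blast
  have "\<exists>L\<in>combs J. (\<forall>p\<in>P. cmod (g p - comb_fun L p) < e) \<and> nrm A (b \<ominus> comb_val A E L) < e" if e: "e > 0" for e
  proof -
    obtain N1 where N1: "\<forall>n\<ge>N1. inverse (real (Suc n)) < e" using small[OF e] by blast
    have "eventually (\<lambda>n. nrm A (?v n \<ominus> b) < e) sequentially"
      using order_tendstoD(2)[OF b(2) e] .
    then obtain N2 where N2: "\<forall>n\<ge>N2. nrm A (?v n \<ominus> b) < e" by (auto simp: eventually_sequentially)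
    let ?n = "max N1 N2"
    have "\<forall>p\<in>P. cmod (g p - comb_fun (L ?n) p) < e"
      using L(2)[of _ ?n] N1[rule_format, of ?n] by fastforce
    moreover have "nrm A (b \<ominus> ?v ?n) < e"
      using N2 nrm_minus[of b "?v ?n"] b L by simp
    ultimately show ?thesis using L(1) by blast
  qed
  then show ?thesis using b(1) unfolding tracks_def by blast
qed

lemma tracks_add:
  assumes "tracks g b" "tracks h c"
  shows "tracks (\<lambda>p. g p + h p) (b \<oplus> c)"
proof -
  have cl: "b \<in> carrier A" "c \<in> carrier A" using assms tracksD by auto
  have "\<exists>L\<in>combs J. (\<forall>p\<in>P. cmod (g p + h p - comb_fun L p) < e) \<and> nrm A (b \<oplus> c \<ominus> comb_val A E L) < e" if "e > 0" for e
  proof -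
    have e: "e / 2 > 0" using that by simp
    obtain L where L: "L \<in> combs J" "\<forall>p\<in>P. cmod (g p - comb_fun L p) < e / 2" "nrm A (b \<ominus> comb_val A E L) < e / 2"
      using assms(1) e unfolding tracks_def by blast
    obtain M where M: "M \<in> combs J" "\<forall>p\<in>P. cmod (h p - comb_fun M p) < e / 2" "nrm A (c \<ominus> comb_val A E M) < e / 2"
      using assms(2) e unfolding tracks_def by blast
    have "cmod (g p + h p - comb_fun (L @ M) p) < e" if "p \<in> P" for p
      using norm_triangle_ineq[of "g p - comb_fun L p" "h p - comb_fun M p"] L(2) M(2) that
      by (fastforce simp: algebra_simps)
    moreover have "b \<oplus> c \<ominus> comb_val A E (L @ M) = (b \<ominus> comb_val A E L) \<oplus> (c \<ominus> comb_val A E M)"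
      using cl L(1) M(1) by (simp add: comb_val_append minus_eq minus_add a_ac)
    then have "nrm A (b \<oplus> c \<ominus> comb_val A E (L @ M)) < e"
      using nrm_add[of "b \<ominus> comb_val A E L" "c \<ominus> comb_val A E M"] cl L M by simp
    ultimately show ?thesis using L(1) M(1) by (intro bexI[of _ "L @ M"]) auto
  qed
  then show ?thesis using cl unfolding tracks_def by simp
qed

lemma tracks_adj:
  assumes "tracks g b"
  shows "tracks (\<lambda>p. cnj (g p)) (adj A b)"
proof -
  have cl: "b \<in> carrier A" using assms tracksD by auto
  have "\<exists>L\<in>combs J. (\<forall>p\<in>P. cmod (cnj (g p) - comb_fun L p) < e) \<and> nrm A (adj A b \<ominus> comb_val A E L) < e" if e: "e > 0" for e
  proof -
    obtain L where L: "L \<in> combs J" "\<forall>p\<in>P. cmod (g p - comb_fun L p) < e" "nrm A (b \<ominus> comb_val A E L) < e"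
      using assms(1) e unfolding tracks_def by blast
    have "cmod (cnj (g p) - comb_fun (comb_cnj L) p) < e" if "p \<in> P" for p
      using L(2) that by (simp add: comb_fun_cnj flip: complex_cnj_diff)
    moreover have "adj A b \<ominus> comb_val A E (comb_cnj L) = adj A (b \<ominus> comb_val A E L)"
      using cl L(1) by (simp add: comb_val_cnj minus_eq minus_smult adj_add adj_smult adj_closed smult_closed)
    then have "nrm A (adj A b \<ominus> comb_val A E (comb_cnj L)) < e"
      using cl L nrm_adj by simp
    ultimately show ?thesis using L(1) by (intro bexI[of _ "comb_cnj L"]) auto
  qed
  then show ?thesis using cl adj_closed unfolding tracks_def by simp
qed

lemma tracks_imp_approx: "tracks g b \<Longrightarrow> comb_approx J P g"
  unfolding tracks_def comb_approx_def by blast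

text \<open>The factors must be approximated in turn: the tolerance for h and c depends on the size
  of the combination L already chosen for g and b.\<close>

lemma tracks_mult:
  assumes "tracks g b" "tracks h c"
  shows "tracks (\<lambda>p. g p * h p) (b \<otimes> c)"
proof -
  have cl: "b \<in> carrier A" "c \<in> carrier A" using assms tracksD by auto
  have "\<exists>L\<in>combs J. (\<forall>p\<in>P. cmod (g p * h p - comb_fun L p) < e) \<and> nrm A (b \<otimes> c \<ominus> comb_val A E L) < e" if "e > 0" for e
  proof -
    obtain H where H: "H \<ge> 0" "\<And>p. p \<in> P \<Longrightarrow> cmod (h p) \<le> H"
      using comb_approx_bounded[OF tracks_imp_approx[OF assms(2)]] by (auto simp: bounded_fun_def)
    define K where "K = H + nrm A c + 1"
    have K: "K > 0" "H \<le> K" "nrm A c \<le> K"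
      using H nrm_nonneg[OF cl(2)] by (auto simp: K_def)
    have "e / (2 * K) > 0" using K that by simp
    then obtain L where L: "L \<in> combs J" "\<And>p. p \<in> P \<Longrightarrow> cmod (g p - comb_fun L p) < e / (2 * K)"
        "nrm A (b \<ominus> comb_val A E L) < e / (2 * K)"
      using assms(1) unfolding tracks_def by blast
    let ?v = "comb_val A E L"
    obtain H' where H': "H' \<ge> 0" "\<And>p. p \<in> P \<Longrightarrow> cmod (comb_fun L p) \<le> H'"
      using bounded_fun_comb[of P L] by (auto simp: bounded_fun_def)
    define K' where "K' = H' + nrm A ?v + 1"
    have K': "K' > 0" "H' \<le> K'" "nrm A ?v \<le> K'"
      using H' nrm_nonneg[of ?v] L(1) by (auto simp: K'_def)
    have "e / (2 * K') > 0" using K' that by simp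
    then obtain M where M: "M \<in> combs J" "\<And>p. p \<in> P \<Longrightarrow> cmod (h p - comb_fun M p) < e / (2 * K')"
        "nrm A (c \<ominus> comb_val A E M) < e / (2 * K')"
      using assms(2) unfolding tracks_def by blast
    let ?u = "comb_val A E M"
    \<comment> \<open>Used once with absolute values at a point of P and once with norms in A; K and
      K' dominate both kinds of quantity.\<close>
    have bound: "x * y + x' * y' < e"
      if "0 \<le> x" "0 \<le> y" "0 \<le> x'" "0 \<le> y'" "x < e / (2 * K)" "y \<le> K" "x' \<le> K'" "y' < e / (2 * K')" for x y x' y'
    proof -
      have "x * y \<le> x * K" using that by (intro mult_left_mono) auto
      also have "\<dots> < e / 2" using that K by (simp add: field_simps)
      finally have 1: "x * y < e / 2" .
      have "x' * y' \<le> K' * y'" using that by (intro mult_right_mono) auto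
      also have "\<dots> < e / 2" using that K' by (simp add: field_simps)
      finally show ?thesis using 1 by simp
    qed
    have "cmod (g p * h p - comb_fun (comb_mult L M) p) < e" if p: "p \<in> P" for p
    proof -
      have "g p * h p - comb_fun (comb_mult L M) p =
          (g p - comb_fun L p) * h p + comb_fun L p * (h p - comb_fun M p)"
        by (simp add: comb_fun_mult algebra_simps)
      then have "cmod (g p * h p - comb_fun (comb_mult L M) p) \<le>
          cmod (g p - comb_fun L p) * cmod (h p) + cmod (comb_fun L p) * cmod (h p - comb_fun M p)"
        using norm_triangle_ineq[of "(g p - comb_fun L p) * h p" "comb_fun L p * (h p - comb_fun M p)"]
        by (simp add: norm_mult)
      also have "\<dots> < e"
        using H(2)[OF p] H'(2)[OF p] K K' by (intro bound L(2) M(2) p) auto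
      finally show ?thesis .
    qed
    moreover have "b \<otimes> c \<ominus> comb_val A E (comb_mult L M) = (b \<ominus> ?v) \<otimes> c \<oplus> ?v \<otimes> (c \<ominus> ?u)"
    proof -
      have "?v \<in> carrier A" "?u \<in> carrier A" using L M by auto
      then have "b \<otimes> c \<ominus> ?v \<otimes> ?u = (b \<ominus> ?v) \<otimes> c \<oplus> ?v \<otimes> (c \<ominus> ?u)"
        using cl by algebra
      then show ?thesis using L(1) M(1) by (simp add: comb_val_mult)
    qed
    then have "nrm A (b \<otimes> c \<ominus> comb_val A E (comb_mult L M)) \<le>
        nrm A (b \<ominus> ?v) * nrm A c + nrm A ?v * nrm A (c \<ominus> ?u)"
      using nrm_add[of "(b \<ominus> ?v) \<otimes> c" "?v \<otimes> (c \<ominus> ?u)"] nrm_mult[of "b \<ominus> ?v" c] nrm_mult[of ?v "c \<ominus> ?u"]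
        cl L(1) M(1) by simp
    moreover have "nrm A (b \<ominus> ?v) * nrm A c + nrm A ?v * nrm A (c \<ominus> ?u) < e"
      using K K' L M cl by (intro bound nrm_nonneg) auto
    ultimately show ?thesis
      using L(1) M(1) by (intro bexI[of _ "comb_mult L M"]) auto
  qed
  then show ?thesis using cl unfolding tracks_def by simp
qed

lemma tracks_scale:
  assumes "tracks g b"
  shows "tracks (\<lambda>p. c * g p) (c \<odot> b)"
proof -
  have b: "b \<in> carrier A" using assms by (rule tracksD)
  have "tracks (\<lambda>p. comb_fun [(c, P)] p * g p) (comb_val A E [(c, P)] \<otimes> b)"
    using top_mem by (intro tracks_mult tracks_comb assms) simp
  moreover have "comb_val A E [(c, P)] \<otimes> b = c \<odot> b"
    using b by (simp add: E_top smult_mult_left smult_closed)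
  ultimately have "tracks (\<lambda>p. comb_fun [(c, P)] p * g p) (c \<odot> b)" by simp
  then show ?thesis by (subst tracks_cong[of _ "\<lambda>p. comb_fun [(c, P)] p * g p"]) auto
qed

end

section \<open>Homomorphisms and word operators\<close>

lemma star_homD:
  assumes "star_hom A B \<phi>"
  shows "x \<in> carrier A \<Longrightarrow> \<phi> x \<in> carrier B"
    and "x \<in> carrier A \<Longrightarrow> y \<in> carrier A \<Longrightarrow> \<phi> (x \<oplus>\<^bsub>A\<^esub> y) = \<phi> x \<oplus>\<^bsub>B\<^esub> \<phi> y"
    and "x \<in> carrier A \<Longrightarrow> y \<in> carrier A \<Longrightarrow> \<phi> (x \<otimes>\<^bsub>A\<^esub> y) = \<phi> x \<otimes>\<^bsub>B\<^esub> \<phi> y"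
    and "x \<in> carrier A \<Longrightarrow> \<phi> (c \<odot>\<^bsub>A\<^esub> x) = c \<odot>\<^bsub>B\<^esub> \<phi> x"
    and "x \<in> carrier A \<Longrightarrow> \<phi> (adj A x) = adj B (\<phi> x)"
  using assms by (auto simp: star_hom_def)

context cstar_algebra
begin

lemma word_op_closed:
  assumes "w \<in> P \<rightarrow> carrier A"
  shows "\<alpha> \<in> words P \<Longrightarrow> word_op A w \<alpha> \<in> carrier A"
  using assms by (induction \<alpha>) (auto simp: words_def adj_closed Pi_iff)

lemma word_op_append:
  assumes "w \<in> P \<rightarrow> carrier A"
  shows "\<alpha> \<in> words P \<Longrightarrow> \<beta> \<in> words P \<Longrightarrow> word_op A w (\<alpha> @ \<beta>) = word_op A w \<alpha> \<otimes> word_op A w \<beta>"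
proof (induction \<alpha>)
  case Nil
  then show ?case using word_op_closed[OF assms, of \<beta>] by simp
next
  case (Cons x \<alpha>)
  then have "\<alpha> \<in> words P" by (simp add: words_def)
  moreover obtain p q where "x = (p, q)" "p \<in> P" "q \<in> P" using Cons.prems by (auto simp: words_def)
  ultimately show ?case
    using Cons word_op_closed[OF assms, of \<alpha>] word_op_closed[OF assms, of \<beta>] assms
    by (auto simp: adj_closed m_assoc Pi_iff)
qed

lemma word_op_rev:
  assumes "w \<in> P \<rightarrow> carrier A"
  shows "\<alpha> \<in> words P \<Longrightarrow> word_op A w (word_rev \<alpha>) = adj A (word_op A w \<alpha>)"
proof (induction \<alpha>)
  case Nil
  then show ?case by simp
next
  case (Cons x \<alpha>)
  then have \<alpha>: "\<alpha> \<in> words P" by (simp add: words_def)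
  obtain p q where x: "x = (p, q)" "p \<in> P" "q \<in> P" using Cons.prems by (auto simp: words_def)
  have "word_rev \<alpha> \<in> words P" "[(q, p)] \<in> words P" using \<alpha> x by (auto simp: words_def word_rev_def)
  then show ?case
    using Cons.IH[OF \<alpha>] word_op_closed[OF assms \<alpha>] assms x
    by (auto simp: word_op_append[OF assms] adj_mult adj_closed adj_adj m_assoc Pi_iff)
qed

lemma hom_word_op:
  assumes "star_hom A B \<phi>" "\<phi> \<one> = \<one>\<^bsub>B\<^esub>" "w \<in> P \<rightarrow> carrier A"
  shows "\<alpha> \<in> words P \<Longrightarrow> \<phi> (word_op A w \<alpha>) = word_op B (\<phi> \<circ> w) \<alpha>"
proof (induction \<alpha>)
  case Nil
  then show ?case using assms by simp
next
  case (Cons x \<alpha>)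
  then have \<alpha>: "\<alpha> \<in> words P" by (simp add: words_def)
  obtain p q where "x = (p, q)" "p \<in> P" "q \<in> P" using Cons.prems by (auto simp: words_def)
  then show ?case
    using Cons.IH[OF \<alpha>] word_op_closed[OF assms(3) \<alpha>] assms(3)
    by (simp add: star_homD[OF assms(1)] adj_closed Pi_iff)
qed

end

lemma hom_minus:
  assumes "cstar_algebra A" "cstar_algebra B" "star_hom A B \<phi>" "x \<in> carrier A" "y \<in> carrier A"
  shows "\<phi> (x \<ominus>\<^bsub>A\<^esub> y) = \<phi> x \<ominus>\<^bsub>B\<^esub> \<phi> y"
proof -
  interpret A: cstar_algebra A by fact
  interpret B: cstar_algebra B by fact
  show ?thesis using assms(4,5) star_homD[OF assms(3)]
    by (simp add: A.minus_eq B.minus_eq A.minus_smult B.minus_smult A.smult_closed)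
qed

text \<open>The element that distinguishes the two universal algebras: the product in (T4) with the
  empty word as \<alpha>, taken for words whose ideals need not cover P.\<close>

definition defect :: "'b cstar \<Rightarrow> ('g \<Rightarrow> 'b) \<Rightarrow> ('g \<times> 'g) list list \<Rightarrow> 'b" where
  "defect A w \<beta>s = foldr (\<lambda>\<beta> x. (\<one>\<^bsub>A\<^esub> \<ominus>\<^bsub>A\<^esub> word_op A w \<beta>) \<otimes>\<^bsub>A\<^esub> x) \<beta>s \<one>\<^bsub>A\<^esub>"

lemma defect_closed:
  assumes "cstar_algebra A" "w \<in> P \<rightarrow> carrier A" "set \<beta>s \<subseteq> words P"
  shows "defect A w \<beta>s \<in> carrier A"
proof -
  interpret A: cstar_algebra A by fact
  show ?thesis using assms(3) A.word_op_closed[OF assms(2)] by (induction \<beta>s) (auto simp: defect_def)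
qed

lemma hom_defect:
  assumes "cstar_algebra A" "cstar_algebra B" "star_hom A B \<phi>" "\<phi> \<one>\<^bsub>A\<^esub> = \<one>\<^bsub>B\<^esub>" "w \<in> P \<rightarrow> carrier A"
    and "set \<beta>s \<subseteq> words P"
  shows "\<phi> (defect A w \<beta>s) = defect B (\<phi> \<circ> w) \<beta>s"
proof -
  interpret A: cstar_algebra A by fact
  show ?thesis
    using assms(6)
  proof (induction \<beta>s)
    case Nil
    then show ?case using assms(4) by (simp add: defect_def)
  next
    case (Cons \<beta> \<beta>s)
    have "defect A w \<beta>s \<in> carrier A" using Cons.prems by (intro defect_closed[OF assms(1,5)]) auto
    moreover have "word_op A w \<beta> \<in> carrier A" using Cons.prems A.word_op_closed[OF assms(5)] by simp
    ultimately have "\<phi> ((\<one>\<^bsub>A\<^esub> \<ominus>\<^bsub>A\<^esub> word_op A w \<beta>) \<otimes>\<^bsub>A\<^esub> defect A w \<beta>s) =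
        (\<one>\<^bsub>B\<^esub> \<ominus>\<^bsub>B\<^esub> \<phi> (word_op A w \<beta>)) \<otimes>\<^bsub>B\<^esub> \<phi> (defect A w \<beta>s)"
      using assms(4) by (simp add: star_homD(3)[OF assms(3)] hom_minus[OF assms(1-3)])
    then show ?case
      using Cons A.hom_word_op[OF assms(3-5), of \<beta>] by (simp add: defect_def comp_def)
  qed
qed

section \<open>From homomorphisms on indicators to the Toeplitz relations\<close>

context group_submonoid
begin

abbreviation "\<J> \<equiv> constructible G P"

lemma defect_eq_comb_val:
  assumes "meet_rep B \<J> P E" "\<And>\<alpha>. \<alpha> \<in> neutral_words G P \<Longrightarrow> word_op B w \<alpha> = E (K_ideal G P \<alpha>)"
    and "set \<beta>s \<subseteq> neutral_words G P"
  shows "defect B w \<beta>s = comb_val B E (comb_diff P P (map (K_ideal G P) \<beta>s))"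
proof -
  interpret M: meet_rep B \<J> P E by fact
  have "set (map (K_ideal G P) \<beta>s) \<subseteq> \<J>" using assms(3) by (auto intro!: constructibleI neutral_wordsD)
  then have "comb_val B E (comb_diff P P (map (K_ideal G P) \<beta>s)) =
      foldr (\<lambda>T x. (E P \<ominus>\<^bsub>B\<^esub> E T) \<otimes>\<^bsub>B\<^esub> x) (map (K_ideal G P) \<beta>s) \<one>\<^bsub>B\<^esub>"
    using constructible_P by (rule M.comb_val_diff[rotated])
  also have "\<dots> = defect B w \<beta>s"
    unfolding defect_def foldr_map using assms(2,3)
    by (intro foldr_cong) (auto simp: M.E_top)
  finally show ?thesis by simp
qed

text \<open>Stated for an arbitrary carrier V containing the indicators because it is applied twice:
  to \<open>D_r\<close> for strongly covariant representations, and to the algebra generated by the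
  left regular representation.\<close>

lemma indicator_hom:
  assumes "cstar_algebra B" and D: "D = (B_ell2 P)\<lparr>carrier := V\<rparr>"
    and V: "\<And>S. S \<in> \<J> \<Longrightarrow> indicator_op P S \<in> V" "\<zero>\<^bsub>B_ell2 P\<^esub> \<in> V"
      "\<And>x y. x \<in> V \<Longrightarrow> y \<in> V \<Longrightarrow> x \<oplus>\<^bsub>B_ell2 P\<^esub> y \<in> V" "\<And>c x. x \<in> V \<Longrightarrow> c \<odot>\<^bsub>B_ell2 P\<^esub> x \<in> V"
    and \<phi>: "star_hom D B \<phi>" "\<phi> \<one>\<^bsub>B_ell2 P\<^esub> = \<one>\<^bsub>B\<^esub>"
  shows "meet_rep B \<J> P (\<phi> \<circ> indicator_op P)"
    and "L \<in> combs \<J> \<Longrightarrow> comb_val B (\<phi> \<circ> indicator_op P) L = \<phi> (mult_op P (comb_fun L))"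
    and "L \<in> combs \<J> \<Longrightarrow> mult_op P (comb_fun L) \<in> V"
    and "\<phi> \<zero>\<^bsub>B_ell2 P\<^esub> = \<zero>\<^bsub>B\<^esub>"
proof -
  interpret B: cstar_algebra B by fact
  interpret H: cstar_algebra "B_ell2 P" by (rule cstar_algebra_B_ell2)
  note h = star_homD[OF \<phi>(1), unfolded D, simplified]
  show "meet_rep B \<J> P (\<phi> \<circ> indicator_op P)"
  proof
    show "P \<in> \<J>" by (rule constructible_P)
    show "(\<phi> \<circ> indicator_op P) P = \<one>\<^bsub>B\<^esub>"
      unfolding \<phi>(2)[symmetric] o_def indicator_op_eq mult_op_simps
      by (rule arg_cong[where f = \<phi>]) (auto intro: mult_op_cong)
    fix S assume S: "S \<in> \<J>"
    show "S \<subseteq> P" using S by (rule constructible_subset)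
    show "(\<phi> \<circ> indicator_op P) S \<in> carrier B" using V(1)[OF S] h by simp
    have "op_adjoint P (indicator_op P S) = indicator_op P S"
      unfolding indicator_op_eq mult_op_adjoint[OF bounded_fun_indicator]
      by (rule mult_op_cong) (auto simp: indicator_def)
    then show "adj B ((\<phi> \<circ> indicator_op P) S) = (\<phi> \<circ> indicator_op P) S"
      using h(5)[OF V(1)[OF S]] by (simp add: B_ell2_simps)
    fix T assume T: "T \<in> \<J>"
    show "S \<inter> T \<in> \<J>" using S T by (rule constructible_Int)
    have "indicator_op P (S \<inter> T) = indicator_op P S \<otimes>\<^bsub>B_ell2 P\<^esub> indicator_op P T"
      unfolding indicator_op_eq mult_op_mult[OF bounded_fun_indicator]
      by (rule mult_op_cong) (simp add: indicator_inter_arith)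
    then show "(\<phi> \<circ> indicator_op P) (S \<inter> T) = (\<phi> \<circ> indicator_op P) S \<otimes>\<^bsub>B\<^esub> (\<phi> \<circ> indicator_op P) T"
      using h(3)[OF V(1)[OF S] V(1)[OF T]] by simp
  qed
  \<comment> \<open>Preservation of zero comes from homogeneity with scalar 0, as only the listed
    closure properties of V are available.\<close>
  have z: "\<phi> (0 \<odot>\<^bsub>B_ell2 P\<^esub> \<zero>\<^bsub>B_ell2 P\<^esub>) = 0 \<odot>\<^bsub>B\<^esub> \<phi> \<zero>\<^bsub>B_ell2 P\<^esub>" using h(4)[OF V(2)] .
  then show \<phi>0: "\<phi> \<zero>\<^bsub>B_ell2 P\<^esub> = \<zero>\<^bsub>B\<^esub>"
    using h(1)[OF V(2)] by (simp add: B.smult_zero)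
  have "comb_val B (\<phi> \<circ> indicator_op P) L = \<phi> (mult_op P (comb_fun L)) \<and> mult_op P (comb_fun L) \<in> V"
    if "L \<in> combs \<J>" using that
  proof (induction L)
    case Nil
    show ?case using \<phi>0 V(2) by (simp add: comb_fun_eq mult_op_simps(4))
  next
    case (Cons x L)
    obtain c S where x: "x = (c, S)" "S \<in> \<J>" "L \<in> combs \<J>" using Cons.prems by (cases x) auto
    have "mult_op P (comb_fun (x # L)) = c \<odot>\<^bsub>B_ell2 P\<^esub> indicator_op P S \<oplus>\<^bsub>B_ell2 P\<^esub> mult_op P (comb_fun L)"
      by (simp add: x comb_fun_eq mult_op_simps indicator_op_eq)
    then show ?case
      using Cons.IH[OF x(3)] V(1)[OF x(2)] V(3,4) h(2,4) by (simp add: x del: comb_fun_simps)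
  qed
  then show "L \<in> combs \<J> \<Longrightarrow> comb_val B (\<phi> \<circ> indicator_op P) L = \<phi> (mult_op P (comb_fun L))"
    "L \<in> combs \<J> \<Longrightarrow> mult_op P (comb_fun L) \<in> V" by auto
qed

text \<open>(T2) and (T4) both assert that a particular formal combination with zero function has
  zero value: a single indicator for (T2), \<open>comb_diff\<close> for (T4).\<close>

lemma toeplitz_relI:
  assumes "meet_rep B \<J> P E" and w1: "w \<one> = \<one>\<^bsub>B\<^esub>"
    and W: "\<And>\<alpha>. \<alpha> \<in> neutral_words G P \<Longrightarrow> word_op B w \<alpha> = E (K_ideal G P \<alpha>)"
    and faithful: "\<And>L. L \<in> combs \<J> \<Longrightarrow> (\<And>p. p \<in> P \<Longrightarrow> comb_fun L p = 0) \<Longrightarrow> comb_val B E L = \<zero>\<^bsub>B\<^esub>"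
  shows "toeplitz_rel G P B w"
  unfolding toeplitz_rel_def
proof (intro conjI ballI allI impI w1)
  interpret M: meet_rep B \<J> P E by fact
  note K = constructibleI[OF neutral_wordsD(1)]
  fix \<alpha> assume \<alpha>: "\<alpha> \<in> neutral_words G P"
  show "word_op B w \<alpha> = \<zero>\<^bsub>B\<^esub>" if "K_ideal G P \<alpha> = {}"
    using faithful[of "[(1, K_ideal G P \<alpha>)]"] that \<alpha> K[OF \<alpha>] W[OF \<alpha>] M.E_closed[OF K[OF \<alpha>]]
    by (simp add: M.smult_one)
  show "word_op B w \<alpha> = word_op B w \<beta>" if "\<beta> \<in> neutral_words G P" "K_ideal G P \<alpha> = K_ideal G P \<beta>" for \<beta>
    using W[OF \<alpha>] W that by simp
  fix \<beta>s assume \<beta>s: "\<beta>s \<noteq> [] \<and> distinct \<beta>s \<and> set \<beta>s \<subseteq> neutral_words G P \<and>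
        K_ideal G P \<alpha> = (\<Union>\<beta>\<in>set \<beta>s. K_ideal G P \<beta>)"
  let ?S = "K_ideal G P \<alpha>" and ?Ts = "map (K_ideal G P) \<beta>s"
  have Ts: "set ?Ts \<subseteq> \<J>" using \<beta>s K by auto
  have "foldr (\<lambda>\<beta> x. (word_op B w \<alpha> \<ominus>\<^bsub>B\<^esub> word_op B w \<beta>) \<otimes>\<^bsub>B\<^esub> x) \<beta>s \<one>\<^bsub>B\<^esub> =
      foldr (\<lambda>T x. (E ?S \<ominus>\<^bsub>B\<^esub> E T) \<otimes>\<^bsub>B\<^esub> x) ?Ts \<one>\<^bsub>B\<^esub>"
    unfolding foldr_map using W[OF \<alpha>] W \<beta>s by (intro foldr_cong) auto
  also have "\<dots> = comb_val B E (comb_diff P ?S ?Ts)"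
    using M.comb_val_diff[OF K[OF \<alpha>] Ts] by simp
  also have "\<dots> = \<zero>\<^bsub>B\<^esub>"
  proof (rule faithful)
    show "comb_diff P ?S ?Ts \<in> combs \<J>" using K[OF \<alpha>] Ts by (rule M.diff_combs)
    fix p assume "p \<in> P"
    have "\<exists>T\<in>set ?Ts. (indicator ?S p :: complex) - indicator T p = 0"
    proof (cases "p \<in> ?S")
      case True
      then obtain \<beta> where "\<beta> \<in> set \<beta>s" "p \<in> K_ideal G P \<beta>" using \<beta>s by blast
      then show ?thesis using True by (auto intro!: bexI[of _ \<beta>])
    next
      \<comment> \<open>Off K(\<alpha>) every factor is 0 - 0, so any member of the list serves;
        there is one because (T4) is imposed for nonempty F.\<close>
      case False
      obtain \<beta> where "\<beta> \<in> set \<beta>s" using \<beta>s by (cases \<beta>s) auto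
      then show ?thesis using False \<beta>s by (auto intro!: bexI[of _ \<beta>])
    qed
    then show "comb_fun (comb_diff P ?S ?Ts) p = 0"
      by (auto simp: comb_fun_diff prod_list_zero_iff)
  qed
  finally show "foldr (\<lambda>\<beta> x. (word_op B w \<alpha> \<ominus>\<^bsub>B\<^esub> word_op B w \<beta>) \<otimes>\<^bsub>B\<^esub> x) \<beta>s \<one>\<^bsub>B\<^esub> = \<zero>\<^bsub>B\<^esub>" .
qed

lemma strongly_covariantD:
  assumes "cstar_algebra B" "strongly_covariant G P B w"
  shows "\<exists>\<phi>. star_hom (D_r G P) B \<phi> \<and> (\<forall>b\<in>D_r_o G P. \<phi> b = \<zero>\<^bsub>B\<^esub>) \<and> meet_rep B \<J> P (\<phi> \<circ> indicator_op P) \<and>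
    (\<forall>\<alpha>\<in>neutral_words G P. word_op B w \<alpha> = (\<phi> \<circ> indicator_op P) (K_ideal G P \<alpha>)) \<and>
    (\<forall>L\<in>combs \<J>. comb_val B (\<phi> \<circ> indicator_op P) L = \<phi> (mult_op P (comb_fun L)) \<and>
       mult_op P (comb_fun L) \<in> carrier (D_r G P)) \<and> \<phi> \<zero>\<^bsub>B_ell2 P\<^esub> = \<zero>\<^bsub>B\<^esub>"
proof -
  obtain \<phi> where \<phi>: "star_hom (D_r G P) B \<phi>" "\<forall>b\<in>D_r_o G P. \<phi> b = \<zero>\<^bsub>B\<^esub>"
    "\<forall>\<alpha>\<in>neutral_words G P. \<phi> (word_op (B_ell2 P) (left_reg G P) \<alpha>) = word_op B w \<alpha>"
    using assms(2) by (auto simp: strongly_covariant_def)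
  have 1: "\<phi> \<one>\<^bsub>B_ell2 P\<^esub> = \<one>\<^bsub>B\<^esub>" using \<phi>(3)[rule_format, OF Nil_neutral] by simp
  have D: "D_r G P = (B_ell2 P)\<lparr>carrier := carrier (D_r G P)\<rparr>" by (simp add: D_r_def)
  have "word_op B w \<alpha> = (\<phi> \<circ> indicator_op P) (K_ideal G P \<alpha>)" if "\<alpha> \<in> neutral_words G P" for \<alpha>
    using \<phi>(3) that word_op_left_reg_neutral by simp
  then show ?thesis
    using \<phi> indicator_hom[OF assms(1) D indicator_op_D_r D_r_closed \<phi>(1) 1] by blast
qed

lemma strongly_covariant_imp_toeplitz:
  assumes "cstar_algebra B" "strongly_covariant G P B w"
  shows "toeplitz_rel G P B w"
proof -
  obtain \<phi> where \<phi>: "meet_rep B \<J> P (\<phi> \<circ> indicator_op P)"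
    "\<And>\<alpha>. \<alpha> \<in> neutral_words G P \<Longrightarrow> word_op B w \<alpha> = (\<phi> \<circ> indicator_op P) (K_ideal G P \<alpha>)"
    "\<And>L. L \<in> combs \<J> \<Longrightarrow> comb_val B (\<phi> \<circ> indicator_op P) L = \<phi> (mult_op P (comb_fun L))"
    "\<phi> \<zero>\<^bsub>B_ell2 P\<^esub> = \<zero>\<^bsub>B\<^esub>"
    using strongly_covariantD[OF assms] by blast
  show ?thesis
  proof (rule toeplitz_relI[OF \<phi>(1) _ \<phi>(2)])
    show "w \<one> = \<one>\<^bsub>B\<^esub>" using assms(2) by (simp add: strongly_covariant_def isometric_rep_def)
    fix L assume "L \<in> combs \<J>" "\<And>p. p \<in> P \<Longrightarrow> comb_fun L p = 0"
    then show "comb_val B (\<phi> \<circ> indicator_op P) L = \<zero>\<^bsub>B\<^esub>"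
      using \<phi>(3,4) mult_op_cong[of P "comb_fun L" "\<lambda>p. 0"] by (simp add: mult_op_simps)
  qed
qed

end


section \<open>Representations of the Toeplitz relations\<close>

lemma (in ring) minus_mult_minus:
  assumes "a \<in> carrier R" "b \<in> carrier R" "c \<in> carrier R" "d \<in> carrier R"
  shows "(a \<ominus> b) \<otimes> (c \<ominus> d) = (a \<otimes> c \<ominus> a \<otimes> d) \<ominus> (b \<otimes> c \<ominus> b \<otimes> d)"
  using assms by (simp add: minus_eq l_distr r_distr l_minus r_minus minus_add a_ac)

lemmas toeplitz_T1 = toeplitz_rel_def[THEN iffD1, THEN conjunct1]
  and toeplitz_T2 = toeplitz_rel_def[THEN iffD1, THEN conjunct2, THEN conjunct1, rule_format]
  and toeplitz_T3 = toeplitz_rel_def[THEN iffD1, THEN conjunct2, THEN conjunct2, THEN conjunct1, rule_format]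
  and toeplitz_T4 = toeplitz_rel_def[THEN iffD1, THEN conjunct2, THEN conjunct2, THEN conjunct2, rule_format]

context group_submonoid
begin

text \<open>Two isometries \<open>V, U\<close> with \<open>V\<^sup>* U = 1\<close> coincide; (T3) for the word \<open>(pq, p, 1, q)\<close> gives this for \<open>w (pq)\<close> and \<open>w p w q\<close>.\<close>

lemma toeplitz_isometric:
  assumes B: "cstar_algebra B" and w: "w \<in> P \<rightarrow> carrier B" and T: "toeplitz_rel G P B w"
  shows "isometric_rep G P B w"
proof -
  interpret B: cstar_algebra B by fact
  have w1: "w \<one> = \<one>\<^bsub>B\<^esub>" by (rule toeplitz_T1[OF T])
  note T3 = toeplitz_T3[OF T]
  have wc: "w p \<in> carrier B" if "p \<in> P" for p using w that by auto
  have iso: "adj B (w p) \<otimes>\<^bsub>B\<^esub> w p = \<one>\<^bsub>B\<^esub>" if p: "p \<in> P" for p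
  proof -
    have "[(p, p)] \<in> neutral_words G P" using p by (simp add: neutral_words_def)
    moreover have "K_ideal G P [(p, p)] = K_ideal G P []"
      using p by (auto simp: mem_K_ideal_Cons simp flip: m_assoc)
    ultimately have "word_op B w [(p, p)] = word_op B w []"
      using Nil_neutral by (intro T3)
    then show ?thesis using wc[OF p] by simp
  qed
  have "w (p \<otimes> q) = w p \<otimes>\<^bsub>B\<^esub> w q" if p: "p \<in> P" and q: "q \<in> P" for p q
  proof -
    let ?V = "w (p \<otimes> q)" and ?U = "w p \<otimes>\<^bsub>B\<^esub> w q"
    have pq: "p \<otimes> q \<in> P" using p q by simp
    have e: "inv (p \<otimes> q) \<otimes> (p \<otimes> (inv \<one> \<otimes> (q \<otimes> \<one>))) = \<one>"
      using p q by (simp add: l_inv)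
    have K2: "x \<in> K_ideal G P [(\<one>, q)] \<longleftrightarrow> x \<in> P" for x
      using q by (subst mem_K_ideal_Cons) auto
    have n: "[(p \<otimes> q, p), (\<one>, q)] \<in> neutral_words G P"
      using p q e by (simp add: neutral_words_def)
    moreover have "x \<in> K_ideal G P [(p \<otimes> q, p), (\<one>, q)] \<longleftrightarrow> x \<in> P" for x
      unfolding mem_K_ideal_Cons[OF neutral_wordsD(1)[OF n]] neutral_wordsD(2)[OF n] K2
      using P.mem_carrier[of x] l_one[of x] by metis
    then have "K_ideal G P [(p \<otimes> q, p), (\<one>, q)] = K_ideal G P []"
      unfolding K_ideal_Nil by blast
    ultimately have "word_op B w [(p \<otimes> q, p), (\<one>, q)] = word_op B w []"
      using Nil_neutral by (intro T3)
    then have VU: "adj B ?V \<otimes>\<^bsub>B\<^esub> ?U = \<one>\<^bsub>B\<^esub>"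
      using wc[OF p] wc[OF q] by (simp add: w1)
    have c: "?V \<in> carrier B" "?U \<in> carrier B" "adj B ?V \<in> carrier B" "adj B ?U \<in> carrier B"
      using wc p q pq by (simp_all add: B.adj_closed)
    have UV: "adj B ?U \<otimes>\<^bsub>B\<^esub> ?V = \<one>\<^bsub>B\<^esub>"
      using arg_cong[OF VU, of "adj B"] c by (simp add: B.adj_mult[of "adj B ?V" ?U] B.adj_adj)
    have "adj B ?U \<otimes>\<^bsub>B\<^esub> ?U = adj B (w q) \<otimes>\<^bsub>B\<^esub> ((adj B (w p) \<otimes>\<^bsub>B\<^esub> w p) \<otimes>\<^bsub>B\<^esub> w q)"
      using wc p q by (simp add: B.adj_mult B.adj_closed B.m_assoc)
    then have UU: "adj B ?U \<otimes>\<^bsub>B\<^esub> ?U = \<one>\<^bsub>B\<^esub>" using iso wc p q by simp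
    have "adj B (?V \<ominus>\<^bsub>B\<^esub> ?U) = adj B ?V \<ominus>\<^bsub>B\<^esub> adj B ?U"
      using c by (simp add: B.minus_eq B.minus_smult B.adj_add B.adj_smult B.smult_closed)
    \<comment> \<open>Each of the four products is the unit, so the sum cancels and the C*-identity
      gives V = U.\<close>
    then have "adj B (?V \<ominus>\<^bsub>B\<^esub> ?U) \<otimes>\<^bsub>B\<^esub> (?V \<ominus>\<^bsub>B\<^esub> ?U) =
        (adj B ?V \<otimes>\<^bsub>B\<^esub> ?V \<ominus>\<^bsub>B\<^esub> adj B ?V \<otimes>\<^bsub>B\<^esub> ?U) \<ominus>\<^bsub>B\<^esub> (adj B ?U \<otimes>\<^bsub>B\<^esub> ?V \<ominus>\<^bsub>B\<^esub> adj B ?U \<otimes>\<^bsub>B\<^esub> ?U)"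
      using c by (simp add: B.minus_mult_minus)
    also have "\<dots> = \<zero>\<^bsub>B\<^esub>"
      unfolding iso[OF pq] VU UV UU by (simp add: B.minus_eq B.r_neg)
    finally have "nrm B (?V \<ominus>\<^bsub>B\<^esub> ?U) = 0"
      using B.cstar_identity[of "?V \<ominus>\<^bsub>B\<^esub> ?U"] c by simp
    then have "?V \<ominus>\<^bsub>B\<^esub> ?U = \<zero>\<^bsub>B\<^esub>" using B.nrm_eq_0[of "?V \<ominus>\<^bsub>B\<^esub> ?U"] c by simp
    then show ?thesis using c by (simp add: B.minus_eq B.add.inv_solve_right')
  qed
  then show ?thesis using w1 iso by (simp add: isometric_rep_def)
qed

text \<open>By (T3) the value does not depend on the word chosen;
  \<open>constructible_neutral\<close> supplies one for every constructible S.\<close>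

definition ideal_val :: "'c cstar \<Rightarrow> ('a \<Rightarrow> 'c) \<Rightarrow> 'a set \<Rightarrow> 'c" where
  "ideal_val B w S = word_op B w (SOME \<alpha>. \<alpha> \<in> neutral_words G P \<and> K_ideal G P \<alpha> = S)"

text \<open>Concatenation of neutral words intersects their ideals and reversal keeps the ideal, so
  (T3) turns these operations on words into \<open>E_Int\<close> and \<open>E_adj\<close>.\<close>

lemma toeplitz_faithful:
  assumes B: "cstar_algebra B" and w: "w \<in> P \<rightarrow> carrier B" and T: "toeplitz_rel G P B w"
  shows "faithful_meet_rep B \<J> P (ideal_val B w)"
    and "\<alpha> \<in> neutral_words G P \<Longrightarrow> word_op B w \<alpha> = ideal_val B w (K_ideal G P \<alpha>)"
proof -
  interpret B: cstar_algebra B by fact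
  let ?E = "ideal_val B w"
  have W: "word_op B w \<alpha> = ?E (K_ideal G P \<alpha>)" if "\<alpha> \<in> neutral_words G P" for \<alpha>
  proof -
    let ?\<beta> = "SOME \<beta>. \<beta> \<in> neutral_words G P \<and> K_ideal G P \<beta> = K_ideal G P \<alpha>"
    have "?\<beta> \<in> neutral_words G P \<and> K_ideal G P ?\<beta> = K_ideal G P \<alpha>"
      by (rule someI[of _ \<alpha>]) (use that in simp)
    then show ?thesis unfolding ideal_val_def using that by (intro toeplitz_T3[OF T]) auto
  qed
  then show "\<alpha> \<in> neutral_words G P \<Longrightarrow> word_op B w \<alpha> = ?E (K_ideal G P \<alpha>)" .
  have word: "\<exists>\<alpha>. \<alpha> \<in> neutral_words G P \<and> K_ideal G P \<alpha> = S \<and> ?E S = word_op B w \<alpha>" if S: "S \<in> \<J>" for S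
  proof -
    obtain \<alpha> where "\<alpha> \<in> neutral_words G P" "K_ideal G P \<alpha> = S" using constructible_neutral[OF S] by blast
    then show ?thesis using W[of \<alpha>] by (intro exI[of _ \<alpha>]) simp
  qed
  have "meet_rep B \<J> P ?E"
  proof
    show "P \<in> \<J>" by (rule constructible_P)
    show "?E P = \<one>\<^bsub>B\<^esub>" using W[OF Nil_neutral] by (simp add: K_ideal_Nil)
    fix S assume S: "S \<in> \<J>"
    obtain \<alpha> where \<alpha>: "\<alpha> \<in> neutral_words G P" "K_ideal G P \<alpha> = S" "?E S = word_op B w \<alpha>"
      using word[OF S] by blast
    show "S \<subseteq> P" using S by (rule constructible_subset)
    show "?E S \<in> carrier B" using \<alpha> B.word_op_closed[OF w] by (simp add: neutral_wordsD)
    show "adj B (?E S) = ?E S"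
      using \<alpha> neutral_rev[OF \<alpha>(1)] W[of "word_rev \<alpha>"] B.word_op_rev[OF w, of \<alpha>] by (simp add: neutral_wordsD)
    fix T assume T: "T \<in> \<J>"
    obtain \<beta> where \<beta>: "\<beta> \<in> neutral_words G P" "K_ideal G P \<beta> = T" "?E T = word_op B w \<beta>"
      using word[OF T] by blast
    show "S \<inter> T \<in> \<J>" using S T by (rule constructible_Int)
    show "?E (S \<inter> T) = ?E S \<otimes>\<^bsub>B\<^esub> ?E T"
      using \<alpha> \<beta> neutral_append[OF \<alpha>(1) \<beta>(1)] W[of "\<alpha> @ \<beta>"] B.word_op_append[OF w, of \<alpha> \<beta>]
      by (simp add: neutral_wordsD)
  qed
  then interpret M: meet_rep B \<J> P ?E .
  show "faithful_meet_rep B \<J> P ?E"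
  proof
    fix S Ts assume S: "S \<in> \<J>" and Ts: "set Ts \<subseteq> \<J>" and sub: "S \<subseteq> \<Union>(set Ts)"
    obtain \<alpha> where \<alpha>: "\<alpha> \<in> neutral_words G P" "K_ideal G P \<alpha> = S" "?E S = word_op B w \<alpha>"
      using word[OF S] by blast
    show "M.cut_proj S Ts = \<zero>\<^bsub>B\<^esub>"
    proof (cases "S = {}")
      \<comment> \<open>The empty ideal is settled by (T2); here the list may be empty, where (T4)
        does not apply.\<close>
      case True
      have "M.cut_proj S Ts = ?E S \<otimes>\<^bsub>B\<^esub> M.cut_proj S Ts"
        using M.E_cut(1)[OF S S Ts] by simp
      moreover have "?E S = \<zero>\<^bsub>B\<^esub>" unfolding \<alpha>(3) by (rule toeplitz_T2[OF T \<alpha>(1)]) (use \<alpha> True in simp)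
      ultimately show ?thesis using M.cut_closed[OF S Ts] by simp
    next
      case False
      obtain f where f: "\<And>U. U \<in> \<J> \<Longrightarrow> f U \<in> neutral_words G P \<and> K_ideal G P (f U) = U"
        using word by metis
      \<comment> \<open>Words for the traces \<open>S \<inter> T\<close>, as (T4) asks for ideals
        whose union is exactly S. Different T may have the same trace, and duplicates are removed
        because (T4) is stated for distinct words.\<close>
      define \<beta>s where "\<beta>s = remdups (map (\<lambda>T. f (S \<inter> T)) Ts)"
      have I: "S \<inter> T \<in> \<J>" if "T \<in> set Ts" for T using S Ts that constructible_Int by blast
      have set: "set \<beta>s = (\<lambda>T. f (S \<inter> T)) ` set Ts" by (simp add: \<beta>s_def)
      have n: "set \<beta>s \<subseteq> neutral_words G P" using f I by (auto simp: set)
      have K: "\<exists>T\<in>set Ts. K_ideal G P \<beta> = S \<inter> T" if "\<beta> \<in> set \<beta>s" for \<beta>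
        using that f I by (auto simp: set)
      have "(\<Union>\<beta>\<in>set \<beta>s. K_ideal G P \<beta>) = (\<Union>T\<in>set Ts. S \<inter> T)" using f I by (simp add: set)
      then have "K_ideal G P \<alpha> = (\<Union>\<beta>\<in>set \<beta>s. K_ideal G P \<beta>)" using \<alpha> sub by auto
      moreover have "\<beta>s \<noteq> []" using sub False by (auto simp: \<beta>s_def)
      moreover have "distinct \<beta>s" by (simp add: \<beta>s_def)
      ultimately have "foldr (\<lambda>\<beta> x. (word_op B w \<alpha> \<ominus>\<^bsub>B\<^esub> word_op B w \<beta>) \<otimes>\<^bsub>B\<^esub> x) \<beta>s \<one>\<^bsub>B\<^esub> = \<zero>\<^bsub>B\<^esub>"
        using \<alpha>(1) n by (intro toeplitz_T4[OF T] conjI)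
      also have "foldr (\<lambda>\<beta> x. (word_op B w \<alpha> \<ominus>\<^bsub>B\<^esub> word_op B w \<beta>) \<otimes>\<^bsub>B\<^esub> x) \<beta>s \<one>\<^bsub>B\<^esub> =
          foldr (\<lambda>U x. (?E S \<ominus>\<^bsub>B\<^esub> ?E U) \<otimes>\<^bsub>B\<^esub> x) (map (K_ideal G P) \<beta>s) \<one>\<^bsub>B\<^esub>"
        unfolding foldr_map using \<alpha>(3) W n by (intro foldr_cong) auto
      finally show ?thesis
        using K n by (intro M.cut_eq_zero[OF S Ts, of "map (K_ideal G P) \<beta>s"])
          (auto intro!: constructibleI neutral_wordsD)
    qed
  qed
qed

text \<open>A nonzero value of the symbol at \<open>p\<close> persists on the set \<open>S \<setminus> \<Union>T\<close> of points lying in the same ideals as \<open>p\<close>, and by (3) this set meets every \<open>\<Delta>\<^sub>F\<close>.\<close>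

lemma D_r_o_trivial:
  assumes no: "\<And>S C. S \<in> \<J> \<Longrightarrow> S \<noteq> {} \<Longrightarrow> \<not> proper_foundation_set G P S C"
    and b: "b \<in> D_r_o G P" and "p \<in> P"
  shows "symbol b p = 0"
proof (rule ccontr)
  assume "symbol b p \<noteq> 0"
  define d where "d = cmod (symbol b p)"
  have d: "d > 0" using \<open>symbol b p \<noteq> 0\<close> by (simp add: d_def)
  have bD: "b \<in> carrier (D_r G P)"
    and lim: "((\<lambda>F. op_norm_on (Delta G P F) b) \<longlongrightarrow> 0) (finite_subsets_at_top (carrier G))"
    using b by (auto simp: D_r_o_def)
  \<comment> \<open>With tolerance d/3, passing from p to another point at which L has the same
    value loses at most two thirds of d and leaves d/3.\<close>
  obtain L where L: "L \<in> combs \<J>" "\<And>q. q \<in> P \<Longrightarrow> cmod (symbol b q - comb_fun L q) < d / 3"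
    using D_r_elem(2)[OF bD] d unfolding comb_approx_def by (meson divide_pos_pos zero_less_numeral)
  have sets: "snd ` set L \<subseteq> \<J>" using L(1) by (auto simp: combs_def)
  define In where "In = {S \<in> snd ` set L. p \<in> S}"
  define Out where "Out = {S \<in> snd ` set L. p \<notin> S}"
  have fin: "finite In" "finite Out" by (auto simp: In_def Out_def)
  \<comment> \<open>Intersecting with P makes the empty intersection constructible.\<close>
  have "P \<inter> \<Inter>X \<in> \<J>" if "finite X" "X \<subseteq> \<J>" for X
    using that
  proof (induction X rule: finite_induct)
    case empty
    then show ?case using constructible_P by simp
  next
    case (insert S X)
    then have "S \<inter> (P \<inter> \<Inter>X) \<in> \<J>" using constructible_Int[of S "P \<inter> \<Inter>X"] by simp
    moreover have "P \<inter> \<Inter>(insert S X) = S \<inter> (P \<inter> \<Inter>X)" by auto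
    ultimately show ?case by (simp only:)
  qed
  moreover have "In \<subseteq> \<J>" using sets by (auto simp: In_def)
  ultimately have S: "P \<inter> \<Inter>In \<in> \<J>" using fin(1) by blast
  define S where "S = P \<inter> \<Inter>In"
  have pS: "p \<in> S" using \<open>p \<in> P\<close> by (auto simp: S_def In_def)
  let ?C = "(\<lambda>T. S \<inter> T) ` Out"
  have "p \<in> S - \<Union>?C" using pS by (auto simp: Out_def)
  \<comment> \<open>The point p shows that the traces of the ideals in \<open>Out\<close> do not
    cover S, so by (3) they form no foundation set. The resulting witness r has rP inside every
    ideal of \<open>In\<close> and disjoint from every ideal of \<open>Out\<close>.\<close>
  then have "\<not> foundation_set G P S ?C"
    using no[of S ?C] S by (auto simp: proper_foundation_set_def S_def[symmetric])
  moreover have "?C \<subseteq> \<J>" using S sets by (auto simp: S_def[symmetric] Out_def intro!: constructible_Int)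
  ultimately obtain r where r: "r \<in> S" "(r <#\<^bsub>G\<^esub> P) \<inter> \<Union>?C = {}"
    using fin by (auto simp: foundation_set_def)
  have rS: "r <#\<^bsub>G\<^esub> P \<subseteq> S" using constructible_right_ideal[OF S] r(1) by (simp add: S_def)
  have same: "comb_fun L q = comb_fun L p" if q: "q \<in> r <#\<^bsub>G\<^esub> P" for q
  proof -
    have "q \<in> T \<longleftrightarrow> p \<in> T" if "T \<in> snd ` set L" for T
    proof (cases "p \<in> T")
      case True
      then show ?thesis using rS q that by (auto simp: S_def In_def)
    next
      case False
      then have "T \<in> Out" using that by (simp add: Out_def)
      then show ?thesis using r(2) rS q False by blast
    qed
    then show ?thesis
      unfolding comb_fun_def by (intro arg_cong[of _ _ sum_list] map_cong) (force simp: indicator_def)+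
  qed
  have "d / 3 \<le> op_norm_on (Delta G P F) b" if F: "finite F" "F \<subseteq> carrier G" for F
  proof -
    have "r \<in> P" using r(1) by (simp add: S_def)
    then obtain q where q: "q \<in> Delta G P F" "q \<in> r <#\<^bsub>G\<^esub> P" using Delta_refine[OF F] by blast
    have "q \<in> P" using q by (simp add: Delta_def)
    have "d \<le> cmod (symbol b q) + cmod (symbol b q - comb_fun L q) + cmod (symbol b p - comb_fun L p)"
      unfolding d_def using same[OF q(2)] norm_triangle_ineq[of "symbol b p - comb_fun L p" "comb_fun L p"]
        norm_triangle_ineq4[of "symbol b q" "symbol b q - comb_fun L q"] by simp
    then have "d / 3 \<le> cmod (symbol b q)"
      using L(2)[OF \<open>q \<in> P\<close>] L(2)[OF \<open>p \<in> P\<close>] by simp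
    also have "\<dots> \<le> op_norm_on (Delta G P F) b"
      using q by (intro cmod_le_op_norm[OF D_r_elem(3)[OF bD]]) (auto simp: Delta_def)
    finally show ?thesis .
  qed
  then have "\<forall>\<^sub>F F in finite_subsets_at_top (carrier G). d / 3 \<le> op_norm_on (Delta G P F) b"
    by (intro eventually_finite_subsets_at_top_weakI) auto
  then have "d / 3 \<le> 0" using lim by (intro tendsto_lowerbound[OF lim]) auto
  then show False using d by simp
qed

text \<open>The homomorphism sends b to the element tracked by its symbol. It annihilates
  \<open>D_r_o\<close> because (3) leaves only the zero symbol there.\<close>

lemma toeplitz_imp_strongly_covariant:
  assumes no: "\<And>S C. S \<in> \<J> \<Longrightarrow> S \<noteq> {} \<Longrightarrow> \<not> proper_foundation_set G P S C"
    and B: "cstar_algebra B" and w: "w \<in> P \<rightarrow> carrier B" and T: "toeplitz_rel G P B w"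
  shows "strongly_covariant G P B w"
proof -
  interpret F: faithful_meet_rep B \<J> P "ideal_val B w" by (rule toeplitz_faithful(1)[OF B w T])
  define \<phi> where "\<phi> b = (THE x. F.tracks (symbol b) x)" for b
  have eq: "\<phi> b = x" if "F.tracks (symbol b) x" for b x
    unfolding \<phi>_def using that F.tracks_unique by (intro the_equality) blast+
  have tr: "F.tracks (symbol b) (\<phi> b)" if "b \<in> carrier (D_r G P)" for b
    using F.tracks_exists[OF D_r_elem(2)[OF that]] eq by auto
  \<comment> \<open>Any function representing b may replace its symbol, since the two agree on P and
    tracking sees only values on P.\<close>
  have trI: "\<phi> b = x" if "b = mult_op P g" "F.tracks g x" for b g x
    using that F.tracks_cong[of "symbol b" g] by (intro eq) (simp add: symbol_mult_op)
  have bounded: "bounded_fun P (symbol b)" if "b \<in> carrier (D_r G P)" for b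
    using comb_approx_bounded[OF D_r_elem(2)[OF that]] .
  have "star_hom (D_r G P) B \<phi>"
    unfolding star_hom_def D_r_simps
  proof (intro conjI ballI allI funcsetI)
    fix x assume x: "x \<in> carrier (D_r G P)"
    note x' = D_r_elem(1)[OF x]
    show "\<phi> x \<in> carrier B" using tr[OF x] by (rule F.tracksD)
    show "\<phi> (c \<odot>\<^bsub>B_ell2 P\<^esub> x) = c \<odot>\<^bsub>B\<^esub> \<phi> x" for c
      by (rule trI[OF _ F.tracks_scale[OF tr[OF x]]]) (subst x', simp add: mult_op_simps)
    show "\<phi> (adj (B_ell2 P) x) = adj B (\<phi> x)"
      by (rule trI[OF _ F.tracks_adj[OF tr[OF x]]])
        (subst x', simp add: B_ell2_simps mult_op_adjoint[OF bounded[OF x]])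
    fix y assume y: "y \<in> carrier (D_r G P)"
    note y' = D_r_elem(1)[OF y]
    show "\<phi> (x \<oplus>\<^bsub>B_ell2 P\<^esub> y) = \<phi> x \<oplus>\<^bsub>B\<^esub> \<phi> y"
      by (rule trI[OF _ F.tracks_add[OF tr[OF x] tr[OF y]]]) (subst x', subst y', simp add: mult_op_simps)
    show "\<phi> (x \<otimes>\<^bsub>B_ell2 P\<^esub> y) = \<phi> x \<otimes>\<^bsub>B\<^esub> \<phi> y"
      by (rule trI[OF _ F.tracks_mult[OF tr[OF x] tr[OF y]]])
        (subst x', subst y', simp add: mult_op_mult[OF bounded[OF y]])
  qed
  moreover have "\<phi> (word_op (B_ell2 P) (left_reg G P) \<alpha>) = word_op B w \<alpha>" if \<alpha>: "\<alpha> \<in> neutral_words G P" for \<alpha>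
  proof -
    let ?K = "K_ideal G P \<alpha>"
    have K: "?K \<in> \<J>" using \<alpha> by (auto intro!: constructibleI neutral_wordsD)
    have "F.tracks (comb_fun [(1, ?K)]) (comb_val B (ideal_val B w) [(1, ?K)])"
      using K by (intro F.tracks_comb) simp
    moreover have "comb_fun [(1, ?K)] = indicator ?K" by (simp add: comb_fun_eq)
    moreover have "comb_val B (ideal_val B w) [(1, ?K)] = word_op B w \<alpha>"
      using F.E_closed[OF K] toeplitz_faithful(2)[OF B w T \<alpha>] by (simp add: F.smult_one)
    ultimately show ?thesis
      using word_op_left_reg_neutral[OF \<alpha>] by (intro trI[of _ "indicator ?K"]) (simp_all add: indicator_op_eq)
  qed
  moreover have "\<phi> b = \<zero>\<^bsub>B\<^esub>" if "b \<in> D_r_o G P" for b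
  proof (rule eq)
    have "F.tracks (comb_fun []) \<zero>\<^bsub>B\<^esub>" using F.tracks_comb[of "[]"] by simp
    then show "F.tracks (symbol b) \<zero>\<^bsub>B\<^esub>"
      using D_r_o_trivial[OF no that] by (subst F.tracks_cong[of _ "comb_fun []"]) auto
  qed
  ultimately show ?thesis
    using toeplitz_isometric[OF B w T] by (auto simp: strongly_covariant_def)
qed

end


section \<open>The quotient map\<close>

text \<open>A limit in A of elements of W first lies in V, since V is closed, and only then does
  closedness of W relative to V apply. Differences are formed in two ring structures and have to be
  identified.\<close>

lemma cstar_subalgebra_restrict:
  fixes A :: "'b cstar" (structure)
  assumes "cstar_algebra A" "cstar_subalgebra A V" "W \<subseteq> V"
    and W: "cstar_subalgebra (A\<lparr>carrier := V\<rparr>) W"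
  shows "cstar_subalgebra A W"
proof -
  interpret A: cstar_algebra A by fact
  interpret B: cstar_algebra "A\<lparr>carrier := V\<rparr>" by (rule cstar_algebra_subalgebra) fact+
  have sub: "V \<subseteq> carrier A" using assms(2) by (simp add: cstar_subalgebra_def closed_subspace_def)
  have diff: "x \<ominus>\<^bsub>A\<lparr>carrier := V\<rparr>\<^esub> y = x \<ominus> y" if "x \<in> V" "y \<in> V" for x y
    using that sub B.minus_smult[of y] A.minus_smult[of y]
    by (simp add: B.minus_eq A.minus_eq subset_iff)
  have "x \<in> W" if x: "x \<in> carrier A" and e: "\<forall>e>0. \<exists>v\<in>W. nrm A (x \<ominus> v) < e" for x
  proof -
    have "x \<in> V"
      using assms(2,3) x e unfolding cstar_subalgebra_def closed_subspace_def by (meson subsetD)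
    moreover from this have "\<forall>e>0. \<exists>v\<in>W. nrm A (x \<ominus>\<^bsub>A\<lparr>carrier := V\<rparr>\<^esub> v) < e"
      using e diff assms(3) by (metis subsetD)
    ultimately show ?thesis using W by (simp add: cstar_subalgebra_def closed_subspace_def)
  qed
  then show ?thesis
    using W sub assms(3) unfolding cstar_subalgebra_def closed_subspace_def by auto
qed

text \<open>\<open>universe_copy\<close> asks that the family generate the whole algebra, with
  generation measured inside that algebra itself.\<close>

lemma generated_subalgebra_self:
  fixes A :: "'b cstar" (structure)
  assumes "cstar_algebra A" "X \<subseteq> carrier A"
  defines "V \<equiv> generated_subalgebra A X"
  shows "generated_subalgebra (A\<lparr>carrier := V\<rparr>) X = V"
proof -
  have V: "cstar_subalgebra A V" unfolding V_def by (rule cstar_subalgebra_generated) fact+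
  have XV: "X \<subseteq> V" by (auto simp: V_def generated_subalgebra_def)
  have B: "cstar_algebra (A\<lparr>carrier := V\<rparr>)" by (rule cstar_algebra_subalgebra) fact+
  have g: "cstar_subalgebra (A\<lparr>carrier := V\<rparr>) (generated_subalgebra (A\<lparr>carrier := V\<rparr>) X)"
    using XV by (intro cstar_subalgebra_generated[OF B]) simp
  then have sub: "generated_subalgebra (A\<lparr>carrier := V\<rparr>) X \<subseteq> V"
    by (simp add: cstar_subalgebra_def closed_subspace_def)
  have "cstar_subalgebra A (generated_subalgebra (A\<lparr>carrier := V\<rparr>) X)"
    by (rule cstar_subalgebra_restrict[OF assms(1) V sub g])
  moreover have "X \<subseteq> generated_subalgebra (A\<lparr>carrier := V\<rparr>) X" by (auto simp: generated_subalgebra_def)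
  ultimately have "V \<subseteq> generated_subalgebra (A\<lparr>carrier := V\<rparr>) X"
    unfolding V_def[THEN meta_eq_to_obj_eq] generated_subalgebra_def[of A] by blast
  with sub show ?thesis by blast
qed

text \<open>\<open>star_hom\<close> does not ask for preservation of the unit. If u is sent to the
  unit of B, then multiplying u by the unit of A shows where the latter goes.\<close>

lemma hom_one:
  assumes "cstar_algebra A" "cstar_algebra B" "star_iso A B \<phi>"
  shows "\<phi> \<one>\<^bsub>A\<^esub> = \<one>\<^bsub>B\<^esub>"
proof -
  interpret A: cstar_algebra A by fact
  interpret B: cstar_algebra B by fact
  have hom: "star_hom A B \<phi>" and bij: "bij_betw \<phi> (carrier A) (carrier B)"
    using assms(3) by (auto simp: star_iso_def)
  obtain u where u: "u \<in> carrier A" "\<phi> u = \<one>\<^bsub>B\<^esub>"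
    using bij by (metis B.one_closed bij_betw_imp_surj_on imageE)
  have "\<phi> u = \<phi> u \<otimes>\<^bsub>B\<^esub> \<phi> \<one>\<^bsub>A\<^esub>" using star_homD(3)[OF hom u(1) A.one_closed] u(1) by simp
  then show ?thesis using u(2) star_homD(1)[OF hom A.one_closed] by simp
qed

context group_submonoid
begin

text \<open>The left regular representation acts on \<open>ell2\<close>, outside the type over which
  \<open>reps\<close> ranges, hence the copy. Its injectivity and the symbol show that a combination
  with zero value has zero function, the converse of what the Toeplitz relations give.\<close>

lemma regular_copy:
  "\<exists>(B :: 'a universe cstar) w E. cstar_algebra B \<and> w \<in> P \<rightarrow> carrier B \<and> toeplitz_rel G P B w \<and>
     meet_rep B \<J> P E \<and> (\<forall>\<alpha>\<in>neutral_words G P. word_op B w \<alpha> = E (K_ideal G P \<alpha>)) \<and>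
     (\<forall>L\<in>combs \<J>. comb_val B E L = \<zero>\<^bsub>B\<^esub> \<longrightarrow> (\<forall>p\<in>P. comb_fun L p = 0))"
proof -
  let ?H = "B_ell2 P" and ?l = "left_reg G P"
  let ?V = "generated_subalgebra ?H (?l ` P)"
  let ?D = "?H\<lparr>carrier := ?V\<rparr>"
  note H = cstar_algebra_B_ell2[of P]
  have lH: "?l ` P \<subseteq> carrier ?H" by (auto simp: B_ell2_simps(1) left_reg_bounded)
  have V: "cstar_subalgebra ?H ?V" by (rule cstar_subalgebra_generated[OF H lH])
  have D: "cstar_algebra ?D" by (rule cstar_algebra_subalgebra[OF H V])
  interpret D: cstar_algebra ?D by (rule D)
  have l: "?l \<in> P \<rightarrow> carrier ?D" by (auto simp: generated_subalgebra_def)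
  obtain B :: "'a universe cstar" and h where B: "cstar_algebra B" and iso: "star_iso ?D B h"
    using universe_copy[OF D l] generated_subalgebra_self[OF H lH] by auto
  have hom: "star_hom ?D B h" and inj: "inj_on h ?V"
    using iso by (auto simp: star_iso_def bij_betw_def)
  have h1: "h \<one>\<^bsub>?H\<^esub> = \<one>\<^bsub>B\<^esub>" using hom_one[OF D B iso] by simp
  have word: "word_op ?D ?l \<alpha> = word_op ?H ?l \<alpha>" for \<alpha> by (simp add: word_op_def)
  have VS: "indicator_op P S \<in> ?V" if S: "S \<in> \<J>" for S
  proof -
    obtain \<alpha> where \<alpha>: "\<alpha> \<in> neutral_words G P" "K_ideal G P \<alpha> = S" using constructible_neutral[OF S] by blast
    then show ?thesis
      using D.word_op_closed[OF l neutral_wordsD(1)[OF \<alpha>(1)]] word word_op_left_reg_neutral[OF \<alpha>(1)] by simp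
  qed
  have Vc: "\<zero>\<^bsub>?H\<^esub> \<in> ?V" "\<And>x y. x \<in> ?V \<Longrightarrow> y \<in> ?V \<Longrightarrow> x \<oplus>\<^bsub>?H\<^esub> y \<in> ?V" "\<And>c x. x \<in> ?V \<Longrightarrow> c \<odot>\<^bsub>?H\<^esub> x \<in> ?V"
    using V by (auto simp: cstar_subalgebra_def closed_subspace_def)
  have I: "meet_rep B \<J> P (h \<circ> indicator_op P)"
    "L \<in> combs \<J> \<Longrightarrow> comb_val B (h \<circ> indicator_op P) L = h (mult_op P (comb_fun L))"
    "L \<in> combs \<J> \<Longrightarrow> mult_op P (comb_fun L) \<in> ?V" "h \<zero>\<^bsub>?H\<^esub> = \<zero>\<^bsub>B\<^esub>" for L
    by (rule indicator_hom[OF B refl VS Vc hom h1]; assumption)+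
  let ?E = "h \<circ> indicator_op P"
  have W: "word_op B (h \<circ> ?l) \<alpha> = ?E (K_ideal G P \<alpha>)" if \<alpha>: "\<alpha> \<in> neutral_words G P" for \<alpha>
    using D.hom_word_op[OF hom _ l neutral_wordsD(1)[OF \<alpha>]] h1 word word_op_left_reg_neutral[OF \<alpha>] by simp
  have "toeplitz_rel G P B (h \<circ> ?l)"
  proof (rule toeplitz_relI[OF I(1) _ W])
    have "indicator_op P P = \<one>\<^bsub>?H\<^esub>"
      unfolding indicator_op_eq mult_op_simps by (rule mult_op_cong) simp
    moreover have "?l \<one> = indicator_op P P"
      by (auto simp: left_reg_def indicator_op_def fun_eq_iff mem_coset_iff indicator_def ell2D)
    ultimately show "(h \<circ> ?l) \<one> = \<one>\<^bsub>B\<^esub>" using h1 by simp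
    fix L assume L: "L \<in> combs \<J>" "\<And>p. p \<in> P \<Longrightarrow> comb_fun L p = 0"
    then have "mult_op P (comb_fun L) = \<zero>\<^bsub>?H\<^esub>"
      using mult_op_cong[of P "comb_fun L" "\<lambda>p. 0"] by (simp add: mult_op_simps)
    then show "comb_val B ?E L = \<zero>\<^bsub>B\<^esub>" using I(2)[OF L(1)] I(4) by simp
  qed
  moreover have "comb_fun L p = 0" if L: "L \<in> combs \<J>" "comb_val B ?E L = \<zero>\<^bsub>B\<^esub>" "p \<in> P" for L p
  proof -
    have "h (mult_op P (comb_fun L)) = h \<zero>\<^bsub>?H\<^esub>" using I(2)[OF L(1)] I(4) L(2) by simp
    then have "mult_op P (comb_fun L) = \<zero>\<^bsub>?H\<^esub>" using inj I(3)[OF L(1)] Vc(1) by (simp add: inj_on_eq_iff)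
    then have "symbol (mult_op P (comb_fun L)) p = symbol (mult_op P (\<lambda>p. 0)) p" by (simp add: mult_op_simps)
    then show ?thesis using L(3) by (simp add: symbol_mult_op)
  qed
  moreover have "h \<circ> ?l \<in> P \<rightarrow> carrier B" using l star_homD(1)[OF hom] by (auto simp: Pi_iff)
  ultimately show ?thesis using B I(1) W by blast
qed

lemma toeplitz_bound:
  assumes "p \<in> P"
  shows "\<exists>M. \<forall>(B, w)\<in>reps P (toeplitz_rel G P). nrm B (w p) \<le> M"
proof -
  have "nrm B (w p) \<le> 1" if "(B, w) \<in> reps P (toeplitz_rel G P)" for B :: "'a universe cstar" and w
  proof -
    have *: "cstar_algebra B" "w \<in> P \<rightarrow> carrier B" "toeplitz_rel G P B w" using that by (auto simp: reps_def)
    interpret B: cstar_algebra B by fact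
    have c: "w p \<in> carrier B" using * assms by auto
    have "(nrm B (w p))\<^sup>2 = nrm B \<one>\<^bsub>B\<^esub>"
      using B.cstar_identity[OF c] toeplitz_isometric[OF *] assms by (simp add: isometric_rep_def)
    \<comment> \<open>Only an inequality: in the zero algebra, which is allowed, the unit has norm
      0.\<close>
    also have "\<dots> \<le> 1" by (rule B.nrm_projection_le) simp_all
    finally show ?thesis by (simp add: power_le_one_iff abs_le_square_iff[of _ 1, simplified] B.nrm_nonneg c)
  qed
  then show ?thesis by (intro exI[of _ 1]) auto
qed

section \<open>The universal algebras as families over representations\<close>

lemma toeplitz_algebra:
  shows "cstar_algebra (toeplitz_algebra G P)"
    and "universal_gen P (toeplitz_rel G P) \<in> P \<rightarrow> carrier (toeplitz_algebra G P)"
    and "(B, w) \<in> reps P (toeplitz_rel G P) \<Longrightarrow> star_hom (toeplitz_algebra G P) B (\<lambda>x. x (B, w))"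
    and "(B, w) \<in> reps P (toeplitz_rel G P) \<Longrightarrow> (\<lambda>x. x (B, w)) \<circ> universal_gen P (toeplitz_rel G P) = w"
proof -
  have ne: "reps P (toeplitz_rel G P) \<noteq> {}"
    using regular_copy by (auto simp: reps_def)
  note U = universal_cstar_algebra[OF ne toeplitz_bound]
  show "cstar_algebra (toeplitz_algebra G P)"
    unfolding toeplitz_algebra_def by (rule U(1))
  show "universal_gen P (toeplitz_rel G P) \<in> P \<rightarrow> carrier (toeplitz_algebra G P)"
    unfolding toeplitz_algebra_def using U(2) by blast
  show "(B, w) \<in> reps P (toeplitz_rel G P) \<Longrightarrow> star_hom (toeplitz_algebra G P) B (\<lambda>x. x (B, w))"
    unfolding toeplitz_algebra_def by (rule U(3))
  show "(B, w) \<in> reps P (toeplitz_rel G P) \<Longrightarrow> (\<lambda>x. x (B, w)) \<circ> universal_gen P (toeplitz_rel G P) = w"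
    using U(4) by auto
qed

text \<open>Every product in the algebra is formed by restriction to the index set, and x is its own
  product with the unit.\<close>

lemma toeplitz_algebra_extensional:
  assumes "x \<in> carrier (toeplitz_algebra G P)"
  shows "x \<in> extensional (reps P (toeplitz_rel G P))"
proof -
  interpret cstar_algebra "toeplitz_algebra G P" by (rule toeplitz_algebra(1))
  have "y \<otimes>\<^bsub>toeplitz_algebra G P\<^esub> x \<in> extensional (reps P (toeplitz_rel G P))" for y
    by (simp add: toeplitz_algebra_def universal_cstar_def cstar_product_def Let_def)
  from this[of "\<one>\<^bsub>toeplitz_algebra G P\<^esub>"] show ?thesis using assms by simp
qed

lemma toeplitz_algebra_one_zero:
  assumes "(B, w) \<in> reps P (toeplitz_rel G P)"
  shows "\<one>\<^bsub>toeplitz_algebra G P\<^esub> (B, w) = \<one>\<^bsub>B\<^esub>" "\<zero>\<^bsub>toeplitz_algebra G P\<^esub> (B, w) = \<zero>\<^bsub>B\<^esub>"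
  using assms by (simp_all add: toeplitz_algebra_def universal_cstar_def cstar_product_def Let_def)

text \<open>Under (3) both algebras are built over the same index set, hence are equal, and
  restricting an extensional family to its own index set changes nothing.\<close>

lemma q_u_iso:
  assumes no: "\<And>S C. S \<in> \<J> \<Longrightarrow> S \<noteq> {} \<Longrightarrow> \<not> proper_foundation_set G P S C"
  shows "star_iso (toeplitz_algebra G P) (covariance_algebra G P) (q_u G P)"
proof -
  have R: "reps P (strongly_covariant G P) = reps P (toeplitz_rel G P)"
    using strongly_covariant_imp_toeplitz toeplitz_imp_strongly_covariant[OF no]
    unfolding reps_def by blast
  have cov: "covariance_algebra G P = toeplitz_algebra G P"
    by (simp add: covariance_algebra_def toeplitz_algebra_def universal_cstar_def universal_gen_def R)
  interpret T: cstar_algebra "toeplitz_algebra G P" by (rule toeplitz_algebra(1))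
  have q: "q_u G P x = x" if "x \<in> carrier (toeplitz_algebra G P)" for x
    using toeplitz_algebra_extensional[OF that] that by (simp add: q_u_def R extensional_restrict)
  show ?thesis
    unfolding star_iso_def star_hom_def cov
    by (auto simp: q T.smult_closed T.adj_closed bij_betw_def inj_on_def)
qed

text \<open>The product \<open>\<Prod>(1 - t\<^sub>\<beta>)\<close> over words for the members of a foundation set becomes multiplication
  by the indicator function of \<open>P \<setminus> \<Union>C\<close>, which is nonzero at the identity but vanishes on every
  sufficiently fine \<open>\<Delta>\<^sub>F\<close>.\<close>

lemma foundation_comb_in_D_r_o:
  assumes C: "foundation_set G P P (set Ts)" and D: "mult_op P (comb_fun (comb_diff P P Ts)) \<in> carrier (D_r G P)"
  shows "mult_op P (comb_fun (comb_diff P P Ts)) \<in> D_r_o G P"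
proof -
  let ?b = "mult_op P (comb_fun (comb_diff P P Ts))"
  have J: "set Ts \<subseteq> \<J>" using C by (simp add: foundation_set_def)
  have "\<forall>S\<in>set Ts. \<exists>F. finite F \<and> F \<subseteq> carrier G \<and>
    (\<forall>F' p. F \<subseteq> F' \<longrightarrow> p \<in> Delta G P F' \<longrightarrow> (p <#\<^bsub>G\<^esub> P) \<inter> S \<noteq> {} \<longrightarrow> p \<in> S)"
    using Delta_decides J by blast
  then obtain f where f: "\<forall>S\<in>set Ts. finite (f S) \<and> f S \<subseteq> carrier G \<and>
    (\<forall>F' p. f S \<subseteq> F' \<longrightarrow> p \<in> Delta G P F' \<longrightarrow> (p <#\<^bsub>G\<^esub> P) \<inter> S \<noteq> {} \<longrightarrow> p \<in> S)"
    by metis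
  let ?F = "\<Union>(f ` set Ts)"
  have "op_norm_on (Delta G P F) ?b = 0" if F: "?F \<subseteq> F" for F
  proof (rule antisym)
    show "op_norm_on (Delta G P F) ?b \<le> 0"
    proof (rule op_norm_leI)
      fix \<xi> assume \<xi>: "\<xi> \<in> ell2 (Delta G P F)"
      have "comb_fun (comb_diff P P Ts) p * \<xi> p = 0" for p
      proof (cases "p \<in> Delta G P F")
        case False
        then show ?thesis using ell2D[OF \<xi>] by simp
      next
        case True
        then have "p \<in> P" by (simp add: Delta_def)
        then obtain S where S: "S \<in> set Ts" "(p <#\<^bsub>G\<^esub> P) \<inter> S \<noteq> {}"
          using C by (fastforce simp: foundation_set_def)
        then have "p \<in> S" using f True F by blast
        then have "(indicator P p :: complex) - indicator S p = 0" using \<open>p \<in> P\<close> by simp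
        then have "comb_fun (comb_diff P P Ts) p = 0"
          using S(1) by (force simp: comb_fun_diff prod_list_zero_iff)
        then show ?thesis by simp
      qed
      moreover have "\<xi> \<in> ell2 P" using \<xi> by (rule ell2_mono) (auto simp: Delta_def)
      ultimately have "?b \<xi> = (\<lambda>p. 0)" by (simp add: mult_op_def fun_eq_iff)
      then show "ell2_norm (?b \<xi>) \<le> 0 * ell2_norm \<xi>" by simp
    qed simp
    show "0 \<le> op_norm_on (Delta G P F) ?b"
      using D_r_elem(3)[OF D] by (rule op_norm_nonneg) (auto simp: Delta_def)
  qed
  moreover have "finite ?F" "?F \<subseteq> carrier G" using f by auto
  ultimately have "\<forall>\<^sub>F F in finite_subsets_at_top (carrier G). op_norm_on (Delta G P F) ?b = 0"
    unfolding eventually_finite_subsets_at_top by blast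
  then have "((\<lambda>F. op_norm_on (Delta G P F) ?b) \<longlongrightarrow> 0) (finite_subsets_at_top (carrier G))"
    by (rule tendsto_eventually)
  then show ?thesis using D by (simp add: D_r_o_def)
qed

text \<open>Families are compared coordinate by coordinate. At strongly covariant coordinates the
  product is the image of an element of \<open>D_r_o\<close>, hence zero; at the coordinate of the
  regular representation it is not.\<close>

lemma q_u_not_injective:
  assumes C: "\<forall>R\<in>C. R \<noteq> P" "foundation_set G P P C"
  shows "\<not> inj_on (q_u G P) (carrier (toeplitz_algebra G P))"
proof
  assume inj: "inj_on (q_u G P) (carrier (toeplitz_algebra G P))"
  let ?T = "toeplitz_algebra G P" and ?t = "universal_gen P (toeplitz_rel G P)"
  interpret T: cstar_algebra ?T by (rule toeplitz_algebra(1))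
  have CJ: "finite C" "C \<subseteq> \<J>" using C by (auto simp: foundation_set_def)
  obtain f where f: "\<And>S. S \<in> C \<Longrightarrow> f S \<in> neutral_words G P \<and> K_ideal G P (f S) = S"
    using constructible_neutral CJ by (metis subsetD)
  obtain Ts where Ts: "set Ts = C" using finite_list[OF CJ(1)] by blast
  define \<beta>s where "\<beta>s = map f Ts"
  have \<beta>s: "set \<beta>s \<subseteq> neutral_words G P" using f by (auto simp: \<beta>s_def Ts)
  then have words: "set \<beta>s \<subseteq> words P" using neutral_wordsD by blast
  have K: "map (K_ideal G P) \<beta>s = Ts" using f by (auto simp: \<beta>s_def Ts intro!: map_idI)
  let ?L = "comb_diff P P Ts" and ?x = "defect ?T ?t \<beta>s"
  have x: "?x \<in> carrier ?T" by (rule defect_closed[OF toeplitz_algebra(1,2) words])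
  have eval: "?x (B, w) = comb_val B E ?L"
    if "(B, w) \<in> reps P (toeplitz_rel G P)" "meet_rep B \<J> P E"
      "\<And>\<alpha>. \<alpha> \<in> neutral_words G P \<Longrightarrow> word_op B w \<alpha> = E (K_ideal G P \<alpha>)" for B w E
  proof -
    have "cstar_algebra B" using that(1) by (simp add: reps_def)
    then have "?x (B, w) = defect B w \<beta>s"
      using hom_defect[OF toeplitz_algebra(1) _ toeplitz_algebra(3)[OF that(1)] _ toeplitz_algebra(2) words]
        toeplitz_algebra_one_zero(1)[OF that(1)] toeplitz_algebra(4)[OF that(1)] by simp
    then show ?thesis using defect_eq_comb_val[OF that(2,3) \<beta>s] K by simp
  qed
  have L: "?L \<in> combs \<J>" if "meet_rep B \<J> P E" for B :: "'a universe cstar" and E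
    using meet_rep.diff_combs[OF that constructible_P] CJ Ts by simp
  have "q_u G P ?x = q_u G P \<zero>\<^bsub>?T\<^esub>"
  proof -
    have "?x i = \<zero>\<^bsub>?T\<^esub> i" if "i \<in> reps P (strongly_covariant G P)" for i
    proof -
      obtain B w where i: "i = (B, w)" by (cases i)
      have B: "cstar_algebra B" "w \<in> P \<rightarrow> carrier B" "strongly_covariant G P B w"
        using that by (auto simp: i reps_def)
      then have r: "(B, w) \<in> reps P (toeplitz_rel G P)"
        using strongly_covariant_imp_toeplitz by (simp add: reps_def)
      obtain \<phi> where \<phi>: "\<forall>b\<in>D_r_o G P. \<phi> b = \<zero>\<^bsub>B\<^esub>" "meet_rep B \<J> P (\<phi> \<circ> indicator_op P)"
        "\<And>\<alpha>. \<alpha> \<in> neutral_words G P \<Longrightarrow> word_op B w \<alpha> = (\<phi> \<circ> indicator_op P) (K_ideal G P \<alpha>)"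
        "\<And>L. L \<in> combs \<J> \<Longrightarrow> comb_val B (\<phi> \<circ> indicator_op P) L = \<phi> (mult_op P (comb_fun L)) \<and>
           mult_op P (comb_fun L) \<in> carrier (D_r G P)"
        using strongly_covariantD[OF B(1,3)] by blast
      have "?x i = comb_val B (\<phi> \<circ> indicator_op P) ?L"
        unfolding i by (rule eval[OF r \<phi>(2)]) (rule \<phi>(3))
      also have "\<dots> = \<phi> (mult_op P (comb_fun ?L))"
        using \<phi>(4)[OF L[OF \<phi>(2)]] by (rule conjunct1)
      also have "\<dots> = \<zero>\<^bsub>B\<^esub>"
        using \<phi>(1) foundation_comb_in_D_r_o[of Ts] C(2) Ts \<phi>(4)[OF L[OF \<phi>(2)]] by simp
      finally show ?thesis using toeplitz_algebra_one_zero(2)[OF r] i by simp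
    qed
    then have "restrict ?x (reps P (strongly_covariant G P)) = restrict \<zero>\<^bsub>?T\<^esub> (reps P (strongly_covariant G P))"
      by (rule restrict_ext)
    then show ?thesis using x by (simp add: q_u_def)
  qed
  then have 0: "?x = \<zero>\<^bsub>?T\<^esub>" using inj x by (simp add: inj_on_eq_iff)
  obtain B :: "'a universe cstar" and w E where B: "cstar_algebra B" "w \<in> P \<rightarrow> carrier B" "toeplitz_rel G P B w"
    and E: "meet_rep B \<J> P E" "\<And>\<alpha>. \<alpha> \<in> neutral_words G P \<Longrightarrow> word_op B w \<alpha> = E (K_ideal G P \<alpha>)"
    and faithful: "\<And>L. L \<in> combs \<J> \<Longrightarrow> comb_val B E L = \<zero>\<^bsub>B\<^esub> \<Longrightarrow> (\<forall>p\<in>P. comb_fun L p = 0)"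
    using regular_copy by blast
  have r: "(B, w) \<in> reps P (toeplitz_rel G P)" using B by (simp add: reps_def)
  have "comb_val B E ?L = \<zero>\<^bsub>B\<^esub>" using eval[OF r E] 0 toeplitz_algebra_one_zero(2)[OF r] by simp
  \<comment> \<open>At the identity the product equals 1 unless some member of C contains the
    identity, and such a member would be all of P.\<close>
  then have "comb_fun ?L \<one> = 0" using faithful L[OF E(1)] by simp
  then obtain S where "S \<in> C" "\<one> \<in> S"
    using Ts by (auto simp: comb_fun_diff prod_list_zero_iff indicator_def split: if_splits)
  then show False using one_mem_constructible C(1) CJ by blast
qed

end

theorem corollary6p17:
  fixes G :: "'g monoid" and P :: "'g set"
  assumes "group G" and "submonoid P G"
  shows "(star_iso (toeplitz_algebra G P) (covariance_algebra G P) (q_u G P) \<longleftrightarrow>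
            \<not> (\<exists>C. (\<forall>R\<in>C. R \<noteq> P) \<and> foundation_set G P P C)) \<and>
         (\<not> (\<exists>C. (\<forall>R\<in>C. R \<noteq> P) \<and> foundation_set G P P C) \<longleftrightarrow>
            (\<forall>S\<in>constructible G P. S \<noteq> {} \<longrightarrow> \<not> (\<exists>C. proper_foundation_set G P S C)))"
proof -
  interpret group_submonoid G P
    by (intro group_submonoid.intro group_submonoid_axioms.intro assms)
  have "star_iso (toeplitz_algebra G P) (covariance_algebra G P) (q_u G P)"
    if "\<not> (\<exists>C. (\<forall>R\<in>C. R \<noteq> P) \<and> foundation_set G P P C)"
    using that foundation_iff_proper_foundation by (intro q_u_iso) blast
  moreover have "\<not> star_iso (toeplitz_algebra G P) (covariance_algebra G P) (q_u G P)"
    if "\<exists>C. (\<forall>R\<in>C. R \<noteq> P) \<and> foundation_set G P P C"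
    using that q_u_not_injective by (auto simp: star_iso_def bij_betw_def)
  ultimately show ?thesis using foundation_iff_proper_foundation by blast
qed

end
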